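(* The operator $\mathbb G$ defined in the context is an extension of the operator $G=-\Delta_{x'}-|x'|^2\Delta_{x''}$ with domain $C_c^\infty(\mathbb R^d)\subset L^2(\mathbb R^d)$; that is, $C_c^\infty(\mathbb R^d)\subset\mathrm{Dom}\,\mathbb G$ and $\mathbb G\varphi=G\varphi$ for every $\varphi\in C_c^\infty(\mathbb R^d)$.
   Context: Let $d',d''\ge1$ be integers, $d=d'+d''$, and write $x=(x',x'')\in\mathbb R^d=\mathbb R^{d'}\times\mathbb R^{d''}$; $\Delta_{x'},\Delta_{x''}$ are the Laplacians on $\mathbb R^{d'},\mathbb R^{d''}$. Put $\mathbb R^{d''}_0=\mathbb R^{d''}\setminus\{0\}$, $\mathbb N=\{0,1,2,\dots\}$, and $|k|=k_1+\dots+k_{d'}$ for $k\in\mathbb N^{d'}$. Hermite functions: $h_n(u)=(2^n n!\sqrt\pi)^{-1/2}H_n(u)e^{-u^2/2}$ on $\mathbb R$ ($H_n$ the Hermite polynomials), $h_k(x')=\prod_{j=1}^{d'}h_{k_j}(x'_j)$ for $k\in\mathbb N^{d'}$, and $h_{k,\tau}(x')=\tau^{d'/4}h_k(\tau^{1/2}x')$ for $\tau>0$; for each $\tau>0$ the family $\{h_{k,\tau}\}_k$ is an orthonormal basis of $L^2(\mathbb R^{d'})$. For $\xi''\in\mathbb R^{d''}_0$ and $g\in L^2(\mathbb R^{d'})$, $\mathcal H^{sc}_{\xi''}g(k)=\langle g,h_{k,|\xi''|}\rangle_{L^2(\mathbb R^{d'})}$. $\mathcal F''$ is the unitary Fourier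 transform on $L^2(\mathbb R^{d''})$, given for integrable functions by $\mathcal F''g(\xi'')=(2\pi)^{-d''/2}\int g(x'')e^{-i\xi''\cdot x''}dx''$. $L^2(\Gamma)=L^2(\mathbb N^{d'}\times\mathbb R^{d''})$ with respect to counting measure times Lebesgue measure. For $f\in L^2(\mathbb R^d)$, with $f_{x'}=f(x',\cdot)$, $\mathcal Gf(k,\xi'')=\mathcal H^{sc}_{\xi''}[x'\mapsto\mathcal F''f_{x'}(\xi'')](k)$. The map $\mathcal G:L^2(\mathbb R^d)\to L^2(\Gamma)$ is a unitary bijection with inverse $\mathcal G^{-1}$. Let $\Theta(k,\xi'')=(2|k|+d')|\xi''|$ on $\mathbb N^{d'}\times\mathbb R^{d''}_0$, and let $\mathbb M_\Theta$ be the multiplication operator $\mathbb M_\Theta F=\Theta F$ with domain $\mathrm{Dom}\,\mathbb M_\Theta=\{F\in L^2(\Gamma):\Theta F\in L^2(\Gamma)\}$. Define $$\mathrm{Dom}\,\mathbb G=\{f\in L^2(\mathbb R^d):\Theta\,\mathcal Gf\in L^2(\Gamma)\},\qquad \mathbb G=\mathcal G^{-1}\circ\mathbb M_\Theta\circ\mathcal G.$$ *)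

theory Defs
  imports "HOL-Analysis.Analysis"
begin

text \<open>
  Elements of an \<open>L\<^sup>2\<close> space are represented by square-integrable complex functions;
  equality in \<open>L\<^sup>2\<close> is equality almost everywhere. The operators on \<open>L\<^sup>2\<close> that are only
  determined up to null sets return an arbitrary representative, chosen by
  Hilbert choice.

  The spaces \<open>\<real>\<^bsup>d'\<^esup>\<close> and \<open>\<real>\<^bsup>d''\<^esup>\<close> are \<open>real ^ 'm\<close> and \<open>real ^ 'n\<close>, so that
  \<open>d' = CARD('m) \<ge> 1\<close> and \<open>d'' = CARD('n) \<ge> 1\<close>; their product is the type of pairs, and
  multi-indices are elements of \<open>nat ^ 'm\<close>.
\<close>

definition L2 :: "'a measure \<Rightarrow> ('a \<Rightarrow> complex) set" where
  "L2 M = {f \<in> borel_measurable M. integrable M (\<lambda>x. (cmod (f x))\<^sup>2)}"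

definition L2_inner :: "'a measure \<Rightarrow> ('a \<Rightarrow> complex) \<Rightarrow> ('a \<Rightarrow> complex) \<Rightarrow> complex" where
  "L2_inner M f g = (LINT x|M. f x * cnj (g x))"

text \<open>The squared distance is extended-valued, hence infinite when \<open>f - g\<close> is not
  square-integrable (a Bochner integral would give \<open>0\<close> there).\<close>

definition L2_dist_sq :: "'a measure \<Rightarrow> ('a \<Rightarrow> complex) \<Rightarrow> ('a \<Rightarrow> complex) \<Rightarrow> ennreal" where
  "L2_dist_sq M f g = (\<integral>\<^sup>+x. ennreal ((cmod (f x - g x))\<^sup>2) \<partial>M)"

subsection \<open>Smooth functions and the differential operator\<close>

primrec Ck :: "nat \<Rightarrow> ('a::euclidean_space \<Rightarrow> complex) \<Rightarrow> bool" where
  "Ck 0 f \<longleftrightarrow> continuous_on UNIV f"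
| "Ck (Suc k) f \<longleftrightarrow>
     (\<forall>x. f differentiable (at x)) \<and> (\<forall>v. Ck k (\<lambda>x. frechet_derivative f (at x) v))"

definition Cc_infinity :: "('a::euclidean_space \<Rightarrow> complex) set" where
  "Cc_infinity = {f. (\<forall>k. Ck k f) \<and> compact (closure {x. f x \<noteq> 0})}"

definition partial_deriv ::
    "'a::euclidean_space \<Rightarrow> ('a \<Rightarrow> complex) \<Rightarrow> 'a \<Rightarrow> complex" where
  "partial_deriv b f x = vector_derivative (\<lambda>t. f (x + t *\<^sub>R b)) (at 0)"

definition laplacian :: "('a::euclidean_space \<Rightarrow> complex) \<Rightarrow> 'a \<Rightarrow> complex" where
  "laplacian f x = (\<Sum>b\<in>Basis. partial_deriv b (partial_deriv b f) x)"

definition grushin ::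
    "((real ^ 'm) \<times> (real ^ 'n) \<Rightarrow> complex) \<Rightarrow> (real ^ 'm) \<times> (real ^ 'n) \<Rightarrow> complex" where
  "grushin f = (\<lambda>(x', x''). - laplacian (\<lambda>y'. f (y', x'')) x'
      - complex_of_real ((norm x')\<^sup>2) * laplacian (\<lambda>y''. f (x', y'')) x'')"

subsection \<open>Hermite functions\<close>

text \<open>Rodrigues' formula for the (physicists') Hermite polynomials, which is the convention
  matching the normalising factor \<open>(2\<^sup>n n! \<surd>\<pi>)\<^bsup>-1/2\<^esup>\<close>.\<close>

definition hermite_poly :: "nat \<Rightarrow> real \<Rightarrow> real" where
  "hermite_poly n u = (- 1) ^ n * exp (u\<^sup>2) * (deriv ^^ n) (\<lambda>v. exp (- v\<^sup>2)) u"

definition hermite1 :: "nat \<Rightarrow> real \<Rightarrow> real" where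
  "hermite1 n u = (2 ^ n * fact n * sqrt pi) powr (- 1 / 2) * hermite_poly n u * exp (- u\<^sup>2 / 2)"

definition hermite :: "nat ^ 'm \<Rightarrow> real ^ 'm \<Rightarrow> real" where
  "hermite k x' = (\<Prod>j\<in>UNIV. hermite1 (k $ j) (x' $ j))"

definition hermite_scaled :: "nat ^ 'm \<Rightarrow> real \<Rightarrow> real ^ 'm \<Rightarrow> real" where
  "hermite_scaled k \<tau> x' = \<tau> powr (real CARD('m) / 4) * hermite k (sqrt \<tau> *\<^sub>R x')"

definition hermite_transform ::
    "real ^ 'n \<Rightarrow> (real ^ 'm \<Rightarrow> complex) \<Rightarrow> nat ^ 'm \<Rightarrow> complex" where
  "hermite_transform \<xi>'' g k =
     L2_inner lborel g (\<lambda>x'. complex_of_real (hermite_scaled k (norm \<xi>'') x'))"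

subsection \<open>The unitary Fourier transform\<close>

definition fourier_integral :: "(real ^ 'n \<Rightarrow> complex) \<Rightarrow> real ^ 'n \<Rightarrow> complex" where
  "fourier_integral g \<xi> = complex_of_real ((2 * pi) powr (- real CARD('n) / 2)) *
     (LINT x|lborel. g x * exp (- \<i> * complex_of_real (\<xi> \<bullet> x)))"

text \<open>Extension by continuity from \<open>L\<^sup>1 \<inter> L\<^sup>2\<close> to \<open>L\<^sup>2\<close>.\<close>

definition is_fourier_L2 :: "(real ^ 'n \<Rightarrow> complex) \<Rightarrow> (real ^ 'n \<Rightarrow> complex) \<Rightarrow> bool" where
  "is_fourier_L2 g h \<longleftrightarrow> g \<in> L2 lborel \<and> h \<in> L2 lborel \<and>
     (\<exists>gs :: nat \<Rightarrow> real ^ 'n \<Rightarrow> complex.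
        (\<forall>j. gs j \<in> L2 lborel \<and> integrable lborel (gs j)) \<and>
        (\<lambda>j. L2_dist_sq lborel (gs j) g) \<longlonglongrightarrow> 0 \<and>
        (\<lambda>j. L2_dist_sq lborel (fourier_integral (gs j)) h) \<longlonglongrightarrow> 0)"

definition fourier_L2 :: "(real ^ 'n \<Rightarrow> complex) \<Rightarrow> real ^ 'n \<Rightarrow> complex" where
  "fourier_L2 g = (SOME h. is_fourier_L2 g h)"

text \<open>The function \<open>(x', \<xi>'') \<mapsto> \<F>'' f\<^bsub>x'\<^esub> (\<xi>'')\<close>. Choosing representatives of
  \<open>\<F>'' f\<^bsub>x'\<^esub>\<close> separately for each \<open>x'\<close> need not give a function measurable in \<open>x'\<close>, so
  one representative is chosen in \<open>L\<^sup>2(\<real>\<^sup>d)\<close>; it is unique up to null sets.\<close>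

definition partial_fourier ::
    "((real ^ 'm) \<times> (real ^ 'n) \<Rightarrow> complex) \<Rightarrow> (real ^ 'm) \<times> (real ^ 'n) \<Rightarrow> complex" where
  "partial_fourier f = (SOME u. u \<in> L2 lborel \<and>
     (AE x' in lborel. AE \<xi>'' in lborel. u (x', \<xi>'') = fourier_L2 (\<lambda>x''. f (x', x'')) \<xi>''))"

subsection \<open>The transform to \<open>L\<^sup>2(\<Gamma>)\<close> and the multiplication operator\<close>

text \<open>Functions on \<open>\<Gamma>\<close> are defined on all of \<open>nat ^ 'm \<times> real ^ 'n\<close>; the points with
  \<open>\<xi>'' = 0\<close> form a null set.\<close>

definition Gamma_measure :: "((nat ^ 'm) \<times> (real ^ 'n)) measure" where
  "Gamma_measure = count_space UNIV \<Otimes>\<^sub>M lborel"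

definition G_transform ::
    "((real ^ 'm) \<times> (real ^ 'n) \<Rightarrow> complex) \<Rightarrow> (nat ^ 'm) \<times> (real ^ 'n) \<Rightarrow> complex" where
  "G_transform f = (\<lambda>(k, \<xi>''). hermite_transform \<xi>'' (\<lambda>x'. partial_fourier f (x', \<xi>'')) k)"

definition G_transform_inv ::
    "((nat ^ 'm) \<times> (real ^ 'n) \<Rightarrow> complex) \<Rightarrow> (real ^ 'm) \<times> (real ^ 'n) \<Rightarrow> complex" where
  "G_transform_inv F =
     (SOME f. f \<in> L2 lborel \<and> (AE p in Gamma_measure. G_transform f p = F p))"

definition Theta :: "(nat ^ 'm) \<times> (real ^ 'n) \<Rightarrow> real" where
  "Theta = (\<lambda>(k, \<xi>''). (2 * real (\<Sum>j\<in>UNIV. k $ j) + real CARD('m)) * norm \<xi>'')"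

definition mult_Theta ::
    "((nat ^ 'm) \<times> (real ^ 'n) \<Rightarrow> complex) \<Rightarrow> (nat ^ 'm) \<times> (real ^ 'n) \<Rightarrow> complex" where
  "mult_Theta F = (\<lambda>p. complex_of_real (Theta p) * F p)"

definition Dom_GG :: "((real ^ 'm) \<times> (real ^ 'n) \<Rightarrow> complex) set" where
  "Dom_GG = {f \<in> L2 lborel. mult_Theta (G_transform f) \<in> L2 Gamma_measure}"

definition GG ::
    "((real ^ 'm) \<times> (real ^ 'n) \<Rightarrow> complex) \<Rightarrow> (real ^ 'm) \<times> (real ^ 'n) \<Rightarrow> complex" where
  "GG = G_transform_inv \<circ> mult_Theta \<circ> G_transform"

end

theory Submission
  imports Defs "HOL-Probability.Characteristic_Functions" "HOL-Computational_Algebra.Polynomial"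
begin

text \<open>
  For a test function \<open>\<phi>\<close>, integrating by parts against \<open>h\<^bsub>k,|\<xi>''|\<^esub>(x') exp (-i \<xi>'' \<cdot> x'')\<close>, which
  is an eigenfunction of \<open>G\<close> with eigenvalue \<open>\<Theta>(k, \<xi>'')\<close>, gives \<open>\<G>(G \<phi>) = \<Theta> \<G> \<phi>\<close>. As \<open>\<G>\<close> is
  bounded (Plancherel and Bessel inequalities), \<open>\<Theta> \<G> \<phi>\<close> is square-integrable. As \<open>\<G>\<close> is
  injective, \<open>G \<phi>\<close> is the only preimage of \<open>\<Theta> \<G> \<phi>\<close>, so the Hilbert choice in \<open>\<G>\<^sup>-\<^sup>1\<close> must
  return it.

  Everything rests on the injectivity of the Fourier transform on \<open>L\<^sup>1\<close>, obtained by Gaussian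
  smoothing. It gives injectivity on \<open>L\<^sup>2\<close> through the multiplication formula, tested on
  translated Gaussians. It also gives completeness of the Hermite functions: if \<open>g\<close> is orthogonal
  to all of them, every Taylor coefficient of the Fourier transform of \<open>g exp (-\<tau> |x|\<^sup>2 / 2)\<close>
  vanishes. Of Plancherel's theorem only the inequality is needed: after Gaussian
  regularisation it is the AM-GM inequality under a double integral.
\<close>

section \<open>Gaussians on Euclidean space\<close>

text \<open>The definitions fix objects only up to null sets and through nested choices, and this
  shapes the argument. A choice returns something useful only when its predicate is satisfiable, so
  for \<open>partial_fourier\<close> a jointly measurable representative has to be built; afterwards
  a chosen function can be identified only almost everywhere. Statements about the transform
  therefore hold for almost every \<xi>'', with one null set for all k at once because multi-indices
  are countable. The frequency 0, where the dilation of the Hermite functions degenerates, is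
  discarded as a null set. Approximation in L2 is arranged with squared distances at most 4^(-j):
  their summability turns convergence on the product space into convergence on almost every
  slice.\<close>

lemma
  fixes f :: "'a::euclidean_space \<Rightarrow> real \<Rightarrow> 'c::{real_normed_field,banach,second_countable_topology}"
  assumes f: "\<And>b. b \<in> Basis \<Longrightarrow> integrable lborel (f b)"
  shows integrable_lborel_prod: "integrable lborel (\<lambda>x. \<Prod>b\<in>Basis. f b (x \<bullet> b))"
    and integral_lborel_prod:
      "(LINT x|lborel. (\<Prod>b\<in>Basis. f b (x \<bullet> b))) = (\<Prod>b\<in>Basis. integral\<^sup>L lborel (f b))"
proof -
  interpret product_sigma_finite "\<lambda>_::'a. lborel :: real measure"
    by standard
  have [measurable]: "f b \<in> borel_measurable borel" if "b \<in> Basis" for b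
    using borel_measurable_integrable[OF f[OF that]] by simp
  have m: "(\<lambda>x. \<Prod>b\<in>Basis. f b (x \<bullet> b)) \<in> borel_measurable borel"
    by measurable
  have inner: "(\<Sum>c\<in>Basis. g c *\<^sub>R c) \<bullet> b = g b" if "b \<in> Basis" for g :: "'a \<Rightarrow> real" and b
    using that by (simp add: inner_sum_left_Basis)
  have eq: "(\<Prod>b\<in>Basis. f b ((\<Sum>c\<in>Basis. g c *\<^sub>R c) \<bullet> b)) = (\<Prod>b\<in>Basis. f b (g b))"
    for g :: "'a \<Rightarrow> real"
    by (rule prod.cong) (simp_all add: inner)
  have T: "(\<lambda>g. \<Sum>b\<in>Basis. g b *\<^sub>R b) \<in> measurable (\<Pi>\<^sub>M b\<in>(Basis::'a set). lborel) borel"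
    by measurable
  note L = lborel_eq[where 'a = 'a]
  show "integrable lborel (\<lambda>x. \<Prod>b\<in>Basis. f b (x \<bullet> b))"
    unfolding L integrable_distr_eq[OF T m] eq
    by (rule product_integrable_prod) (simp_all add: f)
  show "(LINT x|lborel. (\<Prod>b\<in>Basis. f b (x \<bullet> b))) = (\<Prod>b\<in>Basis. integral\<^sup>L lborel (f b))"
    by (subst L, subst integral_distr[OF T m], unfold eq)
      (rule product_integral_prod, simp_all add: f)
qed

definition gauss :: "real \<Rightarrow> 'a::euclidean_space \<Rightarrow> real" where
  "gauss s x = exp (- (s * (norm x)\<^sup>2 / 2))"

lemma gauss_measurable [measurable]: "gauss s \<in> borel_measurable borel"
  unfolding gauss_def by measurable

lemma gauss_nonneg [simp]: "gauss s x \<ge> 0"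
  by (simp add: gauss_def)

lemma gauss_nonzero [simp]: "gauss s x \<noteq> 0"
  by (simp add: gauss_def)

lemma gauss_le_1: "s \<ge> 0 \<Longrightarrow> gauss s x \<le> 1"
  by (simp add: gauss_def)

lemma gauss_minus_commute: "gauss s (x - y) = gauss s (y - x)"
  by (simp add: gauss_def norm_minus_commute)

text \<open>Up to scaling this is the characteristic function of the standard normal distribution:
  the substitution x = \<open>sqrt s * t\<close> turns the weight exp (-s t^2 / 2) into exp (-x^2 /
  2).\<close>

lemma
  fixes s a :: real
  assumes s: "s > 0"
  shows integrable_gauss_exp_real:
      "integrable lborel (\<lambda>t::real. complex_of_real (exp (- (s * t\<^sup>2 / 2))) * exp (- \<i> * complex_of_real (a * t)))"
    and integral_gauss_exp_real:
      "(LINT t|lborel. complex_of_real (exp (- (s * t\<^sup>2 / 2))) * exp (- \<i> * complex_of_real (a * t)))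
        = complex_of_real (sqrt (2 * pi / s) * exp (- (a\<^sup>2 / (2 * s))))"
proof -
  define c where "c = sqrt s"
  have c: "c > 0" "c\<^sup>2 = s" using s by (simp_all add: c_def)
  \<comment> \<open>Chosen so that u (c t) = -a t; then u^2 / 2 = a^2 / (2 s) in the value of the
    integral.\<close>
  define u where "u = - (a / c)"
  let ?f = "\<lambda>t. complex_of_real (exp (- (t\<^sup>2 / 2))) * exp (\<i> * complex_of_real (u * t))"
  have char: "(LINT x|lborel. std_normal_density x *\<^sub>R exp (\<i> * complex_of_real (u * x)))
      = complex_of_real (exp (- u\<^sup>2 / 2))"
    using fun_cong[OF char_std_normal_distribution, of u]
    unfolding char_def by (subst (asm) integral_density) (auto)
  have int1: "integrable lborel (\<lambda>x. std_normal_density x *\<^sub>R exp (\<i> * complex_of_real (u * x)))"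
    by (rule Bochner_Integration.integrable_bound[of _ std_normal_density])
      (use integrable_std_normal_moment[of 0] in \<open>auto simp: norm_exp_eq_Re\<close>)
  have f_eq: "?f x = sqrt (2 * pi) *\<^sub>R (std_normal_density x *\<^sub>R exp (\<i> * complex_of_real (u * x)))" for x
    by (simp add: std_normal_density_def scaleR_conv_of_real)
  have int2: "integrable lborel ?f"
    unfolding f_eq by (rule integrable_scaleR_right[OF int1])
  have val2: "(LINT t|lborel. ?f t) = complex_of_real (sqrt (2 * pi) * exp (- u\<^sup>2 / 2))"
    unfolding f_eq integral_scaleR_right char by (simp add: scaleR_conv_of_real)
  have g_eq: "?f (0 + c * t) = complex_of_real (exp (- (s * t\<^sup>2 / 2))) * exp (- \<i> * complex_of_real (a * t))" for t
    using c by (simp add: u_def power_mult_distrib)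
  show "integrable lborel (\<lambda>t::real. complex_of_real (exp (- (s * t\<^sup>2 / 2))) * exp (- \<i> * complex_of_real (a * t)))"
    using lborel_integrable_real_affine[OF int2, of c 0] c unfolding g_eq by simp
  have "(LINT t|lborel. ?f t) = c *\<^sub>R (LINT t|lborel. complex_of_real (exp (- (s * t\<^sup>2 / 2))) * exp (- \<i> * complex_of_real (a * t)))"
    using lborel_integral_real_affine[of c ?f 0] c unfolding g_eq by simp
  then have "(LINT t|lborel. complex_of_real (exp (- (s * t\<^sup>2 / 2))) * exp (- \<i> * complex_of_real (a * t)))
      = (1 / c) *\<^sub>R complex_of_real (sqrt (2 * pi) * exp (- u\<^sup>2 / 2))"
    using c by (simp only: val2[symmetric]) simp
  also have "\<dots> = complex_of_real (sqrt (2 * pi / s) * exp (- (a\<^sup>2 / (2 * s))))"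
    using c by (simp add: u_def power_divide real_sqrt_divide c_def scaleR_conv_of_real)
  finally show "(LINT t|lborel. complex_of_real (exp (- (s * t\<^sup>2 / 2))) * exp (- \<i> * complex_of_real (a * t)))
        = complex_of_real (sqrt (2 * pi / s) * exp (- (a\<^sup>2 / (2 * s))))" .
qed

lemma gauss_exp_prod:
  fixes x \<xi> :: "'a::euclidean_space"
  shows "complex_of_real (gauss s x) * exp (- \<i> * complex_of_real (\<xi> \<bullet> x)) =
    (\<Prod>b\<in>Basis. complex_of_real (exp (- (s * (x \<bullet> b)\<^sup>2 / 2))) * exp (- \<i> * complex_of_real ((\<xi> \<bullet> b) * (x \<bullet> b))))"
proof -
  have "gauss s x = exp (\<Sum>b\<in>Basis. - (s * (x \<bullet> b)\<^sup>2 / 2))"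
    unfolding gauss_def norm_eq_sqrt_inner
    by (simp add: euclidean_inner[of x x] sum_nonneg power2_eq_square sum_negf sum_divide_distrib sum_distrib_left)
  moreover have "exp (- \<i> * complex_of_real (\<xi> \<bullet> x)) = exp (\<Sum>b\<in>Basis. - \<i> * complex_of_real ((\<xi> \<bullet> b) * (x \<bullet> b)))"
    by (simp only: euclidean_inner[of \<xi> x] of_real_sum sum_distrib_left)
  ultimately show ?thesis
    by (simp only: exp_sum finite_Basis of_real_prod prod.distrib)
qed

lemma
  fixes \<xi> :: "'a::euclidean_space"
  assumes s: "s > 0"
  shows integrable_gauss_exp:
      "integrable lborel (\<lambda>x::'a. complex_of_real (gauss s x) * exp (- \<i> * complex_of_real (\<xi> \<bullet> x)))"
    and integral_gauss_exp:
      "(LINT x|lborel. complex_of_real (gauss s x) * exp (- \<i> * complex_of_real (\<xi> \<bullet> x)))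
        = complex_of_real (sqrt (2 * pi / s) ^ DIM('a) * gauss (1 / s) \<xi>)"
proof -
  show "integrable lborel (\<lambda>x::'a. complex_of_real (gauss s x) * exp (- \<i> * complex_of_real (\<xi> \<bullet> x)))"
    unfolding gauss_exp_prod
    using integrable_gauss_exp_real[OF s]
    by (intro integrable_lborel_prod[where f = "\<lambda>b t. complex_of_real (exp (- (s * t\<^sup>2 / 2))) * exp (- \<i> * complex_of_real ((\<xi> \<bullet> b) * t))"])
  have "(LINT x|lborel. complex_of_real (gauss s x) * exp (- \<i> * complex_of_real (\<xi> \<bullet> x)))
      = (\<Prod>b\<in>Basis. complex_of_real (sqrt (2 * pi / s) * exp (- ((\<xi> \<bullet> b)\<^sup>2 / (2 * s)))))"
    unfolding gauss_exp_prod integral_gauss_exp_real[OF s, symmetric]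
    using integrable_gauss_exp_real[OF s]
    by (intro integral_lborel_prod[where f = "\<lambda>b t. complex_of_real (exp (- (s * t\<^sup>2 / 2))) * exp (- \<i> * complex_of_real ((\<xi> \<bullet> b) * t))"])
  also have "\<dots> = complex_of_real (sqrt (2 * pi / s) ^ DIM('a) * gauss (1 / s) \<xi>)"
  proof -
    have "(\<Prod>b\<in>Basis. exp (- ((\<xi> \<bullet> b)\<^sup>2 / (2 * s)))) = gauss (1 / s) \<xi>"
      unfolding gauss_def norm_eq_sqrt_inner
      by (simp add: euclidean_inner[of \<xi> \<xi>] sum_nonneg power2_eq_square sum_divide_distrib sum_negf mult.commute flip: exp_sum)
    then show ?thesis
      by (simp only: prod.distrib flip: of_real_prod) simp
  qed
  finally show "(LINT x|lborel. complex_of_real (gauss s x) * exp (- \<i> * complex_of_real (\<xi> \<bullet> x)))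
        = complex_of_real (sqrt (2 * pi / s) ^ DIM('a) * gauss (1 / s) \<xi>)" .
qed

lemma
  assumes s: "s > 0"
  shows integrable_gauss: "integrable lborel (gauss s :: 'a::euclidean_space \<Rightarrow> real)"
    and integral_gauss: "(LINT x|lborel. gauss s (x::'a)) = sqrt (2 * pi / s) ^ DIM('a)"
proof -
  show "integrable lborel (gauss s :: 'a::euclidean_space \<Rightarrow> real)"
    using integrable_Re[OF integrable_gauss_exp[OF s, of "0::'a"]] by simp
  show "(LINT x|lborel. gauss s (x::'a)) = sqrt (2 * pi / s) ^ DIM('a)"
    using integral_gauss_exp[OF s, of "0::'a"]
    by (simp add: gauss_def[of "1/s"] flip: of_real_power) 
qed

lemma nn_integral_gauss:
  "s > 0 \<Longrightarrow> (\<integral>\<^sup>+x. ennreal (gauss s x) \<partial>(lborel :: 'a::euclidean_space measure)) = ennreal (sqrt (2 * pi / s) ^ DIM('a))"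
  using integrable_gauss[where 'a = 'a] integral_gauss[where 'a='a] by (simp add: nn_integral_eq_integral)

lemma nn_integral_lborel_translate:
  fixes f :: "'a::euclidean_space \<Rightarrow> ennreal"
  assumes [measurable]: "f \<in> borel_measurable borel"
  shows "(\<integral>\<^sup>+x. f (c + x) \<partial>lborel) = (\<integral>\<^sup>+x. f x \<partial>lborel)"
proof -
  have "(\<integral>\<^sup>+x. f x \<partial>lborel) = (\<integral>\<^sup>+x. f x \<partial>distr lborel borel ((+) c))"
    by (simp add: lborel_distr_plus)
  then show ?thesis
    by (simp add: nn_integral_distr)
qed

text \<open>Fubini, with the exponential bounded by 1. The general measure \<open>M\<close> and map
  \<open>T\<close> allow three readings: the identity gives the usual formula,
  \<open>T p = p - y\<close> smooths by a translated Gaussian, and \<open>T (x, y) = x - y\<close>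
  on pairs turns |fint g|^2 into a double integral with a kernel in x - y.\<close>

lemma multiplication_formula:
  fixes \<gamma> :: "'a::euclidean_space \<Rightarrow> complex" and G :: "'b \<Rightarrow> complex" and T :: "'b \<Rightarrow> 'a"
  assumes M: "sigma_finite_measure M"
    and \<gamma>: "integrable lborel \<gamma>" and G: "integrable M G" and T[measurable]: "T \<in> borel_measurable M"
  shows "(LINT \<xi>|lborel. \<gamma> \<xi> * (LINT p|M. G p * exp (- \<i> * complex_of_real (\<xi> \<bullet> T p)))) =
    (LINT p|M. G p * (LINT \<xi>|lborel. \<gamma> \<xi> * exp (- \<i> * complex_of_real (T p \<bullet> \<xi>))))"
proof -
  interpret M: sigma_finite_measure M by fact
  interpret P: pair_sigma_finite "lborel :: 'a measure" M ..
  have [measurable]: "\<gamma> \<in> borel_measurable lborel" "G \<in> borel_measurable M"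
    using \<gamma> G by auto
  have i0: "integrable (lborel \<Otimes>\<^sub>M M) (\<lambda>(\<xi>, p). \<gamma> \<xi> * G p)"
  proof (rule P.Fubini_integrable)
    show "integrable lborel (\<lambda>x. LINT y|M. norm (case (x, y) of (\<xi>, p) \<Rightarrow> \<gamma> \<xi> * G p))"
      using \<gamma> by (simp add: norm_mult)
  qed (use G in auto)
  have i: "integrable (lborel \<Otimes>\<^sub>M M) (\<lambda>(\<xi>, p). \<gamma> \<xi> * (G p * exp (- \<i> * complex_of_real (\<xi> \<bullet> T p))))"
    by (rule Bochner_Integration.integrable_bound[OF i0])
      (auto simp: norm_mult norm_exp_eq_Re case_prod_beta)
  have "(LINT \<xi>|lborel. \<gamma> \<xi> * (LINT p|M. G p * exp (- \<i> * complex_of_real (\<xi> \<bullet> T p)))) =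
    (LINT \<xi>|lborel. (LINT p|M. \<gamma> \<xi> * (G p * exp (- \<i> * complex_of_real (\<xi> \<bullet> T p)))))"
    by simp
  also have "\<dots> = (LINT p|M. (LINT \<xi>|lborel. \<gamma> \<xi> * (G p * exp (- \<i> * complex_of_real (\<xi> \<bullet> T p)))))"
    using P.Fubini_integral[OF i] by simp
  also have "\<dots> = (LINT p|M. G p * (LINT \<xi>|lborel. \<gamma> \<xi> * exp (- \<i> * complex_of_real (T p \<bullet> \<xi>))))"
    by (simp add: mult.left_commute[of "\<gamma> _"] inner_commute)
  finally show ?thesis .
qed

section \<open>The Fourier transform of integrable functions\<close>

lemma cnj_borel_measurable [measurable]: "cnj \<in> borel_measurable borel"
  by (intro borel_measurable_continuous_onI continuous_intros)

text \<open>The Fourier integral without the factor (2 pi)^(-n/2), on any Euclidean space; the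
  constant would only clutter the Gaussian computations and returns in
  \<open>fourier_integral_eq\<close>.\<close>

definition fint :: "('a::euclidean_space \<Rightarrow> complex) \<Rightarrow> 'a \<Rightarrow> complex" where
  "fint g \<xi> = (LINT x|lborel. g x * exp (- \<i> * complex_of_real (\<xi> \<bullet> x)))"

lemma fint_measurable [measurable]:
  assumes [measurable]: "g \<in> borel_measurable borel"
  shows "fint g \<in> borel_measurable borel"
  unfolding fint_def by measurable

lemma integrable_mult_exp:
  fixes g :: "'a::euclidean_space \<Rightarrow> complex"
  assumes "integrable lborel g"
  shows "integrable lborel (\<lambda>x. g x * exp (- \<i> * complex_of_real (\<xi> \<bullet> x)))"
  by (rule Bochner_Integration.integrable_bound[OF assms]) 
    (use assms in \<open>auto simp: norm_mult norm_exp_eq_Re\<close>)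

lemma norm_fint_le:
  assumes "integrable lborel g"
  shows "cmod (fint g \<xi>) \<le> (LINT x|lborel. cmod (g x))"
  unfolding fint_def
  using integral_norm_bound[of lborel "\<lambda>x. g x * exp (- \<i> * complex_of_real (\<xi> \<bullet> x))"]
  by (simp add: norm_mult norm_exp_eq_Re)

lemma lborel_integral_affine:
  fixes f :: "'a::euclidean_space \<Rightarrow> 'b::{banach, second_countable_topology}"
  assumes [measurable]: "f \<in> borel_measurable borel" and r: "r \<noteq> 0"
  shows "(LINT y|lborel. f y) = \<bar>r\<bar> ^ DIM('a) *\<^sub>R (LINT z|lborel. f (x + r *\<^sub>R z))"
  by (subst lborel_affine[OF r, of x]) (simp add: integral_density integral_distr)

text \<open>A Gaussian is itself a Fourier transform, so the convolution of \<open>w\<close> with it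
  is, up to a constant, the integral of \<open>gauss (1 / s)\<close> against \<open>fint w\<close>
  times the phase that the translation by y produces.\<close>

lemma integral_mult_gauss_eq_0:
  fixes w :: "'a::euclidean_space \<Rightarrow> complex"
  assumes w: "integrable lborel w" and zero: "\<And>\<xi>. fint w \<xi> = 0" and s: "s > 0"
  shows "(LINT x|lborel. w x * complex_of_real (gauss s (x - y))) = 0"
proof -
  let ?\<gamma> = "\<lambda>\<xi>::'a. complex_of_real (gauss (1 / s) \<xi>)"
  have \<gamma>: "integrable lborel ?\<gamma>"
    using integrable_gauss[of "1 / s", where 'a = 'a] s by simp
  have "(LINT p|lborel. w p * exp (- \<i> * complex_of_real (\<xi> \<bullet> (p - y)))) = 0" for \<xi>
  proof -
    have "w p * exp (- \<i> * complex_of_real (\<xi> \<bullet> (p - y)))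
        = exp (\<i> * complex_of_real (\<xi> \<bullet> y)) * (w p * exp (- \<i> * complex_of_real (\<xi> \<bullet> p)))" for p
      by (simp add: inner_diff_right ring_distribs exp_diff exp_minus field_simps)
    then have "(LINT p|lborel. w p * exp (- \<i> * complex_of_real (\<xi> \<bullet> (p - y)))) =
        exp (\<i> * complex_of_real (\<xi> \<bullet> y)) * fint w \<xi>"
      by (simp only: fint_def integral_mult_right_zero)
    then show ?thesis
      by (simp add: zero)
  qed
  then have "(LINT p|lborel. w p * (LINT \<xi>|lborel. ?\<gamma> \<xi> * exp (- \<i> * complex_of_real ((p - y) \<bullet> \<xi>)))) = 0"
    using multiplication_formula[OF sigma_finite_lborel \<gamma> w, of "\<lambda>p. p - y"] by simp
  then have "(LINT p|lborel. complex_of_real (sqrt (2 * pi * s) ^ DIM('a)) * (w p * complex_of_real (gauss s (p - y)))) = 0"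
    using integral_gauss_exp[of "1 / s", where 'a = 'a] s by (simp add: ac_simps)
  then show ?thesis
    using s by (subst (asm) integral_mult_right_zero) simp
qed

text \<open>The indicator of a box is approximated by its convolutions with ever narrower Gaussians.
  Against each of them \<open>w\<close> integrates to 0 by Fubini and
  \<open>integral_mult_gauss_eq_0\<close>, and the limit is taken under the integral.\<close>

lemma integral_box_eq_0:
  fixes w :: "'a::euclidean_space \<Rightarrow> complex"
  assumes w: "integrable lborel w" and zero: "\<And>\<xi>. fint w \<xi> = 0"
  shows "(LINT x|lborel. indicator (box a b) x *\<^sub>R w x) = 0"
proof -
  let ?B = "box a b"
  have [measurable]: "w \<in> borel_measurable borel" using w by auto
  \<comment> \<open>The convolution after the substitution y = x + z / (n + 1): the Gaussian weight
    no longer depends on n and serves as dominating function. Its total mass \<open>C\<close> is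
    left unnormalised.\<close>
  define E :: "nat \<Rightarrow> 'a \<Rightarrow> real"
    where "E = (\<lambda>n x. LINT z|lborel. gauss 1 z * indicator ?B (x + (1 / real (Suc n)) *\<^sub>R z))"
  have [measurable]: "E n \<in> borel_measurable borel" for n
    unfolding E_def by measurable
  define C where "C = (LINT z|lborel. gauss 1 (z :: 'a))"
  have C: "C > 0"
    unfolding C_def by (simp add: integral_gauss)
  have E0: "(LINT x|lborel. w x * complex_of_real (E n x)) = 0" for n
  proof -
    \<comment> \<open>\<open>?s\<close> is the inverse square of \<open>?r\<close>, so
      \<open>gauss ?s\<close> at \<open>?r *\<^sub>R z\<close> is \<open>gauss 1 z\<close>.\<close>
    let ?r = "1 / real (Suc n)" and ?s = "(real (Suc n))\<^sup>2"
    let ?f = "\<lambda>(x, y). w x * complex_of_real (gauss ?s (x - y) * indicator ?B y)"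
    have K: "(LINT y|lborel. gauss ?s (x - y) * indicator ?B y) = ?r ^ DIM('a) * E n x" for x
    proof -
      have "(LINT y|lborel. gauss ?s (x - y) * indicator ?B y)
          = \<bar>?r\<bar> ^ DIM('a) *\<^sub>R (LINT z|lborel. gauss ?s (x - (x + ?r *\<^sub>R z)) * indicator ?B (x + ?r *\<^sub>R z))"
        by (rule lborel_integral_affine) auto
      moreover have "gauss ?s (x - (x + ?r *\<^sub>R z)) = gauss 1 z" for z
        by (simp add: gauss_def power_divide)
      ultimately show ?thesis
        by (simp add: E_def)
    qed
    have wB: "integrable lborel (\<lambda>y. indicator ?B y *\<^sub>R w x)" for x
      by (intro integrable_scaleR_left integrable_real_indicator) (auto simp: emeasure_lborel_box_eq)
    have int: "integrable (lborel \<Otimes>\<^sub>M lborel) ?f"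
    proof (rule Bochner_Integration.integrable_bound)
      show "integrable (lborel \<Otimes>\<^sub>M lborel) (\<lambda>(x, y). indicator ?B y *\<^sub>R w x)"
      proof (rule lborel_pair.Fubini_integrable)
        show "integrable lborel (\<lambda>x. LINT y|lborel. norm (case (x, y) of (x, y) \<Rightarrow> indicator ?B y *\<^sub>R w x))"
          using w by (simp add: norm_mult)
      qed (use wB in \<open>auto simp: case_prod_beta\<close>)
      show "AE p in lborel \<Otimes>\<^sub>M lborel. norm (?f p) \<le> norm (case p of (x, y) \<Rightarrow> indicator ?B y *\<^sub>R w x)"
        by (auto simp: norm_mult gauss_le_1 split: split_indicator intro!: mult_left_le AE_I2)
    qed measurable
    have eqf: "?f (x, y) = complex_of_real (indicator ?B y) * (w x * complex_of_real (gauss ?s (x - y)))" for x y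
      by (simp add: ac_simps)
    have "complex_of_real (?r ^ DIM('a)) * (LINT x|lborel. w x * complex_of_real (E n x)) = 
        (LINT x|lborel. w x * complex_of_real (?r ^ DIM('a) * E n x))"
      by (subst integral_mult_right_zero[symmetric]) (simp add: mult.left_commute)
    also have "\<dots> = (LINT x|lborel. (LINT y|lborel. ?f (x, y)))"
      unfolding K[symmetric] by (simp only: prod.case integral_mult_right_zero integral_complex_of_real)
    also have "\<dots> = (LINT y|lborel. (LINT x|lborel. ?f (x, y)))"
      using lborel_pair.Fubini_integral[of "\<lambda>x y. ?f (x, y)"] int by simp
    also have "\<dots> = (LINT y|lborel. complex_of_real (indicator ?B y) * (LINT x|lborel. w x * complex_of_real (gauss ?s (x - y))))"
      unfolding eqf by (simp only: integral_mult_right_zero)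
    also have "\<dots> = 0"
      by (subst integral_mult_gauss_eq_0[OF w zero]) auto
    finally show ?thesis by (simp del: of_nat_Suc)
  qed
  \<comment> \<open>At a boundary point the smoothed indicators need not tend to the indicator, so
    the null set between \<open>cbox a b\<close> and \<open>box a b\<close> is removed.\<close>
  have ae: "AE x in lborel. x \<in> cbox a b \<longrightarrow> x \<in> box a b"
  proof -
    have "cbox a b - box a b \<in> null_sets lborel"
      by (rule null_setsI)
        (auto simp: emeasure_Diff emeasure_lborel_box_eq emeasure_lborel_cbox_eq box_subset_cbox  
          intro!: emeasure_Diff)
    then show ?thesis
      by (rule AE_not_in[THEN AE_mp]) auto
  qed
  have lim: "AE x in lborel. (\<lambda>n. w x * complex_of_real (E n x)) \<longlonglongrightarrow> w x * complex_of_real (C * indicator ?B x)"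
    using ae
  proof eventually_elim
    fix x assume x: "x \<in> cbox a b \<longrightarrow> x \<in> box a b"
    have "(\<lambda>n. E n x) \<longlonglongrightarrow> (LINT z|lborel. gauss 1 (z :: 'a) * indicator ?B x)"
      unfolding E_def
    proof (rule integral_dominated_convergence[where w = "gauss 1 :: 'a \<Rightarrow> real"])
      show "AE z in lborel. (\<lambda>n. gauss 1 z * indicator ?B (x + (1 / real (Suc n)) *\<^sub>R z)) \<longlonglongrightarrow> gauss 1 z * indicator ?B x"
      proof (intro AE_I2 tendsto_mult tendsto_const)
        fix z :: 'a
        have l: "(\<lambda>n. x + (1 / real (Suc n)) *\<^sub>R z) \<longlonglongrightarrow> x + 0 *\<^sub>R z"
          using LIMSEQ_inverse_real_of_nat
          by (intro tendsto_intros) (simp add: inverse_eq_divide)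
        have "eventually (\<lambda>n. indicator ?B (x + (1 / real (Suc n)) *\<^sub>R z) = (indicator ?B x :: real)) sequentially"
        proof (cases "x \<in> ?B")
          case True
          then show ?thesis
            using topological_tendstoD[OF l open_box[of a b]] by (auto elim: eventually_mono)
        next
          case False
          then have "x \<in> - cbox a b" using x by auto
          then have "eventually (\<lambda>n. x + (1 / real (Suc n)) *\<^sub>R z \<in> - cbox a b) sequentially"
            using topological_tendstoD[OF l, of "- cbox a b"] by (simp add: open_Compl closed_cbox)
          then show ?thesis
            by (rule eventually_mono) (use False box_subset_cbox[of a b] in \<open>auto simp: indicator_def\<close>)
        qed
        then show "(\<lambda>n. indicator ?B (x + (1 / real (Suc n)) *\<^sub>R z)) \<longlonglongrightarrow> (indicator ?B x :: real)"
          by (rule tendsto_eventually)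
      qed
    qed (auto simp: integrable_gauss indicator_def)
    then have "(\<lambda>n. E n x) \<longlonglongrightarrow> C * indicator ?B x"
      by (simp add: C_def)
    then show "(\<lambda>n. w x * complex_of_real (E n x)) \<longlonglongrightarrow> w x * complex_of_real (C * indicator ?B x)"
      by (intro tendsto_intros)
  qed
  have E_le: "\<bar>E n x\<bar> \<le> C" for n x
  proof -
    have "\<bar>E n x\<bar> \<le> (LINT z|lborel. \<bar>gauss 1 z * indicator ?B (x + (1 / real (Suc n)) *\<^sub>R z)\<bar>)"
      unfolding E_def by (rule integral_abs_bound)
    also have "\<dots> \<le> C"
      unfolding C_def
      by (rule integral_mono')
        (auto simp: integrable_gauss indicator_def)
    finally show ?thesis .
  qed
  have "(\<lambda>n. LINT x|lborel. w x * complex_of_real (E n x)) \<longlonglongrightarrow> (LINT x|lborel. w x * complex_of_real (C * indicator ?B x))"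
    by (rule integral_dominated_convergence[where w = "\<lambda>x. C * cmod (w x)", OF _ _ _ lim])
      (use w E_le in \<open>auto simp: norm_mult mult.commute[of C] intro!: mult_left_mono AE_I2\<close>)
  then have "(LINT x|lborel. w x * complex_of_real (C * indicator ?B x)) = 0"
    unfolding E0 by (simp add: LIMSEQ_const_iff)
  also have "(\<lambda>x. w x * complex_of_real (C * indicator ?B x)) = (\<lambda>x. complex_of_real C * (indicator ?B x *\<^sub>R w x))"
    by (auto simp: indicator_def)
  finally show ?thesis
    using C by (subst (asm) integral_mult_right_zero) simp
qed

text \<open>Boxes are closed under intersection and generate the Borel sets, so the vanishing of the
  integrals over boxes extends to every Borel set, which forces a density to vanish almost
  everywhere.\<close>

theorem fourier_L1_injective:
  fixes w :: "'a::euclidean_space \<Rightarrow> complex"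
  assumes w: "integrable lborel w" and zero: "\<And>\<xi>. fint w \<xi> = 0"
  shows "AE x in lborel. w x = 0"
proof (rule sigma_finite_measure.density_zero[OF sigma_finite_lborel w])
  fix A :: "'a set" assume "A \<in> sets lborel"
  then have A: "A \<in> sigma_sets UNIV (range (\<lambda>(a, b). box a b))"
    unfolding sets_lborel borel_eq_box by simp
  have st: "Int_stable (range (\<lambda>(a, b). box a b :: 'a set))"
    by (auto simp: Int_stable_def box_Int_box)
  have sub: "range (\<lambda>(a, b). box a b :: 'a set) \<subseteq> Pow UNIV"
    by simp
  from st sub A show "set_lebesgue_integral lborel A w = 0"
  proof (induction rule: sigma_sets_induct_disjoint)
    case (basic A)
    then show ?case
      using integral_box_eq_0[OF w zero] by (auto simp: set_lebesgue_integral_def)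
  next
    case empty
    show ?case by (simp add: set_lebesgue_integral_def)
  next
    case (compl A)
    then have A: "A \<in> sets lborel" unfolding sets_lborel borel_eq_box by simp
    have "set_lebesgue_integral lborel (A \<union> (UNIV - A)) w = set_lebesgue_integral lborel A w + set_lebesgue_integral lborel (UNIV - A) w"
      by (rule set_integral_Un) (use A w in \<open>auto simp: set_integrable_def intro!: integrable_mult_indicator\<close>)
    \<comment> \<open>Complements reduce to the integral over the whole space, which is the value of
      \<open>fint w\<close> at frequency 0.\<close>
    moreover have "set_lebesgue_integral lborel UNIV w = 0"
      using zero[of 0] by (simp add: fint_def set_lebesgue_integral_def)
    ultimately show ?case
      using compl by simp
  next
    case (union A)
    then have A: "A i \<in> sets lborel" for i unfolding sets_lborel borel_eq_box by auto
    show ?case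
    proof (subst lebesgue_integral_countable_add)
      show "set_integrable lborel (\<Union> (range A)) w"
        using A w by (auto simp: set_integrable_def intro!: integrable_mult_indicator)
    qed (use A union in \<open>auto simp: disjoint_family_on_def\<close>)
  qed
qed

text \<open>The weight \<open>gauss t\<close> makes the integral of |fint g|^2 finite and turns it
  into a double integral of g(x) times the conjugate of g(y) against a Gaussian kernel in x - y.
  After |g(x)| |g(y)| \<le> (|g(x)|^2 + |g(y)|^2) / 2 one variable integrates out, leaving the mass
  of the kernel, which is the same for every t. Fatou's lemma then removes the weight. The right
  side may be infinite.\<close>

lemma nn_integral_fint_le:
  fixes g :: "'a::euclidean_space \<Rightarrow> complex"
  assumes g: "integrable lborel g"
  shows "(\<integral>\<^sup>+\<xi>. ennreal ((cmod (fint g \<xi>))\<^sup>2) \<partial>lborel) \<le> ennreal ((2 * pi) ^ DIM('a)) * (\<integral>\<^sup>+x. ennreal ((cmod (g x))\<^sup>2) \<partial>lborel)"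
proof -
  let ?P = "lborel \<Otimes>\<^sub>M lborel :: ('a \<times> 'a) measure"
  let ?G = "\<lambda>(x, y). g x * cnj (g y)"
  let ?T = "\<lambda>(x, y). x - y"
  let ?I = "\<integral>\<^sup>+x. ennreal ((cmod (g x))\<^sup>2) \<partial>lborel"
  have [measurable]: "g \<in> borel_measurable borel" using g by auto
  have G: "integrable ?P ?G"
  proof (rule lborel_pair.Fubini_integrable)
    show "integrable lborel (\<lambda>x. LINT y|lborel. norm (?G (x, y)))"
      using g by (simp add: norm_mult)
  qed (use g in \<open>auto simp: case_prod_beta\<close>)
  have sf: "sigma_finite_measure ?P"
    by (simp add: lborel_prod sigma_finite_lborel)
  have sq: "(LINT p|?P. ?G p * exp (- \<i> * complex_of_real (\<xi> \<bullet> ?T p))) = complex_of_real ((cmod (fint g \<xi>))\<^sup>2)" for \<xi>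
  proof -
    let ?e = "\<lambda>x. g x * exp (- \<i> * complex_of_real (\<xi> \<bullet> x))"
    have eq: "?G p * exp (- \<i> * complex_of_real (\<xi> \<bullet> ?T p)) = (case p of (x, y) \<Rightarrow> ?e x * cnj (?e y))" for p
      by (cases p) (simp add: exp_cnj inner_diff_right ring_distribs exp_diff exp_minus field_simps)
    have "integrable ?P (\<lambda>(x, y). ?e x * cnj (?e y))"
      by (rule Bochner_Integration.integrable_bound[OF G])
        (auto simp: norm_mult norm_exp_eq_Re)
    then have "(LINT p|?P. (case p of (x, y) \<Rightarrow> ?e x * cnj (?e y))) = (LINT x|lborel. (LINT y|lborel. ?e x * cnj (?e y)))"
      using lborel_pair.integral_fst'[of "\<lambda>(x, y). ?e x * cnj (?e y)"] by simp
    also have "\<dots> = fint g \<xi> * cnj (fint g \<xi>)"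
      by (simp only: integral_mult_right_zero integral_mult_left_zero Bochner_Integration.integral_cnj fint_def)
    finally show ?thesis
      unfolding eq by (simp only: complex_norm_square)
  qed
  have bound: "(\<integral>\<^sup>+\<xi>. ennreal (gauss t \<xi> * (cmod (fint g \<xi>))\<^sup>2) \<partial>lborel) \<le> ennreal ((2 * pi) ^ DIM('a)) * ?I"
    if t: "t > 0" for t
  proof -
    let ?c = "sqrt (2 * pi / t) ^ DIM('a)"
    let ?k = "\<lambda>p. ?c * gauss (1 / t) (?T p)"
    \<comment> \<open>\<open>g\<close> is only integrable here: boundedness of \<open>fint g\<close>
      together with the Gaussian weight gives integrability.\<close>
    have int: "integrable lborel (\<lambda>\<xi>. gauss t \<xi> * (cmod (fint g \<xi>))\<^sup>2)"
    proof (rule Bochner_Integration.integrable_bound)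
      show "integrable lborel (\<lambda>\<xi>::'a. gauss t \<xi> * (LINT x|lborel. cmod (g x))\<^sup>2)"
        using integrable_gauss[OF t, where 'a = 'a] by simp
      show "AE \<xi> in lborel. norm (gauss t \<xi> * (cmod (fint g \<xi>))\<^sup>2) \<le> norm (gauss t \<xi> * (LINT x|lborel. cmod (g x))\<^sup>2)"
        using norm_fint_le[OF g] by (auto simp: abs_mult intro!: mult_left_mono power_mono)
    qed measurable
    have "integrable lborel (\<lambda>\<xi>::'a. complex_of_real (gauss t \<xi>))"
      using integrable_gauss[OF t, where 'a = 'a] by simp
    from multiplication_formula[OF sf this G, of ?T]
    have "(LINT \<xi>|lborel. complex_of_real (gauss t \<xi>) * complex_of_real ((cmod (fint g \<xi>))\<^sup>2))
        = (LINT p|?P. ?G p * complex_of_real (?k p))"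
      unfolding sq integral_gauss_exp[OF t, where 'a = 'a] by simp
    then have eq: "complex_of_real (LINT \<xi>|lborel. gauss t \<xi> * (cmod (fint g \<xi>))\<^sup>2) = (LINT p|?P. ?G p * complex_of_real (?k p))"
      by (simp only: of_real_mult[symmetric] integral_complex_of_real)
    have k: "0 \<le> ?k p" "?k p \<le> ?c" for p
      using t by (auto intro!: mult_left_le gauss_le_1 simp: case_prod_beta)
    have Gk: "integrable ?P (\<lambda>p. ?G p * complex_of_real (?k p))"
    proof (rule Bochner_Integration.integrable_bound)
      show "integrable ?P (\<lambda>p. complex_of_real ?c * ?G p)"
        using G by (rule integrable_mult_right)
      show "AE p in ?P. norm (?G p * complex_of_real (?k p)) \<le> norm (complex_of_real ?c * ?G p)"
      proof (rule AE_I2)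
        fix p
        show "norm (?G p * complex_of_real (?k p)) \<le> norm (complex_of_real ?c * ?G p)"
          unfolding norm_mult norm_of_real mult.commute[of "cmod (?G p)"]
          using k[of p] t by (intro mult_right_mono) auto
      qed
    qed measurable
    have half: "(\<integral>\<^sup>+x. (\<integral>\<^sup>+y. ennreal ((cmod (g x))\<^sup>2) * ennreal (gauss (1 / t) (x - y)) \<partial>lborel) \<partial>lborel)
        = ennreal (sqrt (2 * pi * t) ^ DIM('a)) * ?I"
    proof -
      have "(\<integral>\<^sup>+y. ennreal (gauss (1 / t) (x - y)) \<partial>lborel) = ennreal (sqrt (2 * pi * t) ^ DIM('a))" for x :: 'a
        using nn_integral_lborel_translate[of "\<lambda>y. ennreal (gauss (1 / t) y)" "- x"] nn_integral_gauss[of "1 / t", where 'a = 'a] t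
        by (simp add: gauss_minus_commute[of _ x])
      then show ?thesis
        by (simp add: nn_integral_cmult nn_integral_multc mult.commute)
    qed
    have half': "(\<integral>\<^sup>+x. (\<integral>\<^sup>+y. ennreal ((cmod (g y))\<^sup>2) * ennreal (gauss (1 / t) (y - x)) \<partial>lborel) \<partial>lborel)
        = ennreal (sqrt (2 * pi * t) ^ DIM('a)) * ?I"
      unfolding half[symmetric] by (rule lborel_pair.Fubini') measurable
    \<comment> \<open>The mass of the kernel \<open>?k\<close> in one variable is (2 pi / t)^(d/2)
      times (2 pi t)^(d/2), where t cancels. The 2 collects the two halves of the AM-GM bound and
      cancels its 1/2.\<close>
    have const: "ennreal (?c / 2) * (2 * ennreal (sqrt (2 * pi * t) ^ DIM('a))) = ennreal ((2 * pi) ^ DIM('a))"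
    proof -
      have "?c * sqrt (2 * pi * t) ^ DIM('a) = (sqrt (2 * pi / t) * sqrt (2 * pi * t)) ^ DIM('a)"
        by (simp only: power_mult_distrib)
      also have "sqrt (2 * pi / t) * sqrt (2 * pi * t) = 2 * pi"
        using t real_sqrt_abs2[of "2 * pi"] by (simp flip: real_sqrt_mult)
      finally have eq: "?c / 2 * (2 * sqrt (2 * pi * t) ^ DIM('a)) = (2 * pi) ^ DIM('a)"
        by simp
      have "ennreal (?c / 2) * (2 * ennreal (sqrt (2 * pi * t) ^ DIM('a)))
          = ennreal (?c / 2 * (2 * sqrt (2 * pi * t) ^ DIM('a)))"
        using t by (subst ennreal_mult; simp add: ennreal_mult)
      then show ?thesis
        unfolding eq .
    qed
    have "(\<integral>\<^sup>+\<xi>. ennreal (gauss t \<xi> * (cmod (fint g \<xi>))\<^sup>2) \<partial>lborel) = ennreal (LINT \<xi>|lborel. gauss t \<xi> * (cmod (fint g \<xi>))\<^sup>2)"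
      using int by (intro nn_integral_eq_integral) auto
    also have "\<dots> \<le> ennreal (norm (LINT p|?P. ?G p * complex_of_real (?k p)))"
      unfolding eq[symmetric] by (intro ennreal_leI) simp
    also have "\<dots> \<le> (\<integral>\<^sup>+p. ennreal (norm (?G p * complex_of_real (?k p))) \<partial>?P)"
      by (rule integral_norm_bound_ennreal[OF Gk])
    also have "\<dots> \<le> (\<integral>\<^sup>+p. ennreal (?c / 2) * (case p of (x, y) \<Rightarrow> ennreal ((cmod (g x))\<^sup>2) * ennreal (gauss (1 / t) (x - y)) +
        ennreal ((cmod (g y))\<^sup>2) * ennreal (gauss (1 / t) (y - x))) \<partial>?P)"
    proof (rule nn_integral_mono)
      fix p :: "'a \<times> 'a"
      obtain x y where p: "p = (x, y)" by (cases p)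
      have am: "cmod (g x) * cmod (g y) \<le> ((cmod (g x))\<^sup>2 + (cmod (g y))\<^sup>2) / 2"
        using sum_squares_bound[of "cmod (g x)" "cmod (g y)"] by simp
      have "norm (?G p * complex_of_real (?k p)) = (cmod (g x) * cmod (g y)) * ?k p"
        using k(1)[of p] t by (simp add: p norm_mult norm_power)
      also have "\<dots> \<le> ((cmod (g x))\<^sup>2 + (cmod (g y))\<^sup>2) / 2 * ?k p"
        by (rule mult_right_mono[OF am k(1)])
      also have "\<dots> = ?c / 2 * ((cmod (g x))\<^sup>2 * gauss (1 / t) (x - y) + (cmod (g y))\<^sup>2 * gauss (1 / t) (y - x))"
        by (simp add: p gauss_minus_commute[of _ y x] field_simps)
      finally show "ennreal (norm (?G p * complex_of_real (?k p))) \<le> ennreal (?c / 2) * (case p of (x, y) \<Rightarrow> ennreal ((cmod (g x))\<^sup>2) * ennreal (gauss (1 / t) (x - y)) +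
        ennreal ((cmod (g y))\<^sup>2) * ennreal (gauss (1 / t) (y - x)))"
        using t by (simp add: p ennreal_leI flip: ennreal_mult ennreal_plus)
    qed
    also have "\<dots> = ennreal (?c / 2) * ((\<integral>\<^sup>+x. (\<integral>\<^sup>+y. ennreal ((cmod (g x))\<^sup>2) * ennreal (gauss (1 / t) (x - y)) \<partial>lborel) \<partial>lborel) +
        (\<integral>\<^sup>+x. (\<integral>\<^sup>+y. ennreal ((cmod (g y))\<^sup>2) * ennreal (gauss (1 / t) (y - x)) \<partial>lborel) \<partial>lborel))"
      by (simp add: nn_integral_cmult nn_integral_add case_prod_beta flip: lborel.nn_integral_fst)
    also have "\<dots> = ennreal (?c / 2) * (ennreal (sqrt (2 * pi * t) ^ DIM('a)) * ?I + ennreal (sqrt (2 * pi * t) ^ DIM('a)) * ?I)"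
      unfolding half' half ..
    also have "\<dots> = ennreal (?c / 2) * (2 * ennreal (sqrt (2 * pi * t) ^ DIM('a))) * ?I"
      by (simp only: mult.assoc mult_2[symmetric])
    also have "\<dots> = ennreal ((2 * pi) ^ DIM('a)) * ?I"
      unfolding const ..
    finally show ?thesis .
  qed
  \<comment> \<open>Weights with t = 1 / (n + 1), which increase to 1.\<close>
  let ?g = "\<lambda>n \<xi>. ennreal (gauss (1 / real (Suc n)) \<xi> * (cmod (fint g \<xi>))\<^sup>2)"
  have "ennreal ((cmod (fint g \<xi>))\<^sup>2) = liminf (\<lambda>n. ?g n \<xi>)" for \<xi>
  proof -
    have "(\<lambda>n. ?g n \<xi>) \<longlonglongrightarrow> ennreal (exp (- (0 * (norm \<xi>)\<^sup>2 / 2)) * (cmod (fint g \<xi>))\<^sup>2)"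
      unfolding gauss_def using LIMSEQ_inverse_real_of_nat
      by (intro tendsto_ennrealI tendsto_intros) (simp_all add: inverse_eq_divide)
    then show ?thesis
      by (subst lim_imp_Liminf) simp_all
  qed
  then have "(\<integral>\<^sup>+\<xi>. ennreal ((cmod (fint g \<xi>))\<^sup>2) \<partial>lborel) = (\<integral>\<^sup>+\<xi>. liminf (\<lambda>n. ?g n \<xi>) \<partial>lborel)"
    by simp
  also have "\<dots> \<le> liminf (\<lambda>n. \<integral>\<^sup>+\<xi>. ?g n \<xi> \<partial>lborel)"
    by (rule nn_integral_liminf) measurable
  also have "\<dots> \<le> ennreal ((2 * pi) ^ DIM('a)) * ?I"
    by (intro Liminf_le always_eventually allI bound) simp_all
  finally show ?thesis .
qed

section \<open>Square-integrable functions and their Fourier transforms\<close>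

text \<open>The squared norm as an extended real: membership in \<open>L2\<close> becomes
  measurability plus finiteness, and Tonelli, Fatou and limits apply to it directly.\<close>

definition L2_nsq :: "'a measure \<Rightarrow> ('a \<Rightarrow> complex) \<Rightarrow> ennreal" where
  "L2_nsq M f = (\<integral>\<^sup>+x. ennreal ((cmod (f x))\<^sup>2) \<partial>M)"

lemma L2_iff: "f \<in> L2 M \<longleftrightarrow> f \<in> borel_measurable M \<and> L2_nsq M f < \<infinity>"
  by (auto simp: L2_def L2_nsq_def integrable_iff_bounded)

lemma L2_measurable: "f \<in> L2 M \<Longrightarrow> f \<in> borel_measurable M"
  by (simp add: L2_def)

lemma L2_nsq_finite: "f \<in> L2 M \<Longrightarrow> L2_nsq M f < \<infinity>"
  by (simp add: L2_iff)

lemma L2_dist_sq_eq: "L2_dist_sq M f g = L2_nsq M (\<lambda>x. f x - g x)"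
  by (simp add: L2_dist_sq_def L2_nsq_def)

lemma L2_dist_sq_commute: "L2_dist_sq M f g = L2_dist_sq M g f"
  by (simp add: L2_dist_sq_def norm_minus_commute)

lemma L2_nsq_cong_AE: "AE x in M. f x = g x \<Longrightarrow> L2_nsq M f = L2_nsq M g"
  unfolding L2_nsq_def by (rule nn_integral_cong_AE) auto

lemma L2_cong_AE:
  "f \<in> L2 M \<Longrightarrow> g \<in> borel_measurable M \<Longrightarrow> AE x in M. f x = g x \<Longrightarrow> g \<in> L2 M"
  using L2_nsq_cong_AE[of f g M] by (auto simp: L2_iff)

lemma L2_nsq_mono: "(\<And>x. cmod (f x) \<le> cmod (g x)) \<Longrightarrow> L2_nsq M f \<le> L2_nsq M g"
  unfolding L2_nsq_def by (intro nn_integral_mono ennreal_leI power_mono) auto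

lemma L2_nsq_eq_0_iff:
  "f \<in> borel_measurable M \<Longrightarrow> L2_nsq M f = 0 \<longleftrightarrow> (AE x in M. f x = 0)"
  unfolding L2_nsq_def by (subst nn_integral_0_iff_AE) (auto simp: ennreal_eq_0_iff)

lemma L2_nsq_cmult: "f \<in> borel_measurable M \<Longrightarrow> L2_nsq M (\<lambda>x. c * f x) = ennreal ((cmod c)\<^sup>2) * L2_nsq M f"
  unfolding L2_nsq_def norm_mult power_mult_distrib by (simp add: ennreal_mult nn_integral_cmult)

text \<open>Lets the triangle inequality be used for squared norms without square roots; the factor
  2 is immaterial for finiteness and for convergence to 0.\<close>

lemma cmod_add_sq_le: "(cmod (a + b))\<^sup>2 \<le> 2 * (cmod a)\<^sup>2 + 2 * (cmod b)\<^sup>2"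
proof -
  have "(cmod (a + b))\<^sup>2 \<le> (cmod a + cmod b)\<^sup>2"
    by (intro power_mono norm_triangle_ineq) simp
  also have "\<dots> \<le> 2 * (cmod a)\<^sup>2 + 2 * (cmod b)\<^sup>2"
    using sum_squares_bound[of "cmod a" "cmod b"] by (simp add: power2_sum)
  finally show ?thesis .
qed

lemma L2_nsq_add_le:
  assumes [measurable]: "f \<in> borel_measurable M" "g \<in> borel_measurable M"
  shows "L2_nsq M (\<lambda>x. f x + g x) \<le> 2 * L2_nsq M f + 2 * L2_nsq M g"
proof -
  have "L2_nsq M (\<lambda>x. f x + g x) \<le> (\<integral>\<^sup>+x. 2 * ennreal ((cmod (f x))\<^sup>2) + 2 * ennreal ((cmod (g x))\<^sup>2) \<partial>M)"
    unfolding L2_nsq_def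
  proof (rule nn_integral_mono)
    fix x
    show "ennreal ((cmod (f x + g x))\<^sup>2) \<le> 2 * ennreal ((cmod (f x))\<^sup>2) + 2 * ennreal ((cmod (g x))\<^sup>2)"
      using ennreal_leI[OF cmod_add_sq_le[of "f x" "g x"]] by (simp add: ennreal_plus ennreal_mult)
  qed
  also have "\<dots> = 2 * L2_nsq M f + 2 * L2_nsq M g"
    by (simp add: L2_nsq_def nn_integral_add nn_integral_cmult)
  finally show ?thesis .
qed

lemma L2_dist_sq_triangle:
  assumes [measurable]: "f \<in> borel_measurable M" "g \<in> borel_measurable M" "h \<in> borel_measurable M"
  shows "L2_dist_sq M f h \<le> 2 * L2_dist_sq M f g + 2 * L2_dist_sq M g h"
  using L2_nsq_add_le[of "\<lambda>x. f x - g x" M "\<lambda>x. g x - h x"] by (simp add: L2_dist_sq_eq)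

lemma L2_add: "f \<in> L2 M \<Longrightarrow> g \<in> L2 M \<Longrightarrow> (\<lambda>x. f x + g x) \<in> L2 M"
  using L2_nsq_add_le[of f M g]
  by (auto simp: L2_iff ennreal_mult_less_top intro: order.strict_trans1)

lemma L2_cmult: "f \<in> L2 M \<Longrightarrow> (\<lambda>x. c * f x) \<in> L2 M"
  by (auto simp: L2_iff L2_nsq_cmult ennreal_mult_less_top)

lemma L2_diff: "f \<in> L2 M \<Longrightarrow> g \<in> L2 M \<Longrightarrow> (\<lambda>x. f x - g x) \<in> L2 M"
  using L2_add[of f M "\<lambda>x. (-1) * g x"] L2_cmult[of g M "-1"] by simp

lemma L2_dominated:
  "g \<in> L2 M \<Longrightarrow> f \<in> borel_measurable M \<Longrightarrow> (\<And>x. cmod (f x) \<le> cmod (g x)) \<Longrightarrow> f \<in> L2 M"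
  using L2_nsq_mono[of f g M] by (auto simp: L2_iff)

lemma L2_integrable_mult:
  assumes f: "f \<in> L2 M" and g: "g \<in> L2 M"
  shows "integrable M (\<lambda>x. f x * g x)"
proof (rule Bochner_Integration.integrable_bound)
  show "integrable M (\<lambda>x. (cmod (f x))\<^sup>2 + (cmod (g x))\<^sup>2)"
    using f g by (simp add: L2_def)
  show "AE x in M. norm (f x * g x) \<le> norm ((cmod (f x))\<^sup>2 + (cmod (g x))\<^sup>2)"
  proof (rule AE_I2)
    fix x
    have "cmod (f x) * cmod (g x) \<le> (cmod (f x))\<^sup>2 + (cmod (g x))\<^sup>2"
      using sum_squares_bound[of "cmod (f x)" "cmod (g x)"] mult_nonneg_nonneg[OF norm_ge_zero norm_ge_zero, of "f x" "g x"]
      by linarith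
    then show "norm (f x * g x) \<le> norm ((cmod (f x))\<^sup>2 + (cmod (g x))\<^sup>2)"
      by (simp add: norm_mult)
  qed
qed (use f g in \<open>auto simp: L2_def\<close>)

text \<open>Cauchy-Schwarz, kept squared so that it speaks of \<open>L2_dist_sq\<close>; the root is
  taken only of the real sequence at the end.\<close>

lemma L2_tendsto_integral_mult:
  assumes f: "f \<in> L2 M" and fs: "\<And>j. fs j \<in> L2 M" and g: "g \<in> L2 M"
    and lim: "(\<lambda>j. L2_dist_sq M (fs j) f) \<longlonglongrightarrow> 0"
  shows "(\<lambda>j::nat. LINT x|M. fs j x * g x) \<longlonglongrightarrow> (LINT x|M. f x * g x)"
proof -
  have [measurable]: "f \<in> borel_measurable M" "g \<in> borel_measurable M" "\<And>j. fs j \<in> borel_measurable M"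
    using f fs g by (auto simp: L2_measurable)
  let ?d = "\<lambda>j. (LINT x|M. fs j x * g x) - (LINT x|M. f x * g x)"
  have bound: "ennreal ((cmod (?d j))\<^sup>2) \<le> L2_dist_sq M (fs j) f * L2_nsq M g" for j
  proof -
    have "?d j = (LINT x|M. (fs j x - f x) * g x)"
      using L2_integrable_mult[OF fs g] L2_integrable_mult[OF f g]
      by (simp add: left_diff_distrib)
    then have "ennreal (cmod (?d j)) \<le> (\<integral>\<^sup>+x. ennreal (cmod ((fs j x - f x) * g x)) \<partial>M)"
      using integral_norm_bound_ennreal[OF L2_integrable_mult[OF L2_diff[OF fs f] g]] by simp
    then have "(ennreal (cmod (?d j)))\<^sup>2 \<le> (\<integral>\<^sup>+x. ennreal (cmod (fs j x - f x)) * ennreal (cmod (g x)) \<partial>M)\<^sup>2"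
      by (intro power_mono) (simp_all add: norm_mult ennreal_mult)
    also have "\<dots> \<le> (\<integral>\<^sup>+x. (ennreal (cmod (fs j x - f x)))\<^sup>2 \<partial>M) * (\<integral>\<^sup>+x. (ennreal (cmod (g x)))\<^sup>2 \<partial>M)"
      by (rule Cauchy_Schwarz_nn_integral) measurable
    finally show ?thesis
      by (simp add: L2_dist_sq_def L2_nsq_def ennreal_power)
  qed
  have "(\<lambda>j. ennreal ((cmod (?d j))\<^sup>2)) \<longlonglongrightarrow> 0"
  proof (rule tendsto_sandwich[OF _ _ tendsto_const])
    have "(\<lambda>j. L2_nsq M g * L2_dist_sq M (fs j) f) \<longlonglongrightarrow> L2_nsq M g * 0"
      using L2_nsq_finite[OF g] lim by (intro ennreal_tendsto_cmult) auto
    then show "(\<lambda>j. L2_dist_sq M (fs j) f * L2_nsq M g) \<longlonglongrightarrow> 0"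
      by (simp add: mult.commute)
  qed (use bound in auto)
  then have "(\<lambda>j. (cmod (?d j))\<^sup>2) \<longlonglongrightarrow> 0"
    by (intro tendsto_ennrealD[of _ 0]) simp_all
  then have "(\<lambda>j. cmod (?d j)) \<longlonglongrightarrow> 0"
    using tendsto_real_sqrt[of "\<lambda>j. (cmod (?d j))\<^sup>2" 0] by simp
  then show ?thesis
    by (simp add: LIM_zero_iff tendsto_norm_zero_iff)
qed

text \<open>With this rate \<open>\<Sum>j. 2\<^sup>j \<bar>v\<^bsub>j+1\<^esub> - v\<^bsub>j\<^esub>\<bar>\<^sup>2\<close> is finite almost everywhere, so that the whole
  sequence converges pointwise and no subsequence is needed.\<close>

lemma L2_complete:
  fixes v :: "nat \<Rightarrow> 'a \<Rightarrow> complex"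
  assumes v[measurable]: "\<And>j. v j \<in> borel_measurable M"
    and cauchy: "\<And>i j. j \<le> i \<Longrightarrow> L2_dist_sq M (v i) (v j) \<le> ennreal ((1 / 4) ^ j)"
  obtains u where "u \<in> borel_measurable M" "\<And>j. L2_dist_sq M (v j) u \<le> ennreal ((1 / 4) ^ j)"
proof
  define u where "u = (\<lambda>x. lim (\<lambda>j. v j x))"
  show u[measurable]: "u \<in> borel_measurable M"
    unfolding u_def by (rule borel_measurable_lim_metric) (rule v)
  let ?S = "\<lambda>x. \<Sum>j. ennreal (2 ^ j * (cmod (v (Suc j) x - v j x))\<^sup>2)"
  have "(\<integral>\<^sup>+x. ?S x \<partial>M) = (\<Sum>j. \<integral>\<^sup>+x. ennreal (2 ^ j * (cmod (v (Suc j) x - v j x))\<^sup>2) \<partial>M)"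
    by (rule nn_integral_suminf) measurable
  also have "\<dots> = (\<Sum>j. ennreal (2 ^ j) * L2_dist_sq M (v (Suc j)) (v j))"
    by (simp add: L2_dist_sq_def ennreal_mult nn_integral_cmult)
  also have "\<dots> \<le> (\<Sum>j. ennreal ((1 / 2) ^ j))"
  proof (rule suminf_le)
    fix j
    have "ennreal (2 ^ j) * L2_dist_sq M (v (Suc j)) (v j) \<le> ennreal (2 ^ j) * ennreal ((1 / 4) ^ j)"
      by (intro mult_left_mono cauchy) auto
    also have "\<dots> = ennreal ((1 / 2) ^ j)"
      by (simp flip: ennreal_mult power_mult_distrib)
    finally show "ennreal (2 ^ j) * L2_dist_sq M (v (Suc j)) (v j) \<le> ennreal ((1 / 2) ^ j)" .
  qed auto
  also have "\<dots> < \<infinity>"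
    by (subst suminf_ennreal2) (auto simp: summable_geometric)
  finally have "AE x in M. ?S x \<noteq> \<infinity>"
    by (intro nn_integral_PInf_AE) auto
  then have lim: "AE x in M. (\<lambda>j. v j x) \<longlonglongrightarrow> u x"
  proof eventually_elim
    fix x assume S: "?S x \<noteq> \<infinity>"
    define R where "R = enn2real (?S x)"
    have R: "?S x = ennreal R" "R \<ge> 0"
      using S by (auto simp: R_def less_top)
    have d: "cmod (v (Suc j) x - v j x) \<le> sqrt R * (1 / sqrt 2) ^ j" for j
    proof -
      define F where "F = (\<lambda>j. ennreal (2 ^ j * (cmod (v (Suc j) x - v j x))\<^sup>2))"
      have "sum F {j} \<le> suminf F"
        by (rule sum_le_suminf) auto
      then have "ennreal (2 ^ j * (cmod (v (Suc j) x - v j x))\<^sup>2) \<le> ennreal R"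
        unfolding R(1)[symmetric] F_def by simp
      then have "2 ^ j * (cmod (v (Suc j) x - v j x))\<^sup>2 \<le> R"
        using R by (simp only: ennreal_le_iff)
      then have "(cmod (v (Suc j) x - v j x))\<^sup>2 \<le> R * (1 / 2) ^ j"
        by (simp add: power_divide field_simps)
      then have "sqrt ((cmod (v (Suc j) x - v j x))\<^sup>2) \<le> sqrt (R * (1 / 2) ^ j)"
        by (rule real_sqrt_le_mono)
      then show ?thesis
        by (simp add: real_sqrt_mult real_sqrt_divide real_sqrt_power)
    qed
    have "summable (\<lambda>j. v (Suc j) x - v j x)"
    proof (rule summable_comparison_test')
      show "summable (\<lambda>j. sqrt R * (1 / sqrt 2) ^ j)"
        by (intro summable_mult summable_geometric) simp
    qed (use d in auto)
    then have "convergent (\<lambda>n. \<Sum>j<n. v (Suc j) x - v j x)"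
      by (simp add: summable_iff_convergent)
    then have "convergent (\<lambda>n. v 0 x + (\<Sum>j<n. v (Suc j) x - v j x))"
      by (intro convergent_add convergent_const)
    then have "convergent (\<lambda>n. v n x)"
      by (simp add: sum_lessThan_telescope[of "\<lambda>j. v j x"])
    then show "(\<lambda>j. v j x) \<longlonglongrightarrow> u x"
      unfolding u_def by (simp add: convergent_LIMSEQ_iff)
  qed
  show "L2_dist_sq M (v j) u \<le> ennreal ((1 / 4) ^ j)" for j
  proof -
    have "L2_dist_sq M (v j) u = (\<integral>\<^sup>+x. liminf (\<lambda>i. ennreal ((cmod (v i x - v j x))\<^sup>2)) \<partial>M)"
      unfolding L2_dist_sq_def
    proof (rule nn_integral_cong_AE)
      show "AE x in M. ennreal ((cmod (v j x - u x))\<^sup>2) = liminf (\<lambda>i. ennreal ((cmod (v i x - v j x))\<^sup>2))"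
        using lim
      proof eventually_elim
        fix x assume "(\<lambda>j. v j x) \<longlonglongrightarrow> u x"
        then have "(\<lambda>i. ennreal ((cmod (v i x - v j x))\<^sup>2)) \<longlonglongrightarrow> ennreal ((cmod (u x - v j x))\<^sup>2)"
          by (intro tendsto_intros tendsto_ennrealI)
        then show "ennreal ((cmod (v j x - u x))\<^sup>2) = liminf (\<lambda>i. ennreal ((cmod (v i x - v j x))\<^sup>2))"
          unfolding norm_minus_commute[of "v j x" "u x"] by (rule lim_imp_Liminf[OF sequentially_bot, symmetric])
      qed
    qed
    also have "\<dots> \<le> liminf (\<lambda>i. L2_dist_sq M (v i) (v j))"
      unfolding L2_dist_sq_def by (rule nn_integral_liminf) measurable
    also have "\<dots> \<le> ennreal ((1 / 4) ^ j)"
      using cauchy by (intro Liminf_le eventually_sequentiallyI[of j]) auto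
    finally show ?thesis .
  qed
qed

section \<open>The Fourier transform on L2: contraction, uniqueness and injectivity\<close>

lemma fourier_integral_eq: "fourier_integral g \<xi> = complex_of_real ((2 * pi) powr (- real CARD('n) / 2)) * fint g (\<xi> :: real ^ 'n)"
  by (simp add: fourier_integral_def fint_def)

lemma fourier_integral_measurable [measurable]:
  "g \<in> borel_measurable borel \<Longrightarrow> fourier_integral g \<in> borel_measurable borel"
  unfolding fourier_integral_eq[abs_def] by measurable

text \<open>The squared normalising factor (2 pi)^(-n) exactly cancels the constant (2 pi)^n of
  \<open>nn_integral_fint_le\<close>.\<close>

lemma L2_nsq_fourier_integral_le:
  fixes g :: "real ^ 'n \<Rightarrow> complex"
  assumes g: "integrable lborel g"
  shows "L2_nsq lborel (fourier_integral g) \<le> L2_nsq lborel g"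
proof -
  let ?c = "(2 * pi) powr (- real CARD('n) / 2)"
  have [measurable]: "g \<in> borel_measurable borel" using g by auto
  have c: "?c\<^sup>2 * (2 * pi) ^ CARD('n) = 1"
  proof -
    have "?c\<^sup>2 = (2 * pi) powr (- real CARD('n))"
      by (simp add: power2_eq_square flip: powr_add)
    moreover have "(2 * pi) ^ CARD('n) = (2 * pi) powr (real CARD('n))"
      by (simp add: powr_realpow)
    ultimately show ?thesis
      by (simp flip: powr_add)
  qed
  have "L2_nsq lborel (fourier_integral g) = ennreal (?c\<^sup>2) * L2_nsq lborel (fint g)"
    unfolding fourier_integral_eq[abs_def] by (subst L2_nsq_cmult) auto
  also have "\<dots> \<le> ennreal (?c\<^sup>2) * (ennreal ((2 * pi) ^ CARD('n)) * L2_nsq lborel g)"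
    using nn_integral_fint_le[OF g] by (intro mult_left_mono) (auto simp: L2_nsq_def)
  also have "\<dots> = L2_nsq lborel g"
    using c by (simp flip: mult.assoc ennreal_mult)
  finally show ?thesis .
qed

lemma fourier_integral_L2: "integrable lborel g \<Longrightarrow> g \<in> L2 lborel \<Longrightarrow> fourier_integral g \<in> L2 lborel"
  using L2_nsq_fourier_integral_le[of g] by (auto simp: L2_iff intro: order.strict_trans1)

lemma fourier_integral_diff:
  assumes "integrable lborel f" "integrable lborel g"
  shows "fourier_integral (\<lambda>x. f x - g x) \<xi> = fourier_integral f \<xi> - fourier_integral g \<xi>"
  using integrable_mult_exp[OF assms(1), of \<xi>] integrable_mult_exp[OF assms(2), of \<xi>]
  by (simp add: fourier_integral_def left_diff_distrib right_diff_distrib)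

lemma L2_dist_sq_fourier_integral_le:
  assumes "integrable lborel f" "integrable lborel g"
  shows "L2_dist_sq lborel (fourier_integral f) (fourier_integral g) \<le> L2_dist_sq lborel f g"
  unfolding L2_dist_sq_eq fourier_integral_diff[OF assms, symmetric]
  by (rule L2_nsq_fourier_integral_le) (use assms in auto)

lemma is_fourier_L2_fourier_integral:
  "integrable lborel g \<Longrightarrow> g \<in> L2 lborel \<Longrightarrow> is_fourier_L2 g (fourier_integral g)"
  unfolding is_fourier_L2_def
  by (auto simp: fourier_integral_L2 L2_dist_sq_def intro!: exI[of _ "\<lambda>_. g"])

lemma is_fourier_L2_cong_AE:
  assumes F: "is_fourier_L2 g h" and h': "h' \<in> borel_measurable lborel" and ae: "AE \<xi> in lborel. h \<xi> = h' \<xi>"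
  shows "is_fourier_L2 g h'"
proof -
  have "L2_dist_sq lborel k h = L2_dist_sq lborel k h'" for k
    unfolding L2_dist_sq_eq by (rule L2_nsq_cong_AE) (use ae in auto)
  then show ?thesis
    using F L2_cong_AE[OF _ h' ae] by (auto simp: is_fourier_L2_def)
qed

text \<open>Two approximating sequences of the same g come close to each other; by the contraction
  property so do their Fourier integrals, and hence \<open>h1\<close> and \<open>h2\<close> are at
  distance 0.\<close>

lemma is_fourier_L2_unique:
  assumes 1: "is_fourier_L2 g h1" and 2: "is_fourier_L2 g h2"
  shows "AE \<xi> in lborel. h1 \<xi> = h2 \<xi>"
proof -
  obtain g1 where g1: "\<And>j. g1 j \<in> L2 lborel" "\<And>j. integrable lborel (g1 j)"
      "(\<lambda>j. L2_dist_sq lborel (g1 j) g) \<longlonglongrightarrow> 0" "(\<lambda>j. L2_dist_sq lborel (fourier_integral (g1 j)) h1) \<longlonglongrightarrow> 0"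
    using 1 by (auto simp: is_fourier_L2_def)
  obtain g2 where g2: "\<And>j. g2 j \<in> L2 lborel" "\<And>j. integrable lborel (g2 j)"
      "(\<lambda>j. L2_dist_sq lborel (g2 j) g) \<longlonglongrightarrow> 0" "(\<lambda>j. L2_dist_sq lborel (fourier_integral (g2 j)) h2) \<longlonglongrightarrow> 0"
    using 2 by (auto simp: is_fourier_L2_def)
  have [measurable]: "g \<in> borel_measurable borel" "h1 \<in> borel_measurable borel" "h2 \<in> borel_measurable borel"
      "\<And>j. g1 j \<in> borel_measurable borel" "\<And>j. g2 j \<in> borel_measurable borel"
    using 1 2 g1 g2 by (auto simp: is_fourier_L2_def L2_def)
  let ?D = "L2_dist_sq lborel"
  let ?F = "fourier_integral"
  have "?D h1 h2 \<le> 2 * ?D (?F (g1 j)) h1 + 2 * (2 * (2 * ?D (g1 j) g + 2 * ?D (g2 j) g) + 2 * ?D (?F (g2 j)) h2)" for j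
  proof -
    have a: "?D h1 h2 \<le> 2 * ?D (?F (g1 j)) h1 + 2 * ?D (?F (g1 j)) h2"
      unfolding L2_dist_sq_commute[of _ "?F (g1 j)" h1] by (rule L2_dist_sq_triangle) auto
    have b: "?D (?F (g1 j)) h2 \<le> 2 * ?D (?F (g1 j)) (?F (g2 j)) + 2 * ?D (?F (g2 j)) h2"
      by (rule L2_dist_sq_triangle) auto
    have c: "?D (?F (g1 j)) (?F (g2 j)) \<le> ?D (g1 j) (g2 j)"
      by (rule L2_dist_sq_fourier_integral_le) (use g1 g2 in auto)
    have d: "?D (g1 j) (g2 j) \<le> 2 * ?D (g1 j) g + 2 * ?D (g2 j) g"
      unfolding L2_dist_sq_commute[of _ "g2 j" g] by (rule L2_dist_sq_triangle) auto
    have "2 * ?D (?F (g1 j)) (?F (g2 j)) + 2 * ?D (?F (g2 j)) h2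
        \<le> 2 * (2 * ?D (g1 j) g + 2 * ?D (g2 j) g) + 2 * ?D (?F (g2 j)) h2"
      by (intro add_mono mult_left_mono order_refl order_trans[OF c d]) simp
    then have "2 * ?D (?F (g1 j)) h2 \<le> 2 * (2 * (2 * ?D (g1 j) g + 2 * ?D (g2 j) g) + 2 * ?D (?F (g2 j)) h2)"
      by (intro mult_left_mono order_trans[OF b]) simp_all
    then show ?thesis
      by (intro order_trans[OF a] add_mono order_refl)
  qed
  moreover have "(\<lambda>j. 2 * ?D (?F (g1 j)) h1 + 2 * (2 * (2 * ?D (g1 j) g + 2 * ?D (g2 j) g) + 2 * ?D (?F (g2 j)) h2))
      \<longlonglongrightarrow> 2 * 0 + 2 * (2 * (2 * 0 + 2 * 0) + 2 * 0)"
    using g1 g2 by (intro tendsto_add ennreal_tendsto_cmult) auto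
  ultimately have "?D h1 h2 \<le> 2 * 0 + 2 * (2 * (2 * 0 + 2 * 0) + 2 * 0)"
    by (intro LIMSEQ_le_const) auto
  then have "L2_nsq lborel (\<lambda>x. h1 x - h2 x) = 0"
    by (simp add: L2_dist_sq_eq)
  then show ?thesis
    by (subst (asm) L2_nsq_eq_0_iff) auto
qed

text \<open>On integrable functions it is \<open>multiplication_formula\<close>; both sides are
  continuous in the L2 distance, which carries it along the approximating sequence in
  \<open>is_fourier_L2\<close>.\<close>

lemma is_fourier_L2_multiplication:
  fixes g h \<psi> :: "real ^ 'n \<Rightarrow> complex"
  assumes F: "is_fourier_L2 g h" and \<psi>: "\<psi> \<in> L2 lborel" "integrable lborel \<psi>"
  shows "(LINT \<xi>|lborel. h \<xi> * \<psi> \<xi>) = (LINT x|lborel. g x * fourier_integral \<psi> x)"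
proof -
  obtain gs where gs: "\<And>j. gs j \<in> L2 lborel" "\<And>j. integrable lborel (gs j)"
      "(\<lambda>j. L2_dist_sq lborel (gs j) g) \<longlonglongrightarrow> 0" "(\<lambda>j. L2_dist_sq lborel (fourier_integral (gs j)) h) \<longlonglongrightarrow> 0"
    and gh: "g \<in> L2 lborel" "h \<in> L2 lborel"
    using F by (auto simp: is_fourier_L2_def)
  let ?c = "complex_of_real ((2 * pi) powr (- real CARD('n) / 2))"
  have "(LINT \<xi>|lborel. fourier_integral (gs j) \<xi> * \<psi> \<xi>) = (LINT x|lborel. gs j x * fourier_integral \<psi> x)" for j
  proof -
    have "(LINT \<xi>|lborel. \<psi> \<xi> * fint (gs j) \<xi>) = (LINT p|lborel. gs j p * fint \<psi> p)"
      unfolding fint_def by (rule multiplication_formula) (auto simp: sigma_finite_lborel \<psi> gs)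
    moreover have "(LINT \<xi>|lborel. fourier_integral (gs j) \<xi> * \<psi> \<xi>) = ?c * (LINT \<xi>|lborel. \<psi> \<xi> * fint (gs j) \<xi>)"
      unfolding fourier_integral_eq integral_mult_right_zero[symmetric] by (simp only: ac_simps)
    moreover have "(LINT p|lborel. gs j p * fourier_integral \<psi> p) = ?c * (LINT p|lborel. gs j p * fint \<psi> p)"
      unfolding fourier_integral_eq integral_mult_right_zero[symmetric] by (simp only: ac_simps)
    ultimately show ?thesis
      by simp
  qed
  moreover have "(\<lambda>j. LINT \<xi>|lborel. fourier_integral (gs j) \<xi> * \<psi> \<xi>) \<longlonglongrightarrow> (LINT \<xi>|lborel. h \<xi> * \<psi> \<xi>)"
    using gs gh \<psi> by (intro L2_tendsto_integral_mult fourier_integral_L2) auto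
  moreover have "(\<lambda>j. LINT x|lborel. gs j x * fourier_integral \<psi> x) \<longlonglongrightarrow> (LINT x|lborel. g x * fourier_integral \<psi> x)"
    using gs gh \<psi> by (intro L2_tendsto_integral_mult fourier_integral_L2) auto
  ultimately show ?thesis
    by (simp add: LIMSEQ_unique)
qed

lemma gauss_L2: "s > 0 \<Longrightarrow> (\<lambda>x::'a::euclidean_space. complex_of_real (gauss s (x - y))) \<in> L2 lborel"
proof -
  assume s: "s > 0"
  have "(\<integral>\<^sup>+x. ennreal ((gauss s (x - y))\<^sup>2) \<partial>(lborel :: 'a measure)) = (\<integral>\<^sup>+x. ennreal (gauss (2 * s) (- y + x)) \<partial>(lborel :: 'a measure))"
    by (simp add: gauss_def power2_eq_square flip: exp_add)
  also have "\<dots> < \<infinity>"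
    using nn_integral_lborel_translate[of "\<lambda>x. ennreal (gauss (2 * s) x)" "- y"] s
    by (simp add: nn_integral_gauss)
  finally show ?thesis
    by (simp add: L2_iff L2_nsq_def)
qed

text \<open>The standard Gaussian is fixed by the unitary transform, and its translation by \<eta>
  turns into the character at \<eta>. Used as test functions, the translates produce Fourier
  integrals of a function damped by \<open>gauss 1\<close>.\<close>

lemma
  fixes \<eta> :: "real ^ 'n"
  shows integrable_gauss_translate: "integrable lborel (\<lambda>x. complex_of_real (gauss 1 (x - \<eta>)))"
    and fourier_integral_gauss_translate:
      "fourier_integral (\<lambda>x. complex_of_real (gauss 1 (x - \<eta>))) x
        = complex_of_real (gauss 1 x) * exp (- \<i> * complex_of_real (\<eta> \<bullet> x))"
proof -
  let ?f = "\<lambda>y. complex_of_real (gauss 1 (y - \<eta>)) * exp (- \<i> * complex_of_real (x \<bullet> y))"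
  let ?g = "\<lambda>z. complex_of_real (gauss 1 z) * exp (- \<i> * complex_of_real (x \<bullet> z))"
  have nn: "(\<integral>\<^sup>+x. ennreal (gauss 1 (x - \<eta>)) \<partial>lborel) < \<infinity>"
    using nn_integral_lborel_translate[of "\<lambda>x. ennreal (gauss 1 x)" "- \<eta>"] 
    by (simp add: nn_integral_gauss)
  then show "integrable lborel (\<lambda>x. complex_of_real (gauss 1 (x - \<eta>)))"
    by (simp add: integrable_iff_bounded)
  have shift: "?f (\<eta> + 1 *\<^sub>R z) = exp (- \<i> * complex_of_real (\<eta> \<bullet> x)) * ?g z" for z
    by (simp add: inner_add_right inner_commute ring_distribs exp_diff exp_minus field_simps)
  have "(LINT y|lborel. ?f y) = (LINT z|lborel. ?f (\<eta> + 1 *\<^sub>R z))"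
    by (subst lborel_integral_affine[of ?f 1 \<eta>]) auto
  also have "\<dots> = (LINT z|lborel. exp (- \<i> * complex_of_real (\<eta> \<bullet> x)) * ?g z)"
    unfolding shift ..
  also have "\<dots> =
      exp (- \<i> * complex_of_real (\<eta> \<bullet> x)) * complex_of_real (sqrt (2 * pi) ^ CARD('n) * gauss 1 x)"
    using integral_gauss_exp[of 1 x] by simp
  finally have *: "(LINT y|lborel. ?f y) = exp (- \<i> * complex_of_real (\<eta> \<bullet> x)) * complex_of_real (sqrt (2 * pi) ^ CARD('n) * gauss 1 x)" .
  have "(2 * pi) powr (- real CARD('n) / 2) * sqrt (2 * pi) ^ CARD('n) = 1"
    by (simp add: powr_half_sqrt[symmetric] powr_powr flip: powr_realpow powr_add)
  then have c: "complex_of_real ((2 * pi) powr (- real CARD('n) / 2)) * complex_of_real (sqrt (2 * pi) ^ CARD('n)) = 1"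
    by (simp only: of_real_mult[symmetric]) simp
  have "fourier_integral (\<lambda>x. complex_of_real (gauss 1 (x - \<eta>))) x =
     (complex_of_real ((2 * pi) powr (- real CARD('n) / 2)) * complex_of_real (sqrt (2 * pi) ^ CARD('n))) * 
      (exp (- \<i> * complex_of_real (\<eta> \<bullet> x)) * complex_of_real (gauss 1 x))"
    unfolding fourier_integral_def * by (simp only: of_real_mult ac_simps)
  then show "fourier_integral (\<lambda>x. complex_of_real (gauss 1 (x - \<eta>))) x
        = complex_of_real (gauss 1 x) * exp (- \<i> * complex_of_real (\<eta> \<bullet> x))"
    unfolding c by simp
qed

text \<open>The difference of \<open>g1\<close> and \<open>g2\<close> need not be integrable, but
  its product with \<open>gauss 1\<close> is, being a product of two L2 functions. Testing on the
  Gaussian translated by \<eta> shows that the Fourier integral of this product vanishes at \<eta>,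
  and the Gaussian has no zero.\<close>

lemma is_fourier_L2_injective:
  fixes g1 g2 h :: "real ^ 'n \<Rightarrow> complex"
  assumes 1: "is_fourier_L2 g1 h" and 2: "is_fourier_L2 g2 h"
  shows "AE x in lborel. g1 x = g2 x"
proof -
  have g: "g1 \<in> L2 lborel" "g2 \<in> L2 lborel"
    using 1 2 by (auto simp: is_fourier_L2_def)
  have gs: "(\<lambda>x::real^'n. complex_of_real (gauss 1 x)) \<in> L2 lborel"
    using gauss_L2[of 1 0] by simp
  let ?w = "\<lambda>x. (g1 x - g2 x) * complex_of_real (gauss 1 x)"
  have "AE x in lborel. ?w x = 0"
  proof (rule fourier_L1_injective)
    show "integrable lborel ?w"
      by (rule L2_integrable_mult[OF L2_diff[OF g] gs])
    fix \<eta> :: "real ^ 'n"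
    let ?e = "\<lambda>x. complex_of_real (gauss 1 x) * exp (- \<i> * complex_of_real (\<eta> \<bullet> x))"
    have e: "?e \<in> L2 lborel"
      by (rule L2_dominated[OF gs]) (auto simp: norm_mult norm_exp_eq_Re)
    have "(LINT x|lborel. g1 x * ?e x) = (LINT x|lborel. g2 x * ?e x)"
      using is_fourier_L2_multiplication[OF 1 gauss_L2[of 1 \<eta>] integrable_gauss_translate[of \<eta>]]
        is_fourier_L2_multiplication[OF 2 gauss_L2[of 1 \<eta>] integrable_gauss_translate[of \<eta>]]
      unfolding fourier_integral_gauss_translate by simp
    then have "(LINT x|lborel. g1 x * ?e x - g2 x * ?e x) = 0"
      using L2_integrable_mult[OF g(1) e] L2_integrable_mult[OF g(2) e] by simp
    then show "fint ?w \<eta> = 0"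
      by (simp add: fint_def left_diff_distrib mult.assoc)
  qed
  then show ?thesis
    by (rule AE_mp) (auto intro!: AE_I2)
qed

section \<open>Hermite functions\<close>

text \<open>The Hermite polynomials as polynomial objects. The recursion H_{n+1} = 2 u H_n - H_n' is
  what one more differentiation in Rodrigues' formula does, up to the sign collected there.\<close>

fun herm :: "nat \<Rightarrow> real poly" where
  "herm 0 = 1"
| "herm (Suc n) = [:0, 2:] * herm n - pderiv (herm n)"

lemma funpow_deriv_gauss:
  "(deriv ^^ n) (\<lambda>v::real. exp (- v\<^sup>2)) = (\<lambda>u. (- 1) ^ n * poly (herm n) u * exp (- u\<^sup>2))"
proof (induction n)
  case (Suc n)
  show ?case
  proof
    fix u :: real
    have "((\<lambda>u. (- 1) ^ n * poly (herm n) u * exp (- u\<^sup>2)) has_real_derivative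
        (- 1) ^ Suc n * poly (herm (Suc n)) u * exp (- u\<^sup>2)) (at u)"
      by (rule derivative_eq_intros poly_DERIV refl)+ (simp add: algebra_simps)
    then show "(deriv ^^ Suc n) (\<lambda>v::real. exp (- v\<^sup>2)) u = (- 1) ^ Suc n * poly (herm (Suc n)) u * exp (- u\<^sup>2)"
      by (simp only: funpow.simps o_def Suc.IH DERIV_imp_deriv)
  qed
qed simp

lemma hermite_poly_eq: "hermite_poly n u = poly (herm n) u"
proof -
  have "(- 1 :: real) ^ n * (- 1) ^ n = 1"
    by (simp flip: power_mult_distrib)
  moreover have "exp (u\<^sup>2) * exp (- u\<^sup>2) = 1"
    by (simp flip: exp_add)
  moreover have "hermite_poly n u = ((- 1) ^ n * (- 1) ^ n) * (exp (u\<^sup>2) * exp (- u\<^sup>2)) * poly (herm n) u"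
    by (simp add: hermite_poly_def funpow_deriv_gauss)
  ultimately show ?thesis
    by simp
qed

lemma pderiv_herm_Suc: "pderiv (herm (Suc n)) = smult (2 * real (Suc n)) (herm n)"
proof (induction n)
  case (Suc n)
  have "pderiv (herm (Suc (Suc n))) = pderiv ([:0, 2:] * herm (Suc n) - smult (2 * real (Suc n)) (herm n))"
    by (subst herm.simps(2)) (simp only: Suc.IH)
  also have "\<dots> = [:2:] * herm (Suc n) + smult (2 * real (Suc n)) ([:0, 2:] * herm n - pderiv (herm n))"
    by (simp only: pderiv_diff pderiv_mult pderiv_smult Suc.IH) (simp add: pderiv_pCons smult_diff_right algebra_simps)
  also have "[:0, 2:] * herm n - pderiv (herm n) = herm (Suc n)"
    by simp
  also have "[:2:] * herm (Suc n) + smult (2 * real (Suc n)) (herm (Suc n)) = smult (2 * real (Suc (Suc n))) (herm (Suc n))"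
    by (simp flip: smult_add_left del: herm.simps)
  finally show ?case .
qed (simp add: pderiv_pCons)

text \<open>At n = 0 the index n - 1 is again 0; the factor n makes this harmless.\<close>

lemma pderiv_herm: "pderiv (herm n) = smult (2 * real n) (herm (n - 1))"
  by (cases n) (simp_all add: pderiv_herm_Suc del: herm.simps(2))

lemma poly_herm_recurrence:
  "u * poly (herm n) u = poly (herm (Suc n)) u / 2 + real n * poly (herm (n - 1)) u"
  by (simp add: pderiv_herm field_simps)

text \<open>Compares two expressions for the derivative of \<open>herm (Suc n)\<close>, the lowering
  rule and the differentiated recursion; the result is Hermite's differential equation.\<close>

lemma pderiv_pderiv_herm:
  "pderiv (pderiv (herm n)) = [:0, 2:] * pderiv (herm n) - smult (2 * real n) (herm n)"
proof -
  have "smult (2 * real (Suc n)) (herm n) = pderiv ([:0, 2:] * herm n - pderiv (herm n))"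
    using pderiv_herm_Suc[of n] by simp
  also have "\<dots> = smult 2 (herm n) + [:0, 2:] * pderiv (herm n) - pderiv (pderiv (herm n))"
    by (simp only: pderiv_diff pderiv_mult) (simp add: pderiv_pCons)
  finally have "pderiv (pderiv (herm n)) = smult 2 (herm n) + [:0, 2:] * pderiv (herm n) - smult (2 * real (Suc n)) (herm n)"
    by simp
  also have "smult (2 * real (Suc n)) (herm n) = smult 2 (herm n) + smult (2 * real n) (herm n)"
    by (simp flip: smult_add_left)
  finally show ?thesis
    by simp
qed

definition hermite_const :: "nat \<Rightarrow> real" where
  "hermite_const n = (2 ^ n * fact n * sqrt pi) powr (- 1 / 2)"

lemma hermite_const_pos: "hermite_const n > 0"
  by (simp add: hermite_const_def)

lemma hermite_const_sq: "hermite_const n * hermite_const n * (2 ^ n * fact n * sqrt pi) = 1"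
proof -
  have "x powr (- 1 / 2) * x powr (- 1 / 2) * x = 1" if "x > 0" for x :: real
    using that by (subst powr_add[symmetric]) (simp add: powr_minus)
  then show ?thesis
    unfolding hermite_const_def by simp
qed

lemma hermite1_eq: "hermite1 n u = hermite_const n * poly (herm n) u * exp (- u\<^sup>2 / 2)"
  by (simp add: hermite1_def hermite_const_def hermite_poly_eq)

text \<open>The derivative of \<open>hermite1 n\<close> in closed form, so that its continuity and
  its own derivative can be read off.\<close>

definition hermite1' :: "nat \<Rightarrow> real \<Rightarrow> real" where
  "hermite1' n u = hermite_const n * (poly (pderiv (herm n)) u - u * poly (herm n) u) * exp (- u\<^sup>2 / 2)"

lemma DERIV_poly_gauss:
  "((\<lambda>u. poly p u * exp (- u\<^sup>2 / 2)) has_real_derivative (poly (pderiv p) u - u * poly p u) * exp (- u\<^sup>2 / 2)) (at u)"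
proof -
  have "((\<lambda>u. exp (- u\<^sup>2 / 2)) has_real_derivative exp (- u\<^sup>2 / 2) * (- u)) (at u)"
    by (auto intro!: derivative_eq_intros)
  from DERIV_mult[OF poly_DERIV this, of p] show ?thesis
    by (rule DERIV_cong) (simp add: left_diff_distrib mult.commute)
qed

lemma DERIV_hermite1: "(hermite1 n has_real_derivative hermite1' n u) (at u)"
  using DERIV_cmult[OF DERIV_poly_gauss[of "herm n" u], of "hermite_const n"]
  by (simp add: hermite1_eq[abs_def] hermite1'_def mult.assoc)

text \<open>Hermite's equation becomes the eigenvalue equation of the harmonic oscillator -d^2/du^2
  + u^2; the eigenvalue 2 n + 1 is the one-dimensional source of \<open>Theta\<close>.\<close>

lemma DERIV_hermite1': "(hermite1' n has_real_derivative (u\<^sup>2 - (2 * real n + 1)) * hermite1 n u) (at u)"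
proof -
  let ?p = "pderiv (herm n) - [:0, 1:] * herm n"
  have "poly (pderiv ?p) u - u * poly ?p u = (u\<^sup>2 - (2 * real n + 1)) * poly (herm n) u"
    by (simp only: pderiv_diff pderiv_mult pderiv_pderiv_herm) (simp add: pderiv_pCons algebra_simps power2_eq_square)
  then have "((\<lambda>u. hermite_const n * (poly ?p u * exp (- u\<^sup>2 / 2))) has_real_derivative
      hermite_const n * ((u\<^sup>2 - (2 * real n + 1)) * poly (herm n) u * exp (- u\<^sup>2 / 2))) (at u)"
    using DERIV_cmult[OF DERIV_poly_gauss[of ?p u], of "hermite_const n"] by simp
  also have "(\<lambda>u. hermite_const n * (poly ?p u * exp (- u\<^sup>2 / 2))) = hermite1' n"
    by (simp add: fun_eq_iff hermite1'_def)
  finally show ?thesis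
    by (simp only: hermite1_eq ac_simps)
qed

lemma continuous_hermite1 [continuous_intros]: "continuous_on A f \<Longrightarrow> continuous_on A (\<lambda>x. hermite1 n (f x))"
  unfolding hermite1_eq by (intro continuous_intros) auto

lemma continuous_hermite1' [continuous_intros]: "continuous_on A f \<Longrightarrow> continuous_on A (\<lambda>x. hermite1' n (f x))"
  unfolding hermite1'_def by (intro continuous_intros) auto

lemma hermite1_measurable [measurable]: "hermite1 n \<in> borel_measurable borel"
  by (intro borel_measurable_continuous_onI continuous_intros)

lemma integrable_poly_gauss:
  fixes p :: "real poly"
  shows "integrable lborel (\<lambda>u. poly p u * exp (- u\<^sup>2))"
proof -
  \<comment> \<open>The standard normal density at \<open>sqrt 2 * u\<close> is exp (-u^2) /
    \<open>sqrt (2 * pi)\<close>, so its moments provide these integrals.\<close>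
  have mono: "integrable lborel (\<lambda>u::real. u ^ k * exp (- u\<^sup>2))" for k
  proof -
    have "integrable lborel (\<lambda>u. std_normal_density (0 + sqrt 2 * u) * (0 + sqrt 2 * u) ^ k)"
      by (rule lborel_integrable_real_affine[OF integrable_std_normal_moment]) simp
    then have "integrable lborel (\<lambda>u. (sqrt (2 * pi) / sqrt 2 ^ k) * (std_normal_density (0 + sqrt 2 * u) * (0 + sqrt 2 * u) ^ k))"
      by (rule integrable_mult_right)
    also have "(\<lambda>u. (sqrt (2 * pi) / sqrt 2 ^ k) * (std_normal_density (0 + sqrt 2 * u) * (0 + sqrt 2 * u) ^ k)) = (\<lambda>u. u ^ k * exp (- u\<^sup>2))"
      by (auto simp: std_normal_density_def power_mult_distrib field_simps)
    finally show ?thesis .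
  qed
  show ?thesis
    unfolding poly_altdef sum_distrib_right mult.assoc
    by (intro Bochner_Integration.integrable_sum integrable_mult_right mono)
qed

lemma tendsto_poly_gauss:
  fixes p :: "real poly"
  shows "((\<lambda>u. poly p u * exp (- u\<^sup>2)) \<longlongrightarrow> 0) at_top" "((\<lambda>u. poly p u * exp (- u\<^sup>2)) \<longlongrightarrow> 0) at_bot"
proof -
  have top: "((\<lambda>u. poly p u * exp (- u\<^sup>2)) \<longlongrightarrow> 0) at_top" for p :: "real poly"
  proof -
    have "((\<lambda>u::real. u ^ k * exp (- u\<^sup>2)) \<longlongrightarrow> 0) at_top" for k
    proof (rule tendsto_sandwich[OF _ _ tendsto_const tendsto_power_div_exp_0[of k]])
      show "\<forall>\<^sub>F u::real in at_top. 0 \<le> u ^ k * exp (- u\<^sup>2)"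
        using eventually_ge_at_top[of 0] by eventually_elim simp
      show "\<forall>\<^sub>F u::real in at_top. u ^ k * exp (- u\<^sup>2) \<le> u ^ k / exp u"
        using eventually_ge_at_top[of 1]
      proof eventually_elim
        fix u :: real assume "1 \<le> u"
        then have "exp (- u\<^sup>2) \<le> exp (- u)"
          by (simp add: power2_eq_square)
        then show "u ^ k * exp (- u\<^sup>2) \<le> u ^ k / exp u"
          using \<open>1 \<le> u\<close> by (simp add: exp_minus divide_inverse mult_left_mono)
      qed
    qed
    then show ?thesis
      unfolding poly_altdef sum_distrib_right mult.assoc by (intro tendsto_null_sum tendsto_mult_right_zero)
  qed
  show "((\<lambda>u. poly p u * exp (- u\<^sup>2)) \<longlongrightarrow> 0) at_top" by (rule top)
  show "((\<lambda>u. poly p u * exp (- u\<^sup>2)) \<longlongrightarrow> 0) at_bot"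
    using top[of "pcompose p [:0, -1:]"] by (simp add: filterlim_at_bot_mirror poly_pcompose)
qed

lemma integrable_deriv_poly_gauss:
  fixes p :: "real poly"
  shows "integrable lborel (\<lambda>u. (poly (pderiv p) u - 2 * u * poly p u) * exp (- u\<^sup>2))"
proof -
  have "(poly (pderiv p) u - 2 * u * poly p u) * exp (- u\<^sup>2) = poly (pderiv p - [:0, 2:] * p) u * exp (- u\<^sup>2)" for u
    by simp
  then show ?thesis
    by (simp only: integrable_poly_gauss)
qed

text \<open>The integrand is the derivative of p(u) exp (-u^2), which tends to 0 at both
  ends.\<close>

lemma integral_deriv_poly_gauss:
  fixes p :: "real poly"
  shows "(LINT u|lborel. (poly (pderiv p) u - 2 * u * poly p u) * exp (- u\<^sup>2)) = 0"
proof -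
  let ?F = "\<lambda>u. poly p u * exp (- u\<^sup>2)" and ?f = "\<lambda>u. (poly (pderiv p) u - 2 * u * poly p u) * exp (- u\<^sup>2)"
  have "(LBINT u=-\<infinity>..\<infinity>. ?f u) = 0 - 0"
  proof (rule interval_integral_FTC_integrable[where F = ?F])
    show "(?F has_vector_derivative ?f u) (at u)" for u
      unfolding has_real_derivative_iff_has_vector_derivative[symmetric]
      by (rule derivative_eq_intros poly_DERIV refl)+ (simp add: algebra_simps)
    show "set_integrable lborel (einterval (- \<infinity>) \<infinity>) ?f"
      unfolding set_integrable_def using integrable_deriv_poly_gauss[of p] by simp
    show "((?F \<circ> real_of_ereal) \<longlongrightarrow> 0) (at_right (- \<infinity>))" "((?F \<circ> real_of_ereal) \<longlongrightarrow> 0) (at_left \<infinity>)"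
      using tendsto_poly_gauss[of p] by (simp_all add: ereal_tendsto_simps1)
  qed (auto intro!: continuous_intros)
  then show ?thesis
    by (simp add: interval_lebesgue_integral_def set_lebesgue_integral_def)
qed

text \<open>Integration by parts lowers both indices at once, I (n+1) (m+1) = 2 (m+1) I n m, until
  one of them is 0; only equal indices end at I 0 0, the Gaussian integral.\<close>

lemma integral_herm_herm:
  "(LINT u|lborel. poly (herm n) u * poly (herm m) u * exp (- u\<^sup>2)) = (if n = m then 2 ^ n * fact n * sqrt pi else 0)"
proof -
  define I where "I n m = (LINT u|lborel. poly (herm n) u * poly (herm m) u * exp (- u\<^sup>2))" for n m
  have comm: "I n m = I m n" for n m
    unfolding I_def by (simp add: mult.commute mult.left_commute)
  \<comment> \<open>By the recursion, H_{n+1} H_m exp (-u^2) is H_n H_m' exp (-u^2) minus the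
    derivative of H_n H_m exp (-u^2), whose integral is 0.\<close>
  have step: "I (Suc n) m = (LINT u|lborel. poly (herm n) u * poly (pderiv (herm m)) u * exp (- u\<^sup>2))" for n m
  proof -
    have i: "integrable lborel (\<lambda>u. poly (herm n) u * poly (pderiv (herm m)) u * exp (- u\<^sup>2))"
      using integrable_poly_gauss[of "herm n * pderiv (herm m)"] by simp
    have i2: "integrable lborel (\<lambda>u. (poly (pderiv (herm n * herm m)) u - 2 * u * poly (herm n * herm m) u) * exp (- u\<^sup>2))"
      by (rule integrable_deriv_poly_gauss)
    have "I (Suc n) m = (LINT u|lborel. poly (herm n) u * poly (pderiv (herm m)) u * exp (- u\<^sup>2)
        - (poly (pderiv (herm n * herm m)) u - 2 * u * poly (herm n * herm m) u) * exp (- u\<^sup>2))"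
      unfolding I_def by (rule Bochner_Integration.integral_cong) (simp_all add: pderiv_mult algebra_simps)
    then show ?thesis
      by (simp only: Bochner_Integration.integral_diff[OF i i2] integral_deriv_poly_gauss diff_zero)
  qed
  have Suc_0: "I (Suc n) 0 = 0" for n
    by (simp add: step pderiv_1)
  have zero_Suc: "I 0 (Suc n) = 0" for n
    using comm[of 0 "Suc n"] Suc_0[of n] by simp
  have Suc_Suc: "I (Suc n) (Suc m) = 2 * real (Suc m) * I n m" for n m
    unfolding step pderiv_herm_Suc by (simp add: I_def algebra_simps del: of_nat_Suc herm.simps)
  have I00: "I 0 0 = sqrt pi"
  proof -
    have "(LINT u|lborel. exp (- u\<^sup>2)) = sqrt pi"
      using integral_gauss[of 2, where 'a = real] by (simp add: gauss_def)
    then show ?thesis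
      by (simp add: I_def)
  qed
  have "I n m = (if n = m then 2 ^ n * fact n * sqrt pi else 0)"
  proof (induction n arbitrary: m)
    case 0
    show ?case
      by (cases m) (simp_all add: I00 zero_Suc)
  next
    case (Suc n)
    show ?case
      by (cases m) (simp_all add: Suc_0 Suc_Suc Suc.IH)
  qed
  then show ?thesis
    by (simp add: I_def)
qed

lemma
  shows integrable_hermite1_mult: "integrable lborel (\<lambda>u. hermite1 n u * hermite1 m u)"
    and integral_hermite1_mult: "(LINT u|lborel. hermite1 n u * hermite1 m u) = (if n = m then 1 else 0)"
proof -
  have eq: "hermite1 n u * hermite1 m u = (hermite_const n * hermite_const m) * (poly (herm n) u * poly (herm m) u * exp (- u\<^sup>2))" for u
  proof -
    have "exp (- u\<^sup>2) = exp (- u\<^sup>2 / 2) * exp (- u\<^sup>2 / 2)"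
      by (simp flip: exp_add)
    then show ?thesis
      by (simp add: hermite1_eq)
  qed
  show "integrable lborel (\<lambda>u. hermite1 n u * hermite1 m u)"
    unfolding eq using integrable_poly_gauss[of "herm n * herm m"] by simp
  show "(LINT u|lborel. hermite1 n u * hermite1 m u) = (if n = m then 1 else 0)"
    unfolding eq integral_mult_right_zero integral_herm_herm using hermite_const_sq[of m] by auto
qed

text \<open>One coordinate factor of \<open>hermite_scaled\<close>: the power \<tau>^(d'/4) is
  shared out as \<tau>^(1/4) per coordinate, which normalises each factor by itself.\<close>

definition hermite1_scaled :: "real \<Rightarrow> nat \<Rightarrow> real \<Rightarrow> real" where
  "hermite1_scaled \<tau> n t = \<tau> powr (1 / 4) * hermite1 n (sqrt \<tau> * t)"

lemma hermite_scaled_eq: "hermite_scaled k \<tau> x = (\<Prod>j\<in>UNIV. hermite1_scaled \<tau> (k $ j) (x $ j))"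
proof -
  \<comment> \<open>For \<tau> = 0 both sides are 0, because \<open>0 powr\<close> is 0 and there is
    at least one coordinate.\<close>
  have "\<tau> powr (real CARD('a) / 4) = (\<Prod>j\<in>(UNIV::'a set). \<tau> powr (1 / 4))"
    by (cases "\<tau> = 0") (auto simp: powr_realpow[symmetric] powr_powr)
  then show ?thesis
    by (simp only: hermite_scaled_def hermite_def hermite1_scaled_def prod.distrib) simp
qed

lemma
  assumes \<tau>: "\<tau> > 0"
  shows integrable_hermite1_scaled_mult: "integrable lborel (\<lambda>t. hermite1_scaled \<tau> n t * hermite1_scaled \<tau> m t)"
    and integral_hermite1_scaled_mult: "(LINT t|lborel. hermite1_scaled \<tau> n t * hermite1_scaled \<tau> m t) = (if n = m then 1 else 0)"
proof -
  have eq: "hermite1_scaled \<tau> n t * hermite1_scaled \<tau> m t = sqrt \<tau> * (hermite1 n (0 + sqrt \<tau> * t) * hermite1 m (0 + sqrt \<tau> * t))" for t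
  proof -
    have "sqrt \<tau> = \<tau> powr (1 / 4) * \<tau> powr (1 / 4)"
      using \<tau> by (simp add: powr_half_sqrt flip: powr_add)
    then show ?thesis
      by (simp add: hermite1_scaled_def)
  qed
  have s: "sqrt \<tau> \<noteq> 0" using \<tau> by simp
  show "integrable lborel (\<lambda>t. hermite1_scaled \<tau> n t * hermite1_scaled \<tau> m t)"
    unfolding eq using lborel_integrable_real_affine[OF integrable_hermite1_mult[of n m] s, of 0] by simp
  show "(LINT t|lborel. hermite1_scaled \<tau> n t * hermite1_scaled \<tau> m t) = (if n = m then 1 else 0)"
    unfolding eq integral_mult_right_zero integral_hermite1_mult[symmetric]
    using lborel_integral_real_affine[OF s, of "\<lambda>u. hermite1 n u * hermite1 m u" 0] \<tau> by simp
qed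

lemma
  fixes g :: "'m::finite \<Rightarrow> real \<Rightarrow> 'c::{real_normed_field,banach,second_countable_topology}"
  assumes g: "\<And>j. integrable lborel (g j)"
  shows integrable_vec_prod: "integrable lborel (\<lambda>x::real ^ 'm. \<Prod>j\<in>UNIV. g j (x $ j))"
    and integral_vec_prod: "(LINT x|lborel. (\<Prod>j\<in>UNIV. g j ((x :: real ^ 'm) $ j))) = (\<Prod>j\<in>UNIV. integral\<^sup>L lborel (g j))"
proof -
  have inj: "inj (\<lambda>j::'m. axis j (1::real))"
    by (auto simp: inj_on_def axis_eq_axis)
  have B: "(Basis :: (real ^ 'm) set) = range (\<lambda>j. axis j 1)"
    by (auto simp: Basis_vec_def)
  have P: "(\<Prod>b\<in>(Basis :: (real ^ 'm) set). F b) = (\<Prod>j\<in>UNIV. F (axis j 1))" for F :: "real ^ 'm \<Rightarrow> 'c"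
    unfolding B by (simp add: prod.reindex[OF inj])
  let ?f = "\<lambda>b :: real ^ 'm. g (inv (\<lambda>j. axis j 1) b)"
  have inv: "inv (\<lambda>j. axis j 1) (axis j (1::real)) = j" for j :: 'm
    by (rule inv_f_f[OF inj])
  show "integrable lborel (\<lambda>x::real ^ 'm. \<Prod>j\<in>UNIV. g j (x $ j))"
    using integrable_lborel_prod[of ?f] g by (simp add: P inv inner_axis)
  show "(LINT x|lborel. (\<Prod>j\<in>UNIV. g j ((x :: real ^ 'm) $ j))) = (\<Prod>j\<in>UNIV. integral\<^sup>L lborel (g j))"
    using integral_lborel_prod[of ?f] g by (simp add: P inv inner_axis)
qed

lemma
  fixes k l :: "nat ^ 'm"
  assumes \<tau>: "\<tau> > 0"
  shows integrable_hermite_scaled_mult: "integrable lborel (\<lambda>x. hermite_scaled k \<tau> x * hermite_scaled l \<tau> x)"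
    and integral_hermite_scaled_mult: "(LINT x|lborel. hermite_scaled k \<tau> x * hermite_scaled l \<tau> x) = (if k = l then 1 else 0)"
proof -
  note i = integrable_vec_prod[of "\<lambda>j t. hermite1_scaled \<tau> (k $ j) t * hermite1_scaled \<tau> (l $ j) t"]
    integral_vec_prod[of "\<lambda>j t. hermite1_scaled \<tau> (k $ j) t * hermite1_scaled \<tau> (l $ j) t"]
  show "integrable lborel (\<lambda>x. hermite_scaled k \<tau> x * hermite_scaled l \<tau> x)"
    using i(1) integrable_hermite1_scaled_mult[OF \<tau>] by (simp add: hermite_scaled_eq flip: prod.distrib)
  have "(\<Prod>j\<in>UNIV. if k $ j = l $ j then 1 else 0 :: real) = (if k = l then 1 else 0)"
    by (auto simp: vec_eq_iff)
  then show "(LINT x|lborel. hermite_scaled k \<tau> x * hermite_scaled l \<tau> x) = (if k = l then 1 else 0)"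
    using i(2) integrable_hermite1_scaled_mult[OF \<tau>]
    by (simp add: hermite_scaled_eq integral_hermite1_scaled_mult[OF \<tau>] flip: prod.distrib)
qed

lemma borel_measurable_vec_nth [measurable (raw)]:
  fixes f :: "'a \<Rightarrow> real ^ 'm"
  assumes "f \<in> borel_measurable M"
  shows "(\<lambda>x. f x $ j) \<in> borel_measurable M"
proof -
  have "(\<lambda>x :: real ^ 'm. x $ j) \<in> borel_measurable borel"
    by (intro borel_measurable_continuous_onI continuous_intros)
  from measurable_compose[OF assms this] show ?thesis .
qed

lemma hermite_scaled_borel_measurable [measurable (raw)]:
  assumes [measurable]: "f \<in> borel_measurable M" "t \<in> borel_measurable M"
  shows "(\<lambda>x. hermite_scaled k (t x) (f x :: real ^ 'm)) \<in> borel_measurable M"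
  unfolding hermite_scaled_eq hermite1_scaled_def by measurable

lemma hermite_scaled_L2: "\<tau> > 0 \<Longrightarrow> (\<lambda>x. complex_of_real (hermite_scaled k \<tau> x)) \<in> L2 lborel"
  using integrable_hermite_scaled_mult[of \<tau> k k] by (simp add: L2_def power2_eq_square)

section \<open>Inner products in L2 and Bessel's inequality\<close>

lemma L2_cnj: "f \<in> L2 M \<Longrightarrow> (\<lambda>x. cnj (f x)) \<in> L2 M"
  by (auto simp: L2_def)

lemma L2_sum: "(\<And>k. k \<in> A \<Longrightarrow> f k \<in> L2 M) \<Longrightarrow> (\<lambda>x. \<Sum>k\<in>A. f k x) \<in> L2 M"
proof (induction A rule: infinite_finite_induct)
  case (insert k A)
  then show ?case
    using L2_add[of "f k" M "\<lambda>x. \<Sum>k\<in>A. f k x"] by simp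
qed (simp_all add: L2_def)

lemma L2_inner_add_left:
  "f \<in> L2 M \<Longrightarrow> g \<in> L2 M \<Longrightarrow> h \<in> L2 M \<Longrightarrow> L2_inner M (\<lambda>x. f x + g x) h = L2_inner M f h + L2_inner M g h"
  by (simp add: L2_inner_def distrib_right L2_integrable_mult L2_cnj)

lemma L2_inner_diff_left:
  "f \<in> L2 M \<Longrightarrow> g \<in> L2 M \<Longrightarrow> h \<in> L2 M \<Longrightarrow> L2_inner M (\<lambda>x. f x - g x) h = L2_inner M f h - L2_inner M g h"
  by (simp add: L2_inner_def left_diff_distrib L2_integrable_mult L2_cnj)

lemma L2_inner_sum_left:
  assumes "\<And>k. k \<in> A \<Longrightarrow> f k \<in> L2 M" "h \<in> L2 M"
  shows "L2_inner M (\<lambda>x. \<Sum>k\<in>A. c k * f k x) h = (\<Sum>k\<in>A. c k * L2_inner M (f k) h)"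
  using assms by (simp add: L2_inner_def sum_distrib_right mult.assoc L2_integrable_mult L2_cnj)

lemma L2_inner_cnj: "L2_inner M g f = cnj (L2_inner M f g)"
  unfolding L2_inner_def
  by (subst Bochner_Integration.integral_cnj[symmetric]) (simp only: complex_cnj_mult complex_cnj_cnj mult.commute)

lemma L2_inner_self: "f \<in> L2 M \<Longrightarrow> L2_nsq M f = ennreal (Re (L2_inner M f f))" "Re (L2_inner M f f) \<ge> 0"
proof -
  have eq: "L2_inner M f f = complex_of_real (LINT x|M. (cmod (f x))\<^sup>2)"
    unfolding L2_inner_def complex_norm_square[symmetric] by (rule integral_complex_of_real)
  show "Re (L2_inner M f f) \<ge> 0"
    unfolding eq by simp
  show "L2_nsq M f = ennreal (Re (L2_inner M f f))" if "f \<in> L2 M"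
    unfolding eq L2_nsq_def using that by (simp add: L2_def nn_integral_eq_integral)
qed

text \<open>Pythagoras for the splitting g = r + s, where s is the projection to the span of the
  \<open>e k\<close>: r is orthogonal to s, and dropping the norm of r gives the inequality.\<close>

lemma bessel_inequality_finite:
  assumes A: "finite A" and e: "\<And>k. k \<in> A \<Longrightarrow> e k \<in> L2 M"
    and orth: "\<And>k l. k \<in> A \<Longrightarrow> l \<in> A \<Longrightarrow> L2_inner M (e k) (e l) = (if k = l then 1 else 0)"
    and g: "g \<in> L2 M"
  shows "(\<Sum>k\<in>A. ennreal ((cmod (L2_inner M g (e k)))\<^sup>2)) \<le> L2_nsq M g"
proof -
  define c where "c k = L2_inner M g (e k)" for k
  define s where "s = (\<lambda>x. \<Sum>k\<in>A. c k * e k x)"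
  define r where "r = (\<lambda>x. g x - s x)"
  have s: "s \<in> L2 M" unfolding s_def by (intro L2_sum L2_cmult e)
  have r: "r \<in> L2 M" unfolding r_def by (intro L2_diff g s)
  have se: "L2_inner M s (e l) = c l" if "l \<in> A" for l
  proof -
    have "L2_inner M s (e l) = (\<Sum>k\<in>A. c k * L2_inner M (e k) (e l))"
      unfolding s_def by (rule L2_inner_sum_left) (use e that in auto)
    also have "\<dots> = (\<Sum>k\<in>A. if k = l then c k else 0)"
      by (rule sum.cong) (auto simp: orth that)
    finally show ?thesis
      using A that by simp
  qed
  have re: "L2_inner M r (e l) = 0" if "l \<in> A" for l
    unfolding r_def using L2_inner_diff_left[OF g s e[OF that]] se[OF that] by (simp add: c_def)
  have s_inner: "L2_inner M s h = (\<Sum>k\<in>A. c k * cnj (L2_inner M h (e k)))" if "h \<in> L2 M" for h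
    unfolding s_def using L2_inner_sum_left[of A e M h c] e that by (simp flip: L2_inner_cnj)
  have sr: "L2_inner M s r = 0"
    unfolding s_inner[OF r] using re by simp
  have rs: "L2_inner M r s = 0"
    using sr by (subst L2_inner_cnj) simp
  have ss: "L2_inner M s s = (\<Sum>k\<in>A. complex_of_real ((cmod (c k))\<^sup>2))"
    unfolding s_inner[OF s] by (rule sum.cong) (simp_all only: se complex_norm_square)
  have g_eq: "g = (\<lambda>x. r x + s x)"
    by (simp add: r_def)
  have "L2_inner M g g = L2_inner M r g + L2_inner M s g"
    using L2_inner_add_left[OF r s g] by (simp flip: g_eq)
  also have "L2_inner M r g = cnj (L2_inner M r r + L2_inner M s r)"
    using L2_inner_add_left[OF r s r] by (subst L2_inner_cnj) (simp flip: g_eq)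
  also have "L2_inner M s g = cnj (L2_inner M r s + L2_inner M s s)"
    using L2_inner_add_left[OF r s s] by (subst L2_inner_cnj) (simp flip: g_eq)
  finally have "Re (L2_inner M g g) = Re (L2_inner M r r) + (\<Sum>k\<in>A. (cmod (c k))\<^sup>2)"
    by (simp add: rs sr ss)
  then have "(\<Sum>k\<in>A. (cmod (c k))\<^sup>2) \<le> Re (L2_inner M g g)"
    using L2_inner_self(2)[of M r] by simp
  then have "ennreal (\<Sum>k\<in>A. (cmod (c k))\<^sup>2) \<le> L2_nsq M g"
    unfolding L2_inner_self(1)[OF g] by (rule ennreal_leI)
  then show ?thesis
    by (simp add: c_def sum_ennreal)
qed

text \<open>The sum over all indices is an integral for counting measure, the form in which
  \<open>Gamma_measure\<close> presents it. Exhausting the index type by \<open>to_nat k < n\<close>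
  and Fatou's lemma reduce it to finite sets.\<close>

lemma bessel_inequality:
  fixes e :: "'k::countable \<Rightarrow> 'a \<Rightarrow> complex"
  assumes e: "\<And>k. e k \<in> L2 M"
    and orth: "\<And>k l. L2_inner M (e k) (e l) = (if k = l then 1 else 0)"
    and g: "g \<in> L2 M"
  shows "(\<integral>\<^sup>+k. ennreal ((cmod (L2_inner M g (e k)))\<^sup>2) \<partial>count_space UNIV) \<le> L2_nsq M g"
proof -
  let ?f = "\<lambda>k. ennreal ((cmod (L2_inner M g (e k)))\<^sup>2)"
  define A where "A n = {k :: 'k. to_nat k < n}" for n
  have fin: "finite (A n)" for n
  proof (rule finite_imageD)
    show "finite (to_nat ` A n)"
      by (rule finite_subset[of _ "{..<n}"]) (auto simp: A_def)
  qed (auto intro: inj_on_subset[OF inj_to_nat])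
  have lim: "(\<lambda>n. ?f k * indicator (A n) k) \<longlonglongrightarrow> ?f k" for k
    by (rule tendsto_eventually, rule eventually_sequentiallyI[of "Suc (to_nat k)"]) (auto simp: A_def)
  have "(\<integral>\<^sup>+k. ?f k \<partial>count_space UNIV) = (\<integral>\<^sup>+k. liminf (\<lambda>n. ?f k * indicator (A n) k) \<partial>count_space UNIV)"
    by (simp only: lim_imp_Liminf[OF sequentially_bot lim])
  also have "\<dots> \<le> liminf (\<lambda>n. \<integral>\<^sup>+k. ?f k * indicator (A n) k \<partial>count_space UNIV)"
    by (rule nn_integral_liminf) simp
  also have "\<dots> \<le> L2_nsq M g"
  proof (intro Liminf_le always_eventually allI)
    fix n
    have "(\<integral>\<^sup>+k. ?f k * indicator (A n) k \<partial>count_space UNIV) = (\<Sum>k\<in>A n. ?f k)"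
      by (simp add: nn_integral_count_space_indicator[symmetric] nn_integral_count_space_finite fin)
    also have "\<dots> \<le> L2_nsq M g"
      by (rule bessel_inequality_finite[OF fin e orth g])
    finally show "(\<integral>\<^sup>+k. ?f k * indicator (A n) k \<partial>count_space UNIV) \<le> L2_nsq M g" .
  qed simp
  finally show ?thesis .
qed

section \<open>Completeness of the Hermite functions\<close>

text \<open>The span of the polynomial factors of the \<open>hermite_scaled k \<tau>\<close>, as a
  predicate whose induction rule fits linear statements. It is closed under multiplication by
  coordinates and so contains every power of \<xi> . x.\<close>

inductive hermite_span :: "real \<Rightarrow> (real ^ 'm \<Rightarrow> real) \<Rightarrow> bool" for \<tau> :: real where
  base: "hermite_span \<tau> (\<lambda>x. \<Prod>j\<in>UNIV. poly (herm (k $ j)) (sqrt \<tau> * x $ j))"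
| add: "hermite_span \<tau> p \<Longrightarrow> hermite_span \<tau> q \<Longrightarrow> hermite_span \<tau> (\<lambda>x. p x + q x)"
| scale: "hermite_span \<tau> p \<Longrightarrow> hermite_span \<tau> (\<lambda>x. c * p x)"

lemma hermite_span_one: "hermite_span \<tau> (\<lambda>x. 1)"
  using hermite_span.base[where k = 0 and \<tau> = \<tau>] by simp

lemma hermite_span_zero: "hermite_span \<tau> (\<lambda>x. 0)"
  using hermite_span.scale[OF hermite_span_one, where c = 0 and \<tau> = \<tau>] by simp

lemma hermite_span_sum:
  "finite A \<Longrightarrow> (\<And>i. i \<in> A \<Longrightarrow> hermite_span \<tau> (p i)) \<Longrightarrow> hermite_span \<tau> (\<lambda>x. \<Sum>i\<in>A. p i x)"
  by (induction A rule: finite_induct) (auto intro: hermite_span_zero hermite_span.add)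

text \<open>The three-term recurrence in the variable with index i, extended linearly.\<close>

lemma hermite_span_mult_component:
  assumes p: "hermite_span \<tau> p" and \<tau>: "\<tau> > 0"
  shows "hermite_span \<tau> (\<lambda>x. x $ i * p x)"
  using p
proof induction
  case (base k)
  define H where "H n = (\<lambda>x. \<Prod>j\<in>UNIV. poly (herm ((\<chi> j. if j = i then n else k $ j) $ j)) (sqrt \<tau> * x $ j))" for n
  have H: "hermite_span \<tau> (H n)" for n
    unfolding H_def by (rule hermite_span.base)
  have H_eq: "H n x = poly (herm n) (sqrt \<tau> * x $ i) * (\<Prod>j\<in>UNIV - {i}. poly (herm (k $ j)) (sqrt \<tau> * x $ j))" for n x
    unfolding H_def by (subst prod.remove[of _ i]) (auto intro!: prod.cong)
  have p_eq: "(\<Prod>j\<in>UNIV. poly (herm (k $ j)) (sqrt \<tau> * x $ j)) = H (k $ i) x" for x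
    unfolding H_eq by (rule prod.remove) auto
  \<comment> \<open>The recurrence multiplies by \<open>sqrt \<tau> * x $ i\<close>, whence the
    factor 1 / \<open>sqrt \<tau>\<close>; if \<open>k $ i\<close> is 0, the last term has
    coefficient 0.\<close>
  have "x $ i * H (k $ i) x = (1 / sqrt \<tau>) * ((1 / 2) * H (Suc (k $ i)) x + real (k $ i) * H (k $ i - 1) x)" for x
  proof -
    have "x $ i * H (k $ i) x = (1 / sqrt \<tau>) * ((sqrt \<tau> * x $ i * poly (herm (k $ i)) (sqrt \<tau> * x $ i)) *
        (\<Prod>j\<in>UNIV - {i}. poly (herm (k $ j)) (sqrt \<tau> * x $ j)))"
      using \<tau> by (simp add: H_eq)
    then show ?thesis
      unfolding poly_herm_recurrence H_eq by (simp add: algebra_simps del: herm.simps)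
  qed
  then show ?case
    unfolding p_eq by (simp only:) (intro hermite_span.add hermite_span.scale H)
next
  case (add p q)
  from add.IH show ?case
    unfolding distrib_left by (rule hermite_span.add)
next
  case (scale p c)
  from scale.IH show ?case
    unfolding mult.left_commute[of _ c] by (rule hermite_span.scale)
qed

lemma hermite_span_inner_power:
  fixes \<xi> :: "real ^ 'm"
  assumes \<tau>: "\<tau> > 0"
  shows "hermite_span \<tau> (\<lambda>x. (\<xi> \<bullet> x) ^ n)"
proof (induction n)
  case 0
  show ?case by (simp add: hermite_span_one)
next
  case (Suc n)
  have "hermite_span \<tau> (\<lambda>x. \<Sum>i\<in>UNIV. \<xi> $ i * (x $ i * (\<xi> \<bullet> x) ^ n))"
    by (intro hermite_span_sum hermite_span.scale hermite_span_mult_component Suc \<tau>) simp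
  then show ?case
    by (simp add: inner_vec_def sum_distrib_right mult.assoc)
qed

text \<open>Separates the polynomial from the Gaussian, so that orthogonality of a function to the
  Hermite functions can be read as orthogonality of its product with the Gaussian to
  polynomials.\<close>

lemma hermite_scaled_gauss:
  fixes k :: "nat ^ 'm"
  assumes \<tau>: "\<tau> > 0"
  obtains c where "c \<noteq> 0"
    "\<And>x. hermite_scaled k \<tau> x = c * ((\<Prod>j\<in>UNIV. poly (herm (k $ j)) (sqrt \<tau> * x $ j)) * gauss \<tau> x)"
proof
  show "(\<Prod>j\<in>UNIV. \<tau> powr (1 / 4) * hermite_const (k $ j)) \<noteq> 0"
    using \<tau> by (simp add: hermite_const_pos[THEN less_imp_neq, symmetric])
  fix x :: "real ^ 'm"
  have "gauss \<tau> x = exp (\<Sum>j\<in>UNIV. - (sqrt \<tau> * x $ j)\<^sup>2 / 2)"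
    using \<tau> unfolding gauss_def norm_eq_sqrt_inner
    by (simp add: inner_vec_def sum_nonneg power_mult_distrib sum_negf sum_divide_distrib sum_distrib_left flip: power2_eq_square)
  then show "hermite_scaled k \<tau> x = (\<Prod>j\<in>UNIV. \<tau> powr (1 / 4) * hermite_const (k $ j)) *
      ((\<Prod>j\<in>UNIV. poly (herm (k $ j)) (sqrt \<tau> * x $ j)) * gauss \<tau> x)"
    by (simp add: hermite_scaled_eq hermite1_scaled_def hermite1_eq exp_sum prod.distrib)
qed

text \<open>Completing the square gives a |x| \<le> a^2 / \<tau> + \<tau> |x|^2 / 4: half of the
  Gaussian exponent pays for the exponential and half is kept.\<close>

lemma gauss_exp_norm_le:
  assumes "\<tau> > 0"
  shows "gauss \<tau> x * exp (a * norm x) \<le> exp (a\<^sup>2 / \<tau>) * gauss (\<tau> / 2) x"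
proof -
  have "0 \<le> (a / sqrt \<tau> - sqrt \<tau> * norm x / 2)\<^sup>2"
    by simp
  also have "\<dots> = a\<^sup>2 / \<tau> - a * norm x + \<tau> * (norm x)\<^sup>2 / 4"
    using assms by (simp add: power2_diff power_divide power_mult_distrib)
  finally show ?thesis
    by (simp add: gauss_def field_simps flip: exp_add)
qed

text \<open>After multiplication by the Gaussian, the exponential series of exp (-i \<xi> . x) may
  be integrated term by term. Each term is a multiple of (\<xi> . x)^n, which lies in
  \<open>hermite_span\<close>, so the Fourier integral of \<open>w\<close> vanishes at every
  \<xi>.\<close>

theorem hermite_complete:
  fixes D :: "real ^ 'm \<Rightarrow> complex"
  assumes \<tau>: "\<tau> > 0" and D: "D \<in> L2 lborel"
    and orth: "\<And>k. L2_inner lborel D (\<lambda>x. complex_of_real (hermite_scaled k \<tau> x)) = 0"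
  shows "AE x in lborel. D x = 0"
proof -
  have [measurable]: "D \<in> borel_measurable borel" using D by (simp add: L2_def)
  define w where "w = (\<lambda>x. D x * complex_of_real (gauss \<tau> x))"
  have [measurable]: "w \<in> borel_measurable borel" unfolding w_def by measurable
  \<comment> \<open>Integrability is carried through the induction together with the value 0, since
    additivity of the integral relies on it.\<close>
  have span: "integrable lborel (\<lambda>x. w x * complex_of_real (p x)) \<and> (LINT x|lborel. w x * complex_of_real (p x)) = 0"
    if "hermite_span \<tau> p" for p
    using that
  proof induction
    case (base k)
    obtain c where c: "c \<noteq> 0"
      "\<And>x. hermite_scaled k \<tau> x = c * ((\<Prod>j\<in>UNIV. poly (herm (k $ j)) (sqrt \<tau> * x $ j)) * gauss \<tau> x)"
      using hermite_scaled_gauss[OF \<tau>, of k] by blast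
    have eq: "w x * complex_of_real (\<Prod>j\<in>UNIV. poly (herm (k $ j)) (sqrt \<tau> * x $ j))
        = complex_of_real (1 / c) * (D x * complex_of_real (hermite_scaled k \<tau> x))" for x
      using c(1) unfolding w_def c(2) by simp
    show ?case
      unfolding eq integral_mult_right_zero
      using orth[of k] L2_integrable_mult[OF D hermite_scaled_L2[OF \<tau>, of k]]
      by (simp add: L2_inner_def)
  next
    case (add p q)
    then show ?case
      by (simp add: distrib_left)
  next
    case (scale p c)
    then show ?case
      by (simp add: mult.left_commute[of _ "complex_of_real c"])
  qed
  \<comment> \<open>Supplies the dominating function for the partial sums of the series, with a =
    \<open>norm \<xi>\<close>: the Gaussian times an exponential is still square-integrable, and so
    is D.\<close>
  have E: "integrable lborel (\<lambda>x. cmod (w x) * exp (a * norm x))" for a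
  proof -
    have "(\<lambda>x::real^'m. complex_of_real (gauss \<tau> x * exp (a * norm x))) \<in> L2 lborel"
    proof (rule L2_dominated)
      show "(\<lambda>x::real^'m. complex_of_real (exp (a\<^sup>2 / \<tau>)) * complex_of_real (gauss (\<tau> / 2) (x - 0))) \<in> L2 lborel"
        by (intro L2_cmult gauss_L2) (use \<tau> in simp)
    qed (use gauss_exp_norm_le[OF \<tau>] in \<open>auto simp: norm_mult abs_mult\<close>)
    from integrable_norm[OF L2_integrable_mult[OF D this]] show ?thesis
      by (simp add: w_def norm_mult abs_mult mult.assoc)
  qed
  have w: "integrable lborel w"
    using span[OF hermite_span_one] by simp
  have "AE x in lborel. w x = 0"
  proof (rule fourier_L1_injective[OF w])
    fix \<xi> :: "real ^ 'm"
    let ?z = "\<lambda>x. - \<i> * complex_of_real (\<xi> \<bullet> x)"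
    let ?S = "\<lambda>N x. \<Sum>n<N. ?z x ^ n /\<^sub>R fact n"
    have "(LINT x|lborel. w x * ?S N x) = 0" for N
    proof -
      have term_eq: "w x * (?z x ^ n /\<^sub>R fact n) = ((- \<i>) ^ n /\<^sub>R fact n) * (w x * complex_of_real ((\<xi> \<bullet> x) ^ n))" for x n
        unfolding power_mult_distrib by (simp add: scaleR_conv_of_real)
      show ?thesis
        unfolding sum_distrib_left term_eq
        using span[OF hermite_span_inner_power[OF \<tau>, of \<xi>]]
        by (subst Bochner_Integration.integral_sum) auto
    qed
    moreover have "(\<lambda>N. LINT x|lborel. w x * ?S N x) \<longlonglongrightarrow> (LINT x|lborel. w x * exp (?z x))"
    proof (rule integral_dominated_convergence[where w = "\<lambda>x. cmod (w x) * exp (norm \<xi> * norm x)"])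
      show "AE x in lborel. (\<lambda>N. w x * ?S N x) \<longlonglongrightarrow> w x * exp (?z x)"
        by (intro AE_I2 tendsto_mult tendsto_const) (rule exp_converges[unfolded sums_def])
      show "AE x in lborel. norm (w x * ?S N x) \<le> cmod (w x) * exp (norm \<xi> * norm x)" for N
      proof (rule AE_I2)
        fix x
        have "norm (?S N x) \<le> (\<Sum>n<N. \<bar>\<xi> \<bullet> x\<bar> ^ n /\<^sub>R fact n)"
          by (rule sum_norm_le) (simp add: norm_power norm_mult)
        also have "\<dots> \<le> exp \<bar>\<xi> \<bullet> x\<bar>"
          unfolding exp_def by (rule sum_le_suminf) (auto intro: summable_exp)
        also have "\<dots> \<le> exp (norm \<xi> * norm x)"
          by (simp add: Cauchy_Schwarz_ineq2)
        finally show "norm (w x * ?S N x) \<le> cmod (w x) * exp (norm \<xi> * norm x)"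
          by (simp add: norm_mult mult_left_mono)
      qed
    qed (auto simp: E)
    ultimately show "fint w \<xi> = 0"
      by (simp add: fint_def LIMSEQ_const_iff)
  qed
  then show ?thesis
    by (rule AE_mp) (auto simp: w_def)
qed

section \<open>Slices of square-integrable functions on a product\<close>

lemma
  fixes f :: "'a::euclidean_space \<times> 'b::euclidean_space \<Rightarrow> complex"
  assumes f: "f \<in> borel_measurable borel"
  shows L2_nsq_prod: "L2_nsq lborel f = (\<integral>\<^sup>+x. L2_nsq lborel (\<lambda>y. f (x, y)) \<partial>lborel)"
    and L2_nsq_prod': "L2_nsq lborel f = (\<integral>\<^sup>+y. L2_nsq lborel (\<lambda>x. f (x, y)) \<partial>lborel)"
    and measurable_L2_nsq_slice: "(\<lambda>x. L2_nsq lborel (\<lambda>y. f (x, y))) \<in> borel_measurable borel"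
    and measurable_L2_nsq_slice': "(\<lambda>y. L2_nsq lborel (\<lambda>x. f (x, y))) \<in> borel_measurable borel"
proof -
  have [measurable]: "f \<in> borel_measurable (borel \<Otimes>\<^sub>M borel)"
    using f by (simp add: borel_prod)
  show "L2_nsq lborel f = (\<integral>\<^sup>+x. L2_nsq lborel (\<lambda>y. f (x, y)) \<partial>lborel)"
    unfolding L2_nsq_def lborel_prod[symmetric] by (rule lborel.nn_integral_fst[symmetric]) measurable
  show "L2_nsq lborel f = (\<integral>\<^sup>+y. L2_nsq lborel (\<lambda>x. f (x, y)) \<partial>lborel)"
    unfolding L2_nsq_def lborel_prod[symmetric]
    using lborel_pair.nn_integral_snd[of "\<lambda>p. ennreal ((cmod (f p))\<^sup>2)"] by simp
  show "(\<lambda>x. L2_nsq lborel (\<lambda>y. f (x, y))) \<in> borel_measurable borel"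
    "(\<lambda>y. L2_nsq lborel (\<lambda>x. f (x, y))) \<in> borel_measurable borel"
    unfolding L2_nsq_def by measurable
qed

lemma
  fixes f :: "'a::euclidean_space \<times> 'b::euclidean_space \<Rightarrow> complex"
  assumes f: "f \<in> borel_measurable borel"
  shows slice_measurable: "(\<lambda>y. f (x, y)) \<in> borel_measurable borel"
    and slice_measurable': "(\<lambda>x. f (x, y)) \<in> borel_measurable borel"
proof -
  have [measurable]: "f \<in> borel_measurable (borel \<Otimes>\<^sub>M borel)"
    using f by (simp add: borel_prod)
  show "(\<lambda>y. f (x, y)) \<in> borel_measurable borel" "(\<lambda>x. f (x, y)) \<in> borel_measurable borel"
    by measurable
qed

lemma
  fixes f :: "'a::euclidean_space \<times> 'b::euclidean_space \<Rightarrow> complex"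
  assumes f: "f \<in> L2 lborel"
  shows AE_slice_L2: "AE x in lborel. (\<lambda>y. f (x, y)) \<in> L2 lborel"
    and AE_slice_L2': "AE y in lborel. (\<lambda>x. f (x, y)) \<in> L2 lborel"
proof -
  have m: "f \<in> borel_measurable borel" using f by (simp add: L2_def)
  have "AE x in lborel. L2_nsq lborel (\<lambda>y. f (x, y)) \<noteq> \<infinity>"
    using L2_nsq_finite[OF f] by (intro nn_integral_PInf_AE) (simp_all add: measurable_L2_nsq_slice[OF m] flip: L2_nsq_prod[OF m])
  then show "AE x in lborel. (\<lambda>y. f (x, y)) \<in> L2 lborel"
    by eventually_elim (simp add: L2_iff slice_measurable[OF m] less_top)
  have "AE y in lborel. L2_nsq lborel (\<lambda>x. f (x, y)) \<noteq> \<infinity>"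
    using L2_nsq_finite[OF f] by (intro nn_integral_PInf_AE) (simp_all add: measurable_L2_nsq_slice'[OF m] flip: L2_nsq_prod'[OF m])
  then show "AE y in lborel. (\<lambda>x. f (x, y)) \<in> L2 lborel"
    by eventually_elim (simp add: L2_iff slice_measurable'[OF m] less_top)
qed

lemma L2_dist_sq_prod:
  fixes f g :: "'a::euclidean_space \<times> 'b::euclidean_space \<Rightarrow> complex"
  assumes "f \<in> borel_measurable borel" "g \<in> borel_measurable borel"
  shows "L2_dist_sq lborel f g = (\<integral>\<^sup>+x. L2_dist_sq lborel (\<lambda>y. f (x, y)) (\<lambda>y. g (x, y)) \<partial>lborel)"
  unfolding L2_dist_sq_eq using L2_nsq_prod[of "\<lambda>p. f p - g p"] assms by simp

text \<open>The rate 4^(-j) makes the sum over j of the slicewise squared distances integrable,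
  hence finite on almost every slice, and the terms of a convergent series tend to 0. Thus a single
  sequence serves almost all slices.\<close>

lemma AE_L2_dist_sq_tendsto_0:
  fixes F :: "nat \<Rightarrow> 'a::euclidean_space \<times> 'b::euclidean_space \<Rightarrow> complex"
  assumes F: "\<And>j. F j \<in> borel_measurable borel" and f: "f \<in> borel_measurable borel"
    and le: "\<And>j. L2_dist_sq lborel (F j) f \<le> ennreal ((1 / 4) ^ j)"
  shows "AE x in lborel. (\<lambda>j. L2_dist_sq lborel (\<lambda>y. F j (x, y)) (\<lambda>y. f (x, y))) \<longlonglongrightarrow> 0"
proof -
  let ?d = "\<lambda>j x. L2_dist_sq lborel (\<lambda>y. F j (x, y)) (\<lambda>y. f (x, y))"
  have [measurable]: "?d j \<in> borel_measurable borel" for j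
    unfolding L2_dist_sq_eq using F f measurable_L2_nsq_slice[of "\<lambda>p. F j p - f p"] by simp
  have "(\<integral>\<^sup>+x. (\<Sum>j. ?d j x) \<partial>lborel) = (\<Sum>j. \<integral>\<^sup>+x. ?d j x \<partial>lborel)"
    by (rule nn_integral_suminf) measurable
  also have "\<dots> \<le> (\<Sum>j. ennreal ((1 / 4) ^ j))"
    using le by (intro suminf_le) (simp_all flip: L2_dist_sq_prod[OF F f])
  also have "\<dots> < \<infinity>"
  proof -
    have "(\<Sum>j. ennreal ((1 / 4) ^ j)) \<noteq> top"
      by (rule ennreal_suminf_neq_top) (auto intro!: summable_geometric)
    then show ?thesis
      by (simp only: less_top infinity_ennreal_def)
  qed
  finally have "AE x in lborel. (\<Sum>j. ?d j x) \<noteq> \<infinity>"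
    by (intro nn_integral_PInf_AE) auto
  then show ?thesis
  proof eventually_elim
    fix x assume fin: "(\<Sum>j. ?d j x) \<noteq> \<infinity>"
    have "?d j x \<noteq> top" for j
      using ennreal_suminf_lessD[of "\<lambda>j. ?d j x" top j] fin by (simp add: less_top)
    then have d: "?d j x = ennreal (enn2real (?d j x))" for j
      by (simp add: less_top)
    have "summable (\<lambda>j. enn2real (?d j x))"
      by (rule summable_suminf_not_top) (use fin d in auto)
    then have "(\<lambda>j. ennreal (enn2real (?d j x))) \<longlonglongrightarrow> ennreal 0"
      by (intro tendsto_ennrealI summable_LIMSEQ_zero)
    then show "(\<lambda>j. ?d j x) \<longlonglongrightarrow> 0"
      by (simp flip: d)
  qed
qed

section \<open>The partial Fourier transform and \<open>\<G>\<close>\<close>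

text \<open>Produces approximants in both L1 and L2, as \<open>is_fourier_L2\<close> asks for: a
  cut-off function is the product of two L2 functions, g and the indicator of a ball.\<close>

lemma L2_cutoff:
  fixes g :: "'b::euclidean_space \<Rightarrow> complex"
  assumes g: "g \<in> L2 lborel"
  shows "(\<lambda>y. if norm y \<le> r then g y else 0) \<in> L2 lborel"
    and "integrable lborel (\<lambda>y. if norm y \<le> r then g y else 0)"
proof -
  have [measurable]: "g \<in> borel_measurable borel" using g by (simp add: L2_def)
  show "(\<lambda>y. if norm y \<le> r then g y else 0) \<in> L2 lborel"
    by (rule L2_dominated[OF g]) auto
  have "(\<lambda>y::'b. indicator (cball 0 r) y :: complex) \<in> L2 lborel"
  proof -
    have "L2_nsq lborel (\<lambda>y::'b. indicator (cball 0 r) y :: complex) = (\<integral>\<^sup>+y. indicator (cball 0 r) y \<partial>(lborel :: 'b measure))"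
      unfolding L2_nsq_def by (rule nn_integral_cong) (auto split: split_indicator)
    also have "\<dots> < \<infinity>"
      using emeasure_lborel_cball_finite[of "0 :: 'b" r] by simp
    finally show ?thesis
      by (auto simp: L2_iff intro!: borel_measurable_indicator)
  qed
  from L2_integrable_mult[OF g this]
  show "integrable lborel (\<lambda>y. if norm y \<le> r then g y else 0)"
    by (rule Bochner_Integration.integrable_cong[THEN iffD1, rotated 2]) (auto simp: indicator_def)
qed

text \<open>Choosing transforms slice by slice could lose joint measurability. Instead f is cut off
  in the second variable only; the Fourier integrals of the cut-off slices are jointly measurable in
  (x, \<xi>), and the contraction property on slices makes them a Cauchy sequence in L2 of the
  product. Their limit u is jointly measurable, and its slices are the L2 transforms for almost
  every x.\<close>

lemma partial_fourier_exists:
  fixes f :: "(real ^ 'm) \<times> (real ^ 'n) \<Rightarrow> complex"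
  assumes f: "f \<in> L2 lborel"
  obtains u where "u \<in> L2 lborel"
    "AE x in lborel. is_fourier_L2 (\<lambda>y. f (x, y)) (\<lambda>\<xi>. u (x, \<xi>))"
proof -
  have fm: "f \<in> borel_measurable borel" using f by (simp add: L2_def)
  then have [measurable]: "f \<in> borel_measurable (borel \<Otimes>\<^sub>M borel)" by (simp add: borel_prod)
  define F where "F n = (\<lambda>p. if norm (snd p) \<le> real n then f p else 0)" for n :: nat
  have Fm': "F n \<in> borel_measurable (borel \<Otimes>\<^sub>M borel)" for n
    unfolding F_def by measurable
  then have Fm: "F n \<in> borel_measurable borel" for n
    by (simp add: borel_prod)
  note [measurable] = Fm'
  define \<epsilon> where "\<epsilon> n = L2_nsq lborel (\<lambda>p. f p - F n p)" for n
  have "\<epsilon> \<longlonglongrightarrow> (\<integral>\<^sup>+p. 0 \<partial>(lborel :: ((real ^ 'm) \<times> (real ^ 'n)) measure))"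
    unfolding \<epsilon>_def L2_nsq_def
  proof (rule nn_integral_dominated_convergence[where w = "\<lambda>p. ennreal ((cmod (f p))\<^sup>2)"])
    show "AE p in lborel. (\<lambda>n. ennreal ((cmod (f p - F n p))\<^sup>2)) \<longlonglongrightarrow> 0"
    proof (rule AE_I2)
      fix p :: "(real ^ 'm) \<times> (real ^ 'n)"
      obtain N :: nat where N: "norm (snd p) \<le> real N"
        using real_arch_simple by blast
      show "(\<lambda>n. ennreal ((cmod (f p - F n p))\<^sup>2)) \<longlonglongrightarrow> 0"
        by (rule tendsto_eventually, rule eventually_sequentiallyI[of N]) (use N in \<open>auto simp: F_def\<close>)
    qed
    show "(\<integral>\<^sup>+p. ennreal ((cmod (f p))\<^sup>2) \<partial>lborel) < \<infinity>"
      using L2_nsq_finite[OF f] by (simp add: L2_nsq_def)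
  qed (use fm Fm in \<open>auto simp: F_def intro!: ennreal_leI\<close>)
  then have \<epsilon>: "\<epsilon> \<longlonglongrightarrow> 0" by simp
  have "\<exists>N. \<forall>n\<ge>N. \<epsilon> n \<le> ennreal ((1 / 4) ^ j)" for j
  proof -
    have "eventually (\<lambda>n. \<epsilon> n < ennreal ((1 / 4) ^ j)) sequentially"
      by (rule order_tendstoD(2)[OF \<epsilon>]) simp
    then show ?thesis
      by (auto simp: eventually_sequentially intro: less_imp_le)
  qed
  \<comment> \<open>Cutoff radii giving the rate 4^(-j) that \<open>L2_complete\<close> and
    \<open>AE_L2_dist_sq_tendsto_0\<close> require.\<close>
  then obtain \<rho> where \<rho>: "\<And>j n. n \<ge> \<rho> j \<Longrightarrow> \<epsilon> n \<le> ennreal ((1 / 4) ^ j)"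
    by metis
  have Ff: "L2_dist_sq lborel (F (\<rho> j)) f \<le> ennreal ((1 / 4) ^ j)" for j
    using \<rho>[of j "\<rho> j"] unfolding L2_dist_sq_commute[of _ "F (\<rho> j)" f] by (simp add: \<epsilon>_def L2_dist_sq_eq)
  have FF: "L2_dist_sq lborel (F (\<rho> i)) (F (\<rho> j)) \<le> ennreal ((1 / 4) ^ j)" if "j \<le> i" for i j
  proof -
    \<comment> \<open>The two cutoffs differ only beyond the smaller radius, and there by at most
      |f|. As \<rho> need not be monotone, either radius may be the smaller one; if it is
      \<open>\<rho> i\<close>, the bound 4^(-i) suffices because j \<le> i.\<close>
    have "L2_dist_sq lborel (F (\<rho> i)) (F (\<rho> j)) \<le> \<epsilon> (min (\<rho> i) (\<rho> j))"
      unfolding L2_dist_sq_eq \<epsilon>_def by (rule L2_nsq_mono) (auto simp: F_def)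
    also have "\<dots> \<le> ennreal ((1 / 4) ^ j)"
    proof (cases "\<rho> j \<le> \<rho> i")
      case True
      then show ?thesis using \<rho>[of j "\<rho> j"] by (simp add: min_def)
    next
      case False
      then have "\<epsilon> (min (\<rho> i) (\<rho> j)) \<le> ennreal ((1 / 4) ^ i)"
        using \<rho>[of i "\<rho> i"] by (simp add: min_def)
      also have "\<dots> \<le> ennreal ((1 / 4) ^ j)"
        using that by (intro ennreal_leI power_decreasing) auto
      finally show ?thesis .
    qed
    finally show ?thesis .
  qed
  define v where "v j = (\<lambda>(x, \<xi>). fourier_integral (\<lambda>y. F (\<rho> j) (x, y)) \<xi>)" for j
  have "v j \<in> borel_measurable (borel \<Otimes>\<^sub>M borel)" for j
    unfolding v_def fourier_integral_def by measurable
  then have vm: "v j \<in> borel_measurable borel" for j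
    by (simp add: borel_prod)
  have slice: "AE x in lborel. (\<lambda>y. f (x, y)) \<in> L2 lborel"
    by (rule AE_slice_L2[OF f])
  have Fs: "(\<lambda>y. F n (x, y)) \<in> L2 lborel" "integrable lborel (\<lambda>y. F n (x, y))"
    if "(\<lambda>y. f (x, y)) \<in> L2 lborel" for n x
    using L2_cutoff[OF that, of "real n"] by (simp_all add: F_def)
  have vv: "L2_dist_sq lborel (v i) (v j) \<le> ennreal ((1 / 4) ^ j)" if "j \<le> i" for i j
  proof -
    have "L2_dist_sq lborel (v i) (v j) = (\<integral>\<^sup>+x. L2_dist_sq lborel (\<lambda>y. v i (x, y)) (\<lambda>y. v j (x, y)) \<partial>lborel)"
      by (rule L2_dist_sq_prod) (rule vm)+
    also have "\<dots> \<le> (\<integral>\<^sup>+x. L2_dist_sq lborel (\<lambda>y. F (\<rho> i) (x, y)) (\<lambda>y. F (\<rho> j) (x, y)) \<partial>lborel)"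
    proof (rule nn_integral_mono_AE)
      show "AE x in lborel. L2_dist_sq lborel (\<lambda>y. v i (x, y)) (\<lambda>y. v j (x, y))
          \<le> L2_dist_sq lborel (\<lambda>y. F (\<rho> i) (x, y)) (\<lambda>y. F (\<rho> j) (x, y))"
        using slice
      proof eventually_elim
        fix x assume x: "(\<lambda>y. f (x, y)) \<in> L2 lborel"
        show "L2_dist_sq lborel (\<lambda>y. v i (x, y)) (\<lambda>y. v j (x, y))
          \<le> L2_dist_sq lborel (\<lambda>y. F (\<rho> i) (x, y)) (\<lambda>y. F (\<rho> j) (x, y))"
          unfolding v_def prod.case by (rule L2_dist_sq_fourier_integral_le) (rule Fs[OF x])+
      qed
    qed
    also have "\<dots> = L2_dist_sq lborel (F (\<rho> i)) (F (\<rho> j))"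
      by (rule L2_dist_sq_prod[symmetric]) (rule Fm)+
    also have "\<dots> \<le> ennreal ((1 / 4) ^ j)"
      by (rule FF[OF that])
    finally show ?thesis .
  qed
  obtain u where u: "u \<in> borel_measurable lborel" "\<And>j. L2_dist_sq lborel (v j) u \<le> ennreal ((1 / 4) ^ j)"
    by (rule L2_complete[of v lborel]) (use vm vv in auto)
  have um: "u \<in> borel_measurable borel" using u(1) by simp
  show thesis
  proof
    have "L2_nsq lborel (v 0) \<le> L2_nsq lborel (F (\<rho> 0))"
      unfolding L2_nsq_prod[OF vm] L2_nsq_prod[OF Fm]
    proof (rule nn_integral_mono_AE)
      show "AE x in lborel. L2_nsq lborel (\<lambda>y. v 0 (x, y)) \<le> L2_nsq lborel (\<lambda>y. F (\<rho> 0) (x, y))"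
        using slice
      proof eventually_elim
        fix x assume x: "(\<lambda>y. f (x, y)) \<in> L2 lborel"
        show "L2_nsq lborel (\<lambda>y. v 0 (x, y)) \<le> L2_nsq lborel (\<lambda>y. F (\<rho> 0) (x, y))"
          unfolding v_def prod.case by (rule L2_nsq_fourier_integral_le) (rule Fs[OF x])
      qed
    qed
    also have "\<dots> \<le> L2_nsq lborel f"
      by (rule L2_nsq_mono) (auto simp: F_def)
    finally have "L2_nsq lborel (v 0) < \<infinity>"
      using L2_nsq_finite[OF f] by (rule le_less_trans)
    then have v0: "v 0 \<in> L2 lborel"
      using vm by (simp add: L2_iff)
    have "L2_dist_sq lborel (v 0) u < \<infinity>"
      using u(2)[of 0] by (rule le_less_trans) simp
    then have "(\<lambda>x. v 0 x - u x) \<in> L2 lborel"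
      using vm um by (simp add: L2_iff L2_dist_sq_eq)
    from L2_diff[OF v0 this] show "u \<in> L2 lborel"
      by simp
    have 1: "AE x in lborel. (\<lambda>j. L2_dist_sq lborel (\<lambda>y. F (\<rho> j) (x, y)) (\<lambda>y. f (x, y))) \<longlonglongrightarrow> 0"
      by (rule AE_L2_dist_sq_tendsto_0[OF Fm fm Ff])
    have 2: "AE x in lborel. (\<lambda>j. L2_dist_sq lborel (\<lambda>y. v j (x, y)) (\<lambda>y. u (x, y))) \<longlonglongrightarrow> 0"
      by (rule AE_L2_dist_sq_tendsto_0[OF vm um u(2)])
    show "AE x in lborel. is_fourier_L2 (\<lambda>y. f (x, y)) (\<lambda>\<xi>. u (x, \<xi>))"
      using slice AE_slice_L2[OF \<open>u \<in> L2 lborel\<close>] 1 2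
    proof eventually_elim
      fix x
      assume x: "(\<lambda>y. f (x, y)) \<in> L2 lborel" and ux: "(\<lambda>y. u (x, y)) \<in> L2 lborel"
        and 1: "(\<lambda>j. L2_dist_sq lborel (\<lambda>y. F (\<rho> j) (x, y)) (\<lambda>y. f (x, y))) \<longlonglongrightarrow> 0"
        and 2: "(\<lambda>j. L2_dist_sq lborel (\<lambda>y. v j (x, y)) (\<lambda>y. u (x, y))) \<longlonglongrightarrow> 0"
      show "is_fourier_L2 (\<lambda>y. f (x, y)) (\<lambda>\<xi>. u (x, \<xi>))"
        unfolding is_fourier_L2_def
        using x ux 1 2 Fs[OF x]
        by (intro conjI exI[of _ "\<lambda>j y. F (\<rho> j) (x, y)"]) (auto simp: v_def)
    qed
  qed
qed

text \<open>\<open>partial_fourier\<close> is a choice built on the choice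
  \<open>fourier_L2\<close>. The function from \<open>partial_fourier_exists\<close> satisfies the
  defining predicate, since on almost every slice the L2 transform is unique up to null sets; hence
  the chosen function satisfies it too.\<close>

lemma
  fixes f :: "(real ^ 'm) \<times> (real ^ 'n) \<Rightarrow> complex"
  assumes f: "f \<in> L2 lborel"
  shows partial_fourier_L2: "partial_fourier f \<in> L2 lborel"
    and is_fourier_L2_partial_fourier:
      "AE x in lborel. is_fourier_L2 (\<lambda>y. f (x, y)) (\<lambda>\<xi>. partial_fourier f (x, \<xi>))"
proof -
  let ?Q = "\<lambda>u. u \<in> L2 lborel \<and> (AE x in lborel. AE \<xi> in lborel. u (x, \<xi>) = fourier_L2 (\<lambda>y. f (x, y)) \<xi>)"
  obtain u where u: "u \<in> L2 lborel" "AE x in lborel. is_fourier_L2 (\<lambda>y. f (x, y)) (\<lambda>\<xi>. u (x, \<xi>))"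
    by (rule partial_fourier_exists[OF f])
  have F: "AE x in lborel. is_fourier_L2 (\<lambda>y. f (x, y)) (fourier_L2 (\<lambda>y. f (x, y)))"
    using u(2)
  proof eventually_elim
    fix x assume "is_fourier_L2 (\<lambda>y. f (x, y)) (\<lambda>\<xi>. u (x, \<xi>))"
    then show "is_fourier_L2 (\<lambda>y. f (x, y)) (fourier_L2 (\<lambda>y. f (x, y)))"
      unfolding fourier_L2_def by (rule someI[where P = "is_fourier_L2 (\<lambda>y. f (x, y))"])
  qed
  have "?Q u"
    using u F by (auto elim!: eventually_elim2 intro: is_fourier_L2_unique)
  then have Q: "?Q (partial_fourier f)"
    unfolding partial_fourier_def by (rule someI[where P = ?Q])
  then show p: "partial_fourier f \<in> L2 lborel"
    by simp
  have pm: "partial_fourier f \<in> borel_measurable borel"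
    using p by (simp add: L2_def)
  have "AE x in lborel. AE \<xi> in lborel. partial_fourier f (x, \<xi>) = fourier_L2 (\<lambda>y. f (x, y)) \<xi>"
    using Q by simp
  with F show "AE x in lborel. is_fourier_L2 (\<lambda>y. f (x, y)) (\<lambda>\<xi>. partial_fourier f (x, \<xi>))"
  proof eventually_elim
    fix x
    assume 1: "is_fourier_L2 (\<lambda>y. f (x, y)) (fourier_L2 (\<lambda>y. f (x, y)))"
      and 2: "AE \<xi> in lborel. partial_fourier f (x, \<xi>) = fourier_L2 (\<lambda>y. f (x, y)) \<xi>"
    show "is_fourier_L2 (\<lambda>y. f (x, y)) (\<lambda>\<xi>. partial_fourier f (x, \<xi>))"
      by (rule is_fourier_L2_cong_AE[OF 1]) (use 2 slice_measurable[OF pm] in auto)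
  qed
qed

lemma AE_lborel_prod_iff:
  fixes f g :: "'a::euclidean_space \<times> 'b::euclidean_space \<Rightarrow> complex"
  assumes "f \<in> borel_measurable borel" "g \<in> borel_measurable borel"
  shows "(AE p in lborel. f p = g p) \<longleftrightarrow> (AE x in lborel. AE y in lborel. f (x, y) = g (x, y))"
    and "(AE p in lborel. f p = g p) \<longleftrightarrow> (AE y in lborel. AE x in lborel. f (x, y) = g (x, y))"
proof -
  have [measurable]: "f \<in> borel_measurable (borel \<Otimes>\<^sub>M borel)" "g \<in> borel_measurable (borel \<Otimes>\<^sub>M borel)"
    using assms by (simp_all add: borel_prod)
  have m: "{p \<in> space (lborel \<Otimes>\<^sub>M lborel). f (fst p, snd p) = g (fst p, snd p)} \<in> sets (lborel \<Otimes>\<^sub>M lborel)"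
    by measurable
  show 1: "(AE p in lborel. f p = g p) \<longleftrightarrow> (AE x in lborel. AE y in lborel. f (x, y) = g (x, y))"
    using lborel_pair.AE_pair_iff[of "\<lambda>x y. f (x, y) = g (x, y)", OF m] unfolding lborel_prod[symmetric] by simp
  show "(AE p in lborel. f p = g p) \<longleftrightarrow> (AE y in lborel. AE x in lborel. f (x, y) = g (x, y))"
    unfolding 1 using lborel_pair.AE_commute[of "\<lambda>x y. f (x, y) = g (x, y)", OF m] by simp
qed

text \<open>Computes the choice on concrete functions: uniqueness on almost every slice and joint
  measurability determine the representative up to a null set.\<close>

lemma partial_fourier_eq:
  fixes f v :: "(real ^ 'm) \<times> (real ^ 'n) \<Rightarrow> complex"
  assumes f: "f \<in> L2 lborel" and v: "v \<in> borel_measurable borel"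
    and F: "AE x in lborel. is_fourier_L2 (\<lambda>y. f (x, y)) (\<lambda>\<xi>. v (x, \<xi>))"
  shows "AE p in lborel. partial_fourier f p = v p"
proof (subst AE_lborel_prod_iff)
  show "partial_fourier f \<in> borel_measurable borel"
    using partial_fourier_L2[OF f] by (simp add: L2_def)
  show "AE x in lborel. AE y in lborel. partial_fourier f (x, y) = v (x, y)"
    using F is_fourier_L2_partial_fourier[OF f]
    by eventually_elim (rule is_fourier_L2_unique)
qed (rule v)

lemma partial_fourier_injective:
  fixes f g :: "(real ^ 'm) \<times> (real ^ 'n) \<Rightarrow> complex"
  assumes f: "f \<in> L2 lborel" and g: "g \<in> L2 lborel"
    and eq: "AE p in lborel. partial_fourier f p = partial_fourier g p"
  shows "AE p in lborel. f p = g p"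
proof (subst AE_lborel_prod_iff)
  show "f \<in> borel_measurable borel" "g \<in> borel_measurable borel"
    using f g by (auto simp: L2_def)
  have pf: "partial_fourier f \<in> borel_measurable borel" and pg: "partial_fourier g \<in> borel_measurable borel"
    using partial_fourier_L2[OF f] partial_fourier_L2[OF g] by (auto simp: L2_def)
  have "AE x in lborel. AE y in lborel. partial_fourier f (x, y) = partial_fourier g (x, y)"
    using eq AE_lborel_prod_iff(1)[OF pf pg] by simp
  then show "AE x in lborel. AE y in lborel. f (x, y) = g (x, y)"
    using is_fourier_L2_partial_fourier[OF f] is_fourier_L2_partial_fourier[OF g]
  proof eventually_elim
    fix x
    assume eq: "AE y in lborel. partial_fourier f (x, y) = partial_fourier g (x, y)"
      and F: "is_fourier_L2 (\<lambda>y. f (x, y)) (\<lambda>\<xi>. partial_fourier f (x, \<xi>))"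
      and G: "is_fourier_L2 (\<lambda>y. g (x, y)) (\<lambda>\<xi>. partial_fourier g (x, \<xi>))"
    have "is_fourier_L2 (\<lambda>y. f (x, y)) (\<lambda>\<xi>. partial_fourier g (x, \<xi>))"
      by (rule is_fourier_L2_cong_AE[OF F _ eq]) (simp add: slice_measurable[OF pg])
    then show "AE y in lborel. f (x, y) = g (x, y)"
      using G by (rule is_fourier_L2_injective)
  qed
qed

text \<open>At almost every fixed \<xi>, equal Hermite coefficients give equal slices of the partial
  Fourier transforms by completeness, and these transforms determine the functions.\<close>

theorem G_transform_injective:
  fixes f g :: "(real ^ 'm) \<times> (real ^ 'n) \<Rightarrow> complex"
  assumes f: "f \<in> L2 lborel" and g: "g \<in> L2 lborel"
    and eq: "AE p in Gamma_measure. G_transform f p = G_transform g p"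
  shows "AE p in lborel. f p = g p"
proof (rule partial_fourier_injective[OF f g])
  let ?u = "partial_fourier f" and ?v = "partial_fourier g"
  have u: "?u \<in> L2 lborel" and v: "?v \<in> L2 lborel"
    using partial_fourier_L2[OF f] partial_fourier_L2[OF g] by auto
  have m: "?u \<in> borel_measurable borel" "?v \<in> borel_measurable borel"
    using u v by (auto simp: L2_def)
  interpret C: sigma_finite_measure "count_space (UNIV :: (nat ^ 'm) set)"
    by (rule sigma_finite_measure_count_space)
  interpret P: pair_sigma_finite "count_space (UNIV :: (nat ^ 'm) set)" "lborel :: (real ^ 'n) measure" ..
  have "AE k in count_space UNIV. AE \<xi> in lborel. G_transform f (k, \<xi>) = G_transform g (k, \<xi>)"
    using P.AE_pair[OF eq[unfolded Gamma_measure_def]] .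
  then have "\<And>k. AE \<xi> in lborel. G_transform f (k, \<xi>) = G_transform g (k, \<xi>)"
    by (simp add: AE_count_space)
  \<comment> \<open>Multi-indices are countable, so the exceptional null sets can be united.\<close>
  then have k: "AE \<xi> in lborel. \<forall>k. G_transform f (k, \<xi>) = G_transform g (k, \<xi>)"
    by (simp add: AE_all_countable)
  show "AE p in lborel. ?u p = ?v p"
    unfolding AE_lborel_prod_iff(2)[OF m]
    \<comment> \<open>At \<xi> = 0 the functions \<open>hermite_scaled k 0\<close> vanish
      identically and determine nothing, so this point is removed.\<close>
    using k AE_slice_L2'[OF u] AE_slice_L2'[OF v] AE_lborel_singleton[of 0]
  proof eventually_elim
    fix \<xi> :: "real ^ 'n"
    assume k: "\<forall>k. G_transform f (k, \<xi>) = G_transform g (k, \<xi>)"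
      and u: "(\<lambda>x. ?u (x, \<xi>)) \<in> L2 lborel" and v: "(\<lambda>x. ?v (x, \<xi>)) \<in> L2 lborel" and "\<xi> \<noteq> 0"
    then have \<tau>: "norm \<xi> > 0" by simp
    have "AE x in lborel. ?u (x, \<xi>) - ?v (x, \<xi>) = 0"
    proof (rule hermite_complete[OF \<tau> L2_diff[OF u v]])
      fix k
      show "L2_inner lborel (\<lambda>x. ?u (x, \<xi>) - ?v (x, \<xi>)) (\<lambda>x. complex_of_real (hermite_scaled k (norm \<xi>) x)) = 0"
        using k L2_inner_diff_left[OF u v hermite_scaled_L2[OF \<tau>, of k]]
        by (simp add: G_transform_def hermite_transform_def)
    qed
    then show "AE x in lborel. ?u (x, \<xi>) = ?v (x, \<xi>)"
      by simp
  qed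
qed

text \<open>Bessel's inequality bounds the coefficients at a fixed \<xi> by the slice of
  \<open>partial_fourier f\<close>; integrating over \<xi> gives the squared norm of a function
  known to lie in L2.\<close>

lemma G_transform_L2:
  fixes f :: "(real ^ 'm) \<times> (real ^ 'n) \<Rightarrow> complex"
  assumes f: "f \<in> L2 lborel"
  shows "G_transform f \<in> L2 Gamma_measure"
proof -
  let ?u = "partial_fourier f"
  have u: "?u \<in> L2 lborel"
    by (rule partial_fourier_L2[OF f])
  have um: "?u \<in> borel_measurable borel"
    using u by (simp add: L2_def)
  then have [measurable]: "?u \<in> borel_measurable (borel \<Otimes>\<^sub>M borel)"
    by (simp add: borel_prod)
  interpret C: sigma_finite_measure "count_space (UNIV :: (nat ^ 'm) set)"
    by (rule sigma_finite_measure_count_space)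
  interpret P: pair_sigma_finite "count_space (UNIV :: (nat ^ 'm) set)" "lborel :: (real ^ 'n) measure" ..
  have slice: "(\<lambda>\<xi>. G_transform f (k, \<xi>)) \<in> borel_measurable borel" for k
    unfolding G_transform_def hermite_transform_def L2_inner_def prod.case by measurable
  \<comment> \<open>The first factor is countable and discrete, so measurability in \<xi> for each k
    suffices.\<close>
  have m: "G_transform f \<in> borel_measurable (count_space UNIV \<Otimes>\<^sub>M lborel)"
    by (rule measurable_pair_measure_countable1) (use slice in simp_all)
  have "L2_nsq Gamma_measure (G_transform f) = (\<integral>\<^sup>+\<xi>. (\<integral>\<^sup>+k. ennreal ((cmod (G_transform f (k, \<xi>)))\<^sup>2) \<partial>count_space UNIV) \<partial>lborel)"
    unfolding L2_nsq_def Gamma_measure_def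
    using P.nn_integral_snd[of "\<lambda>p. ennreal ((cmod (G_transform f p))\<^sup>2)"] m by simp
  also have "\<dots> \<le> (\<integral>\<^sup>+\<xi>. L2_nsq lborel (\<lambda>x. ?u (x, \<xi>)) \<partial>lborel)"
  proof (rule nn_integral_mono_AE)
    show "AE \<xi> in lborel. (\<integral>\<^sup>+k. ennreal ((cmod (G_transform f (k, \<xi>)))\<^sup>2) \<partial>count_space UNIV) \<le> L2_nsq lborel (\<lambda>x. ?u (x, \<xi>))"
      using AE_slice_L2'[OF u] AE_lborel_singleton[of 0]
    proof eventually_elim
      fix \<xi> :: "real ^ 'n"
      assume u: "(\<lambda>x. ?u (x, \<xi>)) \<in> L2 lborel" and "\<xi> \<noteq> 0"
      then have \<tau>: "norm \<xi> > 0" by simp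
      show "(\<integral>\<^sup>+k. ennreal ((cmod (G_transform f (k, \<xi>)))\<^sup>2) \<partial>count_space UNIV) \<le> L2_nsq lborel (\<lambda>x. ?u (x, \<xi>))"
        unfolding G_transform_def hermite_transform_def prod.case
      proof (rule bessel_inequality[OF hermite_scaled_L2[OF \<tau>] _ u])
        fix k l :: "nat ^ 'm"
        show "L2_inner lborel (\<lambda>x. complex_of_real (hermite_scaled k (norm \<xi>) x)) (\<lambda>x. complex_of_real (hermite_scaled l (norm \<xi>) x))
            = (if k = l then 1 else 0)"
          using integral_hermite_scaled_mult[OF \<tau>, of k l]
          by (simp add: L2_inner_def flip: of_real_mult)
      qed
    qed
  qed
  also have "\<dots> = L2_nsq lborel ?u"
    by (rule L2_nsq_prod'[OF um, symmetric])
  also have "\<dots> < \<infinity>"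
    by (rule L2_nsq_finite[OF u])
  finally show ?thesis
    using m by (simp add: L2_iff Gamma_measure_def)
qed

section \<open>Integration by parts\<close>

lemma
  fixes f :: "'a::euclidean_space \<Rightarrow> complex"
  assumes f: "continuous_on UNIV f" and K: "compact K" and 0: "\<And>x. x \<notin> K \<Longrightarrow> f x = 0"
  shows integrable_compact_support: "integrable lborel f"
    and L2_compact_support: "f \<in> L2 lborel"
proof -
  have "integrable lborel (\<lambda>x. indicator K x *\<^sub>R f x)"
    by (rule borel_integrable_compact[OF K]) (rule continuous_on_subset[OF f], simp)
  moreover have "(\<lambda>x. indicator K x *\<^sub>R f x) = f"
    using 0 by (auto simp: indicator_def)
  ultimately show "integrable lborel f" by simp
  have "integrable lborel (\<lambda>x. indicator K x *\<^sub>R (cmod (f x))\<^sup>2)"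
    by (rule borel_integrable_compact[OF K]) (intro continuous_intros continuous_on_subset[OF f], simp)
  moreover have "(\<lambda>x. indicator K x *\<^sub>R (cmod (f x))\<^sup>2) = (\<lambda>x. (cmod (f x))\<^sup>2)"
    by (intro ext) (use 0 in \<open>auto split: split_indicator\<close>)
  ultimately show "f \<in> L2 lborel"
    using f by (simp add: L2_def borel_measurable_continuous_onI)
qed

text \<open>The form in which derivatives occur in \<open>Ck\<close>, so that closure of
  \<open>Cc_infinity\<close> under it is immediate; \<open>partial_deriv_slice\<close> translates
  from \<open>partial_deriv\<close>.\<close>

abbreviation dirderiv :: "'a::euclidean_space \<Rightarrow> ('a \<Rightarrow> complex) \<Rightarrow> 'a \<Rightarrow> complex" where
  "dirderiv v f \<equiv> (\<lambda>x. frechet_derivative f (at x) v)"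

definition csupp :: "('a::euclidean_space \<Rightarrow> complex) \<Rightarrow> 'a set" where
  "csupp f = closure {x. f x \<noteq> 0}"

lemma not_in_csupp: "x \<notin> csupp f \<Longrightarrow> f x = 0"
  using closure_subset[of "{x. f x \<noteq> 0}"] by (auto simp: csupp_def)

lemma dirderiv_not_in_csupp:
  assumes "x \<notin> csupp f"
  shows "dirderiv v f x = 0"
proof -
  have "((\<lambda>_. 0) has_derivative (\<lambda>_. 0)) (at x)"
    by simp
  then have "(f has_derivative (\<lambda>_. 0)) (at x)"
  proof (rule has_derivative_transform_within_open)
    show "open (- csupp f)"
      by (simp add: csupp_def open_Compl)
  qed (use assms in \<open>auto simp: not_in_csupp\<close>)
  then show ?thesis
    using fun_cong[OF frechet_derivative_at, of f "\<lambda>_. 0" x v] by simp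
qed

lemma csupp_dirderiv_subset: "csupp (dirderiv v f) \<subseteq> csupp f"
  unfolding csupp_def[of "dirderiv v f"]
proof (rule closure_minimal)
  show "{x. dirderiv v f x \<noteq> 0} \<subseteq> csupp f"
    using dirderiv_not_in_csupp by blast
qed (simp add: csupp_def)

lemma Cc_infinity_iff: "f \<in> Cc_infinity \<longleftrightarrow> (\<forall>k. Ck k f) \<and> compact (csupp f)"
  by (simp add: Cc_infinity_def csupp_def)

lemma Cc_infinity_dirderiv:
  assumes "f \<in> Cc_infinity"
  shows "dirderiv v f \<in> Cc_infinity"
  unfolding Cc_infinity_iff
proof
  show "\<forall>k. Ck k (dirderiv v f)"
  proof
    fix k
    have "Ck (Suc k) f"
      using assms by (simp only: Cc_infinity_iff)
    then show "Ck k (dirderiv v f)"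
      by simp
  qed
  have "closed (csupp (dirderiv v f))"
    by (simp add: csupp_def)
  then show "compact (csupp (dirderiv v f))"
    using assms compact_Int_closed[of "csupp f" "csupp (dirderiv v f)"] csupp_dirderiv_subset[of f v]
    by (simp add: Cc_infinity_iff Int_absorb1)
qed

lemma Cc_infinity_continuous: "f \<in> Cc_infinity \<Longrightarrow> continuous_on UNIV f"
  unfolding Cc_infinity_iff by (metis Ck.simps(1))

lemma has_vector_derivative_dirderiv:
  assumes "f \<in> Cc_infinity"
  shows "((\<lambda>t. f (x + t *\<^sub>R b)) has_vector_derivative dirderiv b f (x + t *\<^sub>R b)) (at t)"
proof -
  let ?y = "x + t *\<^sub>R b"
  have "Ck (Suc 0) f"
    using assms by (simp only: Cc_infinity_iff)
  then have d: "f differentiable (at ?y)"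
    by simp
  then have D: "(f has_derivative frechet_derivative f (at ?y)) (at ?y)"
    by (simp add: frechet_derivative_works)
  have "((\<lambda>t. x + t *\<^sub>R b) has_derivative (\<lambda>h. h *\<^sub>R b)) (at t)"
    by (auto intro!: derivative_eq_intros)
  from diff_chain_at[OF this D] show ?thesis
    by (simp add: has_vector_derivative_def o_def linear_cmul[OF linear_frechet_derivative[OF d]])
qed

lemma has_vector_derivative_imp_diff_quotient:
  fixes f :: "real \<Rightarrow> 'a::real_normed_vector"
  assumes f: "(f has_vector_derivative D) (at x)" and t: "filterlim t (at 0) F"
  shows "((\<lambda>n. (1 / t n) *\<^sub>R (f (x + t n) - f x)) \<longlongrightarrow> D) F"
proof -
  have "((\<lambda>y. norm ((f y - f x) - (y - x) *\<^sub>R D) / norm (y - x)) \<longlongrightarrow> 0) (at x)"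
    using f unfolding has_vector_derivative_def has_derivative_iff_norm by simp
  moreover have t': "filterlim (\<lambda>n. x + t n) (at x) F"
    using t by (auto simp: filterlim_at intro!: tendsto_eq_intros)
  ultimately have "((\<lambda>n. norm ((f (x + t n) - f x) - (x + t n - x) *\<^sub>R D) / norm (x + t n - x)) \<longlongrightarrow> 0) F"
    by (rule filterlim_compose)
  then have "((\<lambda>n. norm ((1 / t n) *\<^sub>R (f (x + t n) - f x) - D)) \<longlongrightarrow> 0) F"
  proof (rule Lim_transform_eventually)
    have "eventually (\<lambda>n. t n \<noteq> 0) F"
      using t by (simp add: filterlim_at)
    then show "\<forall>\<^sub>F n in F. norm ((f (x + t n) - f x) - (x + t n - x) *\<^sub>R D) / norm (x + t n - x) = norm ((1 / t n) *\<^sub>R (f (x + t n) - f x) - D)"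
    proof eventually_elim
      fix n assume n: "t n \<noteq> 0"
      have "(1 / t n) *\<^sub>R (f (x + t n) - f x) - D = (1 / t n) *\<^sub>R ((f (x + t n) - f x) - t n *\<^sub>R D)"
        using n by (simp add: scaleR_diff_right)
      then show "norm ((f (x + t n) - f x) - (x + t n - x) *\<^sub>R D) / norm (x + t n - x) = norm ((1 / t n) *\<^sub>R (f (x + t n) - f x) - D)"
        by simp
    qed
  qed
  then show ?thesis
    by (simp add: LIM_zero_iff tendsto_norm_zero_iff)
qed

text \<open>Translation invariance gives every difference quotient the integral 0, and the limit is
  taken by dominated convergence; this avoids choosing coordinates in which b is an axis.\<close>

lemma integral_directional_derivative_eq_0:
  fixes F F' :: "'a::euclidean_space \<Rightarrow> complex"
  assumes der: "\<And>x t. ((\<lambda>t. F (x + t *\<^sub>R b)) has_vector_derivative F' (x + t *\<^sub>R b)) (at t)"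
    and F: "continuous_on UNIV F" and F': "continuous_on UNIV F'"
    and K: "compact K" "\<And>x. x \<notin> K \<Longrightarrow> F x = 0" "\<And>x. x \<notin> K \<Longrightarrow> F' x = 0"
  shows "(LINT x|lborel. F' x) = 0"
proof -
  define t where "t n = 1 / real (Suc n)" for n
  have t: "0 < t n" "t n \<le> 1" for n
    by (simp_all add: t_def)
  have "compact (F' ` K)"
    by (rule compact_continuous_image[OF continuous_on_subset[OF F'] K(1)]) simp
  then obtain B where B: "\<And>x. x \<in> K \<Longrightarrow> cmod (F' x) \<le> B"
    using compact_imp_bounded by (force simp: bounded_iff)
  \<comment> \<open>\<open>B\<close> could be negative if \<open>K\<close> is empty; the absolute
    value makes the bound valid off \<open>K\<close> as well.\<close>
  have B': "cmod (F' x) \<le> \<bar>B\<bar>" for x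
    using B[of x] K(3)[of x] by (cases "x \<in> K") auto
  \<comment> \<open>K swept along -b for times in [0, 1]: outside \<open>K'\<close> neither x nor x
    + t b lies in K for 0 \<le> t \<le> 1, so all the difference quotients live on one compact
    set.\<close>
  define K' where "K' = (\<lambda>(x, s). x - s *\<^sub>R b) ` (K \<times> {0..1})"
  have K': "compact K'"
    unfolding K'_def
    by (intro compact_continuous_image compact_Times K(1) compact_Icc) (auto simp: case_prod_beta intro!: continuous_intros)
  have notK': "x + s *\<^sub>R b \<notin> K" if "x \<notin> K'" "0 \<le> s" "s \<le> 1" for x s
  proof
    assume "x + s *\<^sub>R b \<in> K"
    then have "(\<lambda>(x, s). x - s *\<^sub>R b) (x + s *\<^sub>R b, s) \<in> K'"
      unfolding K'_def using that by (intro imageI) auto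
    then show False using that by simp
  qed
  let ?s = "\<lambda>n x. (1 / t n) *\<^sub>R (F (x + t n *\<^sub>R b) - F x)"
  have [measurable]: "F \<in> borel_measurable borel" "F' \<in> borel_measurable borel"
    using F F' by (auto intro: borel_measurable_continuous_onI)
  have int: "integrable lborel F"
    by (rule integrable_compact_support[OF F K(1,2)])
  have zero: "(LINT x|lborel. ?s n x) = 0" for n
  proof -
    have eq: "(LINT x|lborel. F (x + t n *\<^sub>R b)) = (LINT x|lborel. F x)"
      using lborel_integral_affine[of F 1 "t n *\<^sub>R b"] by (simp add: add.commute)
    have "integrable lborel (\<lambda>x. F (x + t n *\<^sub>R b))"
    proof (rule integrable_compact_support)
      show "continuous_on UNIV (\<lambda>x. F (x + t n *\<^sub>R b))"
        by (rule continuous_on_compose2[OF F]) (auto intro!: continuous_intros)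
      show "compact K'" by (rule K')
      show "F (x + t n *\<^sub>R b) = 0" if "x \<notin> K'" for x
        using t[of n] notK'[OF that, of "t n"] K(2) by auto
    qed
    then show ?thesis
      using int eq by simp
  qed
  have "(\<lambda>n. LINT x|lborel. ?s n x) \<longlonglongrightarrow> (LINT x|lborel. F' x)"
  proof (rule integral_dominated_convergence[where w = "\<lambda>x. indicator K' x *\<^sub>R \<bar>B\<bar>"])
    show "integrable lborel (\<lambda>x. indicator K' x *\<^sub>R \<bar>B\<bar>)"
      by (rule borel_integrable_compact[OF K']) simp
    show "AE x in lborel. (\<lambda>n. ?s n x) \<longlonglongrightarrow> F' x"
    proof (rule AE_I2)
      fix x
      have "((\<lambda>t. F (x + t *\<^sub>R b)) has_vector_derivative F' x) (at 0)"
        using der[of x 0] by simp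
      moreover have "filterlim t (at 0) sequentially"
        unfolding filterlim_at t_def using LIMSEQ_inverse_real_of_nat by (simp add: inverse_eq_divide)
      ultimately show "(\<lambda>n. ?s n x) \<longlonglongrightarrow> F' x"
        using has_vector_derivative_imp_diff_quotient[of "\<lambda>t. F (x + t *\<^sub>R b)" "F' x" 0 t] by simp
    qed
    show "AE x in lborel. norm (?s n x) \<le> indicator K' x *\<^sub>R \<bar>B\<bar>" for n
    proof (rule AE_I2)
      fix x
      show "norm (?s n x) \<le> indicator K' x *\<^sub>R \<bar>B\<bar>"
      proof (cases "x \<in> K'")
        case False
        then show ?thesis
          using notK'[of x 0] notK'[of x "t n"] t[of n] K(2) by simp
      next
        case True
        have "norm (F (x + t n *\<^sub>R b) - F (x + 0 *\<^sub>R b)) \<le> \<bar>B\<bar> * norm (t n - 0)"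
        proof (rule differentiable_bound[of "UNIV :: real set" "\<lambda>t. F (x + t *\<^sub>R b)" "\<lambda>t h. h *\<^sub>R F' (x + t *\<^sub>R b)"])
          show "((\<lambda>t. F (x + t *\<^sub>R b)) has_derivative (\<lambda>h. h *\<^sub>R F' (x + s *\<^sub>R b))) (at s)" for s
            using der[of x s] by (simp add: has_vector_derivative_def)
          show "onorm (\<lambda>h. h *\<^sub>R F' (x + s *\<^sub>R b)) \<le> \<bar>B\<bar>" for s
            by (rule onorm_le) (use B'[of "x + s *\<^sub>R b"] in \<open>simp add: mult.commute[of "\<bar>B\<bar>"] mult_left_mono\<close>)
        qed auto
        moreover have "norm (?s n x) = norm (F (x + t n *\<^sub>R b) - F (x + 0 *\<^sub>R b)) / t n"
          using t[of n] by (simp del: scaleR_right_diff_distrib)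
        ultimately show ?thesis
          using True t[of n] by (simp add: pos_divide_le_eq)
      qed
    qed
  qed measurable
  then show ?thesis
    unfolding zero by (simp add: LIMSEQ_const_iff)
qed

text \<open>Green's identity in direction b: \<phi>'' \<psi> - \<phi> \<psi>'' is the derivative of
  \<phi>' \<psi> - \<phi> \<psi>'. All support conditions come from \<phi>, so \<psi> may be a wave
  that does not decay.\<close>

lemma integral_dirderiv2_mult:
  fixes \<phi> \<psi> \<psi>' \<psi>'' :: "'a::euclidean_space \<Rightarrow> complex"
  assumes \<phi>: "\<phi> \<in> Cc_infinity"
    and c: "continuous_on UNIV \<psi>" "continuous_on UNIV \<psi>'" "continuous_on UNIV \<psi>''"
    and d1: "\<And>x t. ((\<lambda>t. \<psi> (x + t *\<^sub>R b)) has_vector_derivative \<psi>' (x + t *\<^sub>R b)) (at t)"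
    and d2: "\<And>x t. ((\<lambda>t. \<psi>' (x + t *\<^sub>R b)) has_vector_derivative \<psi>'' (x + t *\<^sub>R b)) (at t)"
  shows "(LINT x|lborel. dirderiv b (dirderiv b \<phi>) x * \<psi> x) = (LINT x|lborel. \<phi> x * \<psi>'' x)"
proof -
  let ?K = "csupp \<phi>" and ?\<phi>1 = "dirderiv b \<phi>" and ?\<phi>2 = "dirderiv b (dirderiv b \<phi>)"
  have \<phi>1: "?\<phi>1 \<in> Cc_infinity" and \<phi>2: "?\<phi>2 \<in> Cc_infinity"
    using \<phi> by (intro Cc_infinity_dirderiv; simp)+
  have K: "compact ?K"
    using \<phi> by (simp add: Cc_infinity_iff)
  have out: "\<phi> x = 0" "?\<phi>1 x = 0" "?\<phi>2 x = 0" if "x \<notin> ?K" for x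
    using that not_in_csupp[of x \<phi>] dirderiv_not_in_csupp[of x \<phi> b] dirderiv_not_in_csupp[of x ?\<phi>1 b]
      csupp_dirderiv_subset[of \<phi> b] by auto
  note cont = c Cc_infinity_continuous[OF \<phi>] Cc_infinity_continuous[OF \<phi>1] Cc_infinity_continuous[OF \<phi>2]
  have i1: "integrable lborel (\<lambda>x. ?\<phi>2 x * \<psi> x)"
    by (rule integrable_compact_support[OF _ K]) (use cont in \<open>auto intro!: continuous_on_mult simp: out\<close>)
  have i2: "integrable lborel (\<lambda>x. \<phi> x * \<psi>'' x)"
    by (rule integrable_compact_support[OF _ K]) (use cont in \<open>auto intro!: continuous_on_mult simp: out\<close>)
  have "(LINT x|lborel. ?\<phi>2 x * \<psi> x - \<phi> x * \<psi>'' x) = 0"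
  proof (rule integral_directional_derivative_eq_0[where F = "\<lambda>x. ?\<phi>1 x * \<psi> x - \<phi> x * \<psi>' x" and b = b, OF _ _ _ K])
    fix x t
    have "((\<lambda>t. ?\<phi>1 (x + t *\<^sub>R b) * \<psi> (x + t *\<^sub>R b) - \<phi> (x + t *\<^sub>R b) * \<psi>' (x + t *\<^sub>R b)) has_vector_derivative
      (?\<phi>1 (x + t *\<^sub>R b) * \<psi>' (x + t *\<^sub>R b) + ?\<phi>2 (x + t *\<^sub>R b) * \<psi> (x + t *\<^sub>R b)) -
      (\<phi> (x + t *\<^sub>R b) * \<psi>'' (x + t *\<^sub>R b) + ?\<phi>1 (x + t *\<^sub>R b) * \<psi>' (x + t *\<^sub>R b))) (at t)"
      by (intro has_vector_derivative_diff has_vector_derivative_mult d1 d2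
          has_vector_derivative_dirderiv[OF \<phi>] has_vector_derivative_dirderiv[OF \<phi>1])
    then show "((\<lambda>t. ?\<phi>1 (x + t *\<^sub>R b) * \<psi> (x + t *\<^sub>R b) - \<phi> (x + t *\<^sub>R b) * \<psi>' (x + t *\<^sub>R b)) has_vector_derivative
      ?\<phi>2 (x + t *\<^sub>R b) * \<psi> (x + t *\<^sub>R b) - \<phi> (x + t *\<^sub>R b) * \<psi>'' (x + t *\<^sub>R b)) (at t)"
      by (simp add: algebra_simps)
  qed (use cont in \<open>auto intro!: continuous_on_mult continuous_on_diff simp: out\<close>)
  then show ?thesis
    using i1 i2 by simp
qed

lemma partial_deriv_slice:
  assumes "f \<in> Cc_infinity"
  shows "partial_deriv b (\<lambda>y. f (y, z)) = (\<lambda>x. dirderiv (b, 0) f (x, z))"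
    and "partial_deriv c (\<lambda>y. f (x, y)) = (\<lambda>z. dirderiv (0, c) f (x, z))"
  using has_vector_derivative_dirderiv[OF assms, of _ "(b, 0)" 0]
    has_vector_derivative_dirderiv[OF assms, of _ "(0, c)" 0]
  by (auto simp: partial_deriv_def intro!: ext vector_derivative_at)

text \<open>\<open>grushin\<close> differentiates slices; directional derivatives on the product are
  the form to which integration by parts applies.\<close>

lemma grushin_eq:
  assumes f: "f \<in> Cc_infinity"
  shows "grushin f p = - (\<Sum>b\<in>Basis. dirderiv (b, 0) (dirderiv (b, 0) f) p)
    - complex_of_real ((norm (fst p))\<^sup>2) * (\<Sum>b\<in>Basis. dirderiv (0, b) (dirderiv (0, b) f) p)"
  using f by (cases p) (simp add: grushin_def laplacian_def partial_deriv_slice[OF f]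
      partial_deriv_slice[OF Cc_infinity_dirderiv[OF f]])

lemma
  assumes f: "f \<in> Cc_infinity"
  shows grushin_continuous: "continuous_on UNIV (grushin f)"
    and grushin_not_in_csupp: "p \<notin> csupp f \<Longrightarrow> grushin f p = 0"
proof -
  show "continuous_on UNIV (grushin f)"
    unfolding grushin_eq[OF f, abs_def]
    by (intro continuous_intros Cc_infinity_continuous Cc_infinity_dirderiv f)
  show "grushin f p = 0" if "p \<notin> csupp f"
  proof -
    have "dirderiv v (dirderiv v f) p = 0" for v
      using that csupp_dirderiv_subset[of f v] dirderiv_not_in_csupp[of p "dirderiv v f" v] by auto
    then show ?thesis
      by (simp add: grushin_eq[OF f])
  qed
qed

text \<open>The oscillator equation under dilation by \<open>sqrt \<tau>\<close>: two chain-rule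
  factors \<open>sqrt \<tau>\<close> yield the outer \<tau>, and u^2 becomes \<tau> t^2.\<close>

lemma has_real_derivative_hermite1_scaled:
  fixes \<tau> :: real
  defines "h' n t \<equiv> \<tau> powr (1 / 4) * sqrt \<tau> * hermite1' n (sqrt \<tau> * t)"
  assumes "\<tau> > 0"
  shows "(hermite1_scaled \<tau> n has_real_derivative h' n t) (at t)"
    and "(h' n has_real_derivative \<tau> * (\<tau> * t\<^sup>2 - (2 * real n + 1)) * hermite1_scaled \<tau> n t) (at t)"
proof -
  have s: "((\<lambda>t. sqrt \<tau> * t) has_real_derivative sqrt \<tau>) (at t)"
    by (auto intro!: derivative_eq_intros)
  show "(hermite1_scaled \<tau> n has_real_derivative h' n t) (at t)"
    unfolding hermite1_scaled_def[abs_def] h'_def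
    by (rule DERIV_cong[OF DERIV_cmult[OF DERIV_chain2[OF DERIV_hermite1 s]]]) simp
  show "(h' n has_real_derivative \<tau> * (\<tau> * t\<^sup>2 - (2 * real n + 1)) * hermite1_scaled \<tau> n t) (at t)"
    unfolding hermite1_scaled_def[abs_def] h'_def[abs_def]
    by (rule DERIV_cong[OF DERIV_cmult[OF DERIV_chain2[OF DERIV_hermite1' s]]])
      (use \<open>\<tau> > 0\<close> in \<open>simp add: power_mult_distrib\<close>)
qed

section \<open>The operator on test functions\<close>

lemma hermite_scaled_remove:
  "hermite_scaled k \<tau> x = hermite1_scaled \<tau> (k $ j) (x $ j) * (\<Prod>i\<in>UNIV - {j}. hermite1_scaled \<tau> (k $ i) (x $ i))"
  unfolding hermite_scaled_eq by (rule prod.remove) auto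

lemma continuous_hermite1_scaled [continuous_intros]:
  "continuous_on A f \<Longrightarrow> continuous_on A (\<lambda>x. hermite1_scaled \<tau> n (f x))"
  unfolding hermite1_scaled_def by (intro continuous_intros)

lemma continuous_hermite_scaled [continuous_intros]:
  "continuous_on A f \<Longrightarrow> continuous_on A (\<lambda>x. hermite_scaled k \<tau> (f x))"
  unfolding hermite_scaled_eq by (intro continuous_intros)

text \<open>The Hermite factor is real and the exponential carries the sign of the Fourier kernel,
  so pairing with the wave without conjugation yields \<open>G_transform\<close> up to the
  normalising factor.\<close>

definition hermite_wave :: "nat ^ 'm \<Rightarrow> real ^ 'n \<Rightarrow> (real ^ 'm) \<times> (real ^ 'n) \<Rightarrow> complex" where
  "hermite_wave k \<xi> p = complex_of_real (hermite_scaled k (norm \<xi>) (fst p)) * exp (- \<i> * complex_of_real (\<xi> \<bullet> snd p))"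

lemma continuous_hermite_wave: "continuous_on UNIV (hermite_wave k \<xi>)"
  unfolding hermite_wave_def[abs_def] by (intro continuous_intros)

text \<open>Along the axis j only the factor with index \<open>k $ j\<close> varies, so the
  one-dimensional oscillator equation applies and the other factors are constants.\<close>

lemma integral_dirderiv2_fst_hermite_wave:
  fixes \<phi> :: "(real ^ 'm) \<times> (real ^ 'n) \<Rightarrow> complex" and j :: 'm
  assumes \<phi>: "\<phi> \<in> Cc_infinity" and \<xi>: "\<xi> \<noteq> 0"
  defines "b \<equiv> (axis j 1, 0)"
  shows "(LINT p|lborel. dirderiv b (dirderiv b \<phi>) p * hermite_wave k \<xi> p) =
    (LINT p|lborel. \<phi> p * (complex_of_real (norm \<xi> * (norm \<xi> * (fst p $ j)\<^sup>2 - (2 * real (k $ j) + 1))) * hermite_wave k \<xi> p))"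
proof -
  define \<tau> where "\<tau> = norm \<xi>"
  have \<tau>: "\<tau> > 0" using \<xi> by (simp add: \<tau>_def)
  let ?h = "hermite1_scaled \<tau> (k $ j)"
  let ?h' = "\<lambda>t. \<tau> powr (1 / 4) * sqrt \<tau> * hermite1' (k $ j) (sqrt \<tau> * t)"
  let ?R = "\<lambda>x :: real ^ 'm. \<Prod>i\<in>UNIV - {j}. hermite1_scaled \<tau> (k $ i) (x $ i)"
  let ?e = "\<lambda>p :: (real ^ 'm) \<times> (real ^ 'n). exp (- \<i> * complex_of_real (\<xi> \<bullet> snd p))"
  have wave: "hermite_wave k \<xi> p = complex_of_real (?h (fst p $ j)) * (complex_of_real (?R (fst p)) * ?e p)" for p
    by (simp add: hermite_wave_def hermite_scaled_remove[of k _ _ j] \<tau>_def)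
  have shift: "fst (p + t *\<^sub>R b) $ j = fst p $ j + t" "?R (fst (p + t *\<^sub>R b)) = ?R (fst p)" "snd (p + t *\<^sub>R b) = snd p"
    for p :: "(real ^ 'm) \<times> (real ^ 'n)" and t
    by (auto simp: b_def axis_def intro!: prod.cong)
  have D: "((\<lambda>t. complex_of_real (f (fst (p + t *\<^sub>R b) $ j)) * (complex_of_real (?R (fst (p + t *\<^sub>R b))) * ?e (p + t *\<^sub>R b)))
      has_vector_derivative complex_of_real (f' (fst (p + t *\<^sub>R b) $ j)) * (complex_of_real (?R (fst (p + t *\<^sub>R b))) * ?e (p + t *\<^sub>R b))) (at t)"
    if "\<And>s. (f has_real_derivative f' s) (at s)" for f f' :: "real \<Rightarrow> real" and p t
  proof -
    have "((\<lambda>t. f (fst p $ j + t)) has_real_derivative f' (fst p $ j + t)) (at t)"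
      using that[of "fst p $ j + t"] by (simp add: DERIV_shift add.commute)
    then have "((\<lambda>t. complex_of_real (f (fst p $ j + t))) has_vector_derivative complex_of_real (f' (fst p $ j + t))) (at t)"
      by (rule has_vector_derivative_of_real)
    then show ?thesis
      unfolding shift by (rule has_vector_derivative_mult_left)
  qed
  have "(LINT p|lborel. dirderiv b (dirderiv b \<phi>) p * hermite_wave k \<xi> p) =
    (LINT p|lborel. \<phi> p * (complex_of_real (\<tau> * (\<tau> * (fst p $ j)\<^sup>2 - (2 * real (k $ j) + 1)) * ?h (fst p $ j)) * (complex_of_real (?R (fst p)) * ?e p)))"
    unfolding wave
  proof (rule integral_dirderiv2_mult[where \<psi>' = "\<lambda>p. complex_of_real (?h' (fst p $ j)) * (complex_of_real (?R (fst p)) * ?e p)", OF \<phi>])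
    fix p :: "(real ^ 'm) \<times> (real ^ 'n)" and t
    show "((\<lambda>t. complex_of_real (?h (fst (p + t *\<^sub>R b) $ j)) * (complex_of_real (?R (fst (p + t *\<^sub>R b))) * ?e (p + t *\<^sub>R b)))
      has_vector_derivative complex_of_real (?h' (fst (p + t *\<^sub>R b) $ j)) * (complex_of_real (?R (fst (p + t *\<^sub>R b))) * ?e (p + t *\<^sub>R b))) (at t)"
      by (rule D) (rule has_real_derivative_hermite1_scaled(1)[OF \<tau>])
    show "((\<lambda>t. complex_of_real (?h' (fst (p + t *\<^sub>R b) $ j)) * (complex_of_real (?R (fst (p + t *\<^sub>R b))) * ?e (p + t *\<^sub>R b)))
      has_vector_derivative complex_of_real (\<tau> * (\<tau> * (fst (p + t *\<^sub>R b) $ j)\<^sup>2 - (2 * real (k $ j) + 1)) * ?h (fst (p + t *\<^sub>R b) $ j)) * (complex_of_real (?R (fst (p + t *\<^sub>R b))) * ?e (p + t *\<^sub>R b))) (at t)"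
      by (rule D) (rule has_real_derivative_hermite1_scaled(2)[OF \<tau>])
  qed (intro continuous_intros)+
  then show ?thesis
    unfolding wave \<tau>_def[symmetric] by (simp only: of_real_mult mult.assoc)
qed

text \<open>Along (0, c) both |x'|^2 and the Hermite factor are constant. Putting |x'|^2 on the side
  of the wave leaves a plain second derivative of \<phi>, and two derivatives of the exponential
  contribute -(\<xi> . c)^2.\<close>

lemma integral_dirderiv2_snd_hermite_wave:
  fixes \<phi> :: "(real ^ 'm) \<times> (real ^ 'n) \<Rightarrow> complex" and c :: "real ^ 'n"
  assumes \<phi>: "\<phi> \<in> Cc_infinity"
  defines "b \<equiv> (0, c)"
  shows "(LINT p|lborel. dirderiv b (dirderiv b \<phi>) p * (complex_of_real ((norm (fst p))\<^sup>2) * hermite_wave k \<xi> p)) =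
    (LINT p|lborel. \<phi> p * (complex_of_real (- ((\<xi> \<bullet> c)\<^sup>2 * (norm (fst p))\<^sup>2)) * hermite_wave k \<xi> p))"
proof -
  let ?A = "\<lambda>p :: (real ^ 'm) \<times> (real ^ 'n). complex_of_real ((norm (fst p))\<^sup>2) * complex_of_real (hermite_scaled k (norm \<xi>) (fst p))"
  let ?e = "\<lambda>p :: (real ^ 'm) \<times> (real ^ 'n). exp (- \<i> * complex_of_real (\<xi> \<bullet> snd p))"
  let ?a = "- \<i> * complex_of_real (\<xi> \<bullet> c)"
  have wave: "complex_of_real ((norm (fst p))\<^sup>2) * hermite_wave k \<xi> p = ?A p * ?e p" for p
    by (simp add: hermite_wave_def)
  \<comment> \<open>The scalar z lets one rule serve both derivatives, with z = 1 and then z =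
    \<open>?a * 1\<close>.\<close>
  have D: "((\<lambda>t. z * ?A (p + t *\<^sub>R b) * ?e (p + t *\<^sub>R b)) has_vector_derivative (?a * z) * ?A (p + t *\<^sub>R b) * ?e (p + t *\<^sub>R b)) (at t)"
    for z p t
  proof -
    have "((\<lambda>w. exp (- \<i> * (complex_of_real (\<xi> \<bullet> snd p) + w * complex_of_real (\<xi> \<bullet> c)))) has_field_derivative
        exp (- \<i> * (complex_of_real (\<xi> \<bullet> snd p) + complex_of_real t * complex_of_real (\<xi> \<bullet> c))) * ?a) (at (complex_of_real t))"
      by (auto intro!: derivative_eq_intros)
    from has_vector_derivative_mult_right[OF has_vector_derivative_real_field[OF this], of "z * ?A p"]
    show ?thesis
      by (simp add: b_def inner_add_right algebra_simps)
  qed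
  have "(LINT p|lborel. dirderiv b (dirderiv b \<phi>) p * (1 * ?A p * ?e p)) = (LINT p|lborel. \<phi> p * ((?a * (?a * 1)) * ?A p * ?e p))"
    by (rule integral_dirderiv2_mult[where \<psi>' = "\<lambda>p. (?a * 1) * ?A p * ?e p", OF \<phi> _ _ _ D D])
      (intro continuous_intros)+
  moreover have "(?a * (?a * 1)) * ?A p * ?e p = complex_of_real (- ((\<xi> \<bullet> c)\<^sup>2 * (norm (fst p))\<^sup>2)) * hermite_wave k \<xi> p" for p
  proof -
    have "?a * (?a * 1) = complex_of_real (- ((\<xi> \<bullet> c)\<^sup>2))"
      by (simp add: complex_eq_iff power2_eq_square)
    then show ?thesis
      by (simp only:) (simp add: hermite_wave_def)
  qed
  ultimately show ?thesis
    unfolding wave by simp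
qed

lemma sum_Basis_vec: "(\<Sum>b\<in>(Basis :: (real ^ 'm) set). F b) = (\<Sum>j\<in>UNIV. F (axis j 1))"
proof -
  have inj: "inj (\<lambda>j::'m. axis j (1::real))"
    by (auto simp: inj_on_def axis_eq_axis)
  have B: "(Basis :: (real ^ 'm) set) = range (\<lambda>j. axis j 1)"
    by (auto simp: Basis_vec_def)
  show ?thesis
    unfolding B by (simp add: sum.reindex[OF inj])
qed

text \<open>Summed over j, the oscillator terms give |\<xi>|^2 |x'|^2 -
  \<open>Theta (k, \<xi>)\<close>; summed over the basis, the frequencies give -|\<xi>|^2 |x'|^2.
  With the signs of the operator the quadratic parts cancel and the eigenvalue remains.\<close>

lemma integral_grushin_hermite_wave:
  fixes \<phi> :: "(real ^ 'm) \<times> (real ^ 'n) \<Rightarrow> complex"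
  assumes \<phi>: "\<phi> \<in> Cc_infinity" and \<xi>: "\<xi> \<noteq> 0"
  shows "(LINT p|lborel. grushin \<phi> p * hermite_wave k \<xi> p) =
    complex_of_real (Theta (k, \<xi>)) * (LINT p|lborel. \<phi> p * hermite_wave k \<xi> p)"
proof -
  let ?W = "hermite_wave k \<xi>" and ?N = "\<lambda>p :: (real ^ 'm) \<times> (real ^ 'n). (norm (fst p))\<^sup>2"
  let ?D = "\<lambda>b. dirderiv b (dirderiv b \<phi>)"
  let ?a = "\<lambda>j p. norm \<xi> * (norm \<xi> * (fst p $ j)\<^sup>2 - (2 * real (k $ j) + 1))"
  have K: "compact (csupp \<phi>)"
    using \<phi> by (simp add: Cc_infinity_iff)
  have D: "?D b \<in> Cc_infinity" for b
    by (intro Cc_infinity_dirderiv \<phi>)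
  have D0: "?D b p = 0" if "p \<notin> csupp \<phi>" for b p
    using that csupp_dirderiv_subset[of \<phi> b] dirderiv_not_in_csupp[of p "dirderiv b \<phi>" b] by auto
  note cont = continuous_hermite_wave[of k \<xi>] Cc_infinity_continuous[OF \<phi>] Cc_infinity_continuous[OF D]
  have i1: "integrable lborel (\<lambda>p. ?D b p * ?W p)" for b
    by (rule integrable_compact_support[OF _ K]) (auto intro!: continuous_on_mult cont simp: D0)
  have i2: "integrable lborel (\<lambda>p. ?D b p * (complex_of_real (?N p) * ?W p))" for b
    by (rule integrable_compact_support[OF _ K]) (auto intro!: continuous_on_mult cont continuous_intros simp: D0)
  have i3: "integrable lborel (\<lambda>p. \<phi> p * (complex_of_real (?a j p) * ?W p))" for j
    by (rule integrable_compact_support[OF _ K])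
      (auto intro!: continuous_on_mult cont continuous_intros simp: not_in_csupp)
  have i4: "integrable lborel (\<lambda>p. \<phi> p * (complex_of_real (- ((\<xi> \<bullet> c)\<^sup>2 * ?N p)) * ?W p))" for c
    by (rule integrable_compact_support[OF _ K])
      (auto intro!: continuous_on_mult cont continuous_intros simp: not_in_csupp)
  have eq: "grushin \<phi> p * ?W p = - (\<Sum>j\<in>UNIV. ?D (axis j 1, 0) p * ?W p)
      - (\<Sum>c\<in>Basis. ?D (0, c) p * (complex_of_real (?N p) * ?W p))" for p
    unfolding grushin_eq[OF \<phi>] sum_Basis_vec[where 'm = 'm]
    by (simp add: algebra_simps sum_distrib_left)
  have "(LINT p|lborel. grushin \<phi> p * ?W p) = - (\<Sum>j\<in>UNIV. LINT p|lborel. ?D (axis j 1, 0) p * ?W p)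
      - (\<Sum>c\<in>Basis. LINT p|lborel. ?D (0, c) p * (complex_of_real (?N p) * ?W p))"
    unfolding eq using i1 i2
    by (simp only: Bochner_Integration.integral_diff Bochner_Integration.integral_minus Bochner_Integration.integral_sum
        Bochner_Integration.integrable_sum Bochner_Integration.integrable_minus)
  also have "\<dots> = - (\<Sum>j\<in>UNIV. LINT p|lborel. \<phi> p * (complex_of_real (?a j p) * ?W p))
      - (\<Sum>c\<in>Basis. LINT p|lborel. \<phi> p * (complex_of_real (- ((\<xi> \<bullet> c)\<^sup>2 * ?N p)) * ?W p))"
    by (simp only: integral_dirderiv2_fst_hermite_wave[OF \<phi> \<xi>] integral_dirderiv2_snd_hermite_wave[OF \<phi>])
  also have "\<dots> = (LINT p|lborel. - (\<Sum>j\<in>UNIV. \<phi> p * (complex_of_real (?a j p) * ?W p))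
      - (\<Sum>c\<in>Basis. \<phi> p * (complex_of_real (- ((\<xi> \<bullet> c)\<^sup>2 * ?N p)) * ?W p)))"
    using i3 i4
    by (simp only: Bochner_Integration.integral_diff Bochner_Integration.integral_minus Bochner_Integration.integral_sum
        Bochner_Integration.integrable_sum Bochner_Integration.integrable_minus)
  also have "\<dots> = (LINT p|lborel. complex_of_real (Theta (k, \<xi>)) * (\<phi> p * ?W p))"
  proof (rule Bochner_Integration.integral_cong)
    fix p :: "(real ^ 'm) \<times> (real ^ 'n)"
    have N: "?N p = (\<Sum>j\<in>UNIV. (fst p $ j)\<^sup>2)"
      by (simp add: power2_norm_eq_inner inner_vec_def power2_eq_square[of "_ $ _"])
    have X: "(norm \<xi>)\<^sup>2 = (\<Sum>c\<in>Basis. (\<xi> \<bullet> c)\<^sup>2)"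
      unfolding power2_norm_eq_inner by (subst euclidean_inner) (simp add: power2_eq_square)
    have "(\<Sum>j\<in>UNIV. ?a j p) = (norm \<xi>)\<^sup>2 * ?N p - Theta (k, \<xi>)"
      unfolding N Theta_def
      by (simp add: right_diff_distrib sum_subtractf sum.distrib sum_distrib_left sum_distrib_right power2_eq_square algebra_simps)
    moreover have "(\<Sum>c\<in>Basis. - ((\<xi> \<bullet> c)\<^sup>2 * ?N p)) = - ((norm \<xi>)\<^sup>2 * ?N p)"
      unfolding X by (simp add: sum_negf sum_distrib_right)
    ultimately have "- (\<Sum>j\<in>UNIV. ?a j p) - (\<Sum>c\<in>Basis. - ((\<xi> \<bullet> c)\<^sup>2 * ?N p)) = Theta (k, \<xi>)"
      by simp
    then have "complex_of_real (Theta (k, \<xi>)) = - (\<Sum>j\<in>UNIV. complex_of_real (?a j p)) - (\<Sum>c\<in>Basis. complex_of_real (- ((\<xi> \<bullet> c)\<^sup>2 * ?N p)))"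
      by (simp only: of_real_sum[symmetric] of_real_minus[symmetric] of_real_diff[symmetric])
    then show "- (\<Sum>j\<in>UNIV. \<phi> p * (complex_of_real (?a j p) * ?W p))
      - (\<Sum>c\<in>Basis. \<phi> p * (complex_of_real (- ((\<xi> \<bullet> c)\<^sup>2 * ?N p)) * ?W p)) = complex_of_real (Theta (k, \<xi>)) * (\<phi> p * ?W p)"
      by (simp only: left_diff_distrib sum_distrib_left[symmetric] sum_distrib_right[symmetric] mult_minus_left mult_minus_right mult.left_commute[of "\<phi> p"])
  qed simp
  finally show ?thesis
    by (simp only: integral_mult_right_zero)
qed

text \<open>Here the choices become explicit integrals: slicewise Fourier integrals identify
  \<open>partial_fourier f\<close>, and Fubini joins the integrals over x' and x''. The exceptional
  \<xi> come from that identification alone, so one null set serves all k.\<close>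

lemma G_transform_compact_support:
  fixes f :: "(real ^ 'm) \<times> (real ^ 'n) \<Rightarrow> complex"
  assumes f: "continuous_on UNIV f" and K: "compact K" and 0: "\<And>p. p \<notin> K \<Longrightarrow> f p = 0"
  shows "AE \<xi> in lborel. \<forall>k. G_transform f (k, \<xi>) =
    complex_of_real ((2 * pi) powr (- real CARD('n) / 2)) * (LINT p|lborel. f p * hermite_wave k \<xi> p)"
proof -
  have f_L2: "f \<in> L2 lborel"
    by (rule L2_compact_support[OF f K 0])
  have [measurable]: "f \<in> borel_measurable (borel \<Otimes>\<^sub>M borel)"
    using borel_measurable_continuous_onI[OF f] by (simp add: borel_prod)
  define v where "v = (\<lambda>(x, \<xi>). fourier_integral (\<lambda>y. f (x, y)) \<xi>)"
  have "v \<in> borel_measurable (borel \<Otimes>\<^sub>M borel)"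
    unfolding v_def fourier_integral_def by measurable
  then have vm: "v \<in> borel_measurable borel"
    by (simp add: borel_prod)
  have K2: "compact (snd ` K)"
    by (intro compact_continuous_image K continuous_intros)
  have slice: "continuous_on UNIV (\<lambda>y. f (x, y))" "y \<notin> snd ` K \<Longrightarrow> f (x, y) = 0" for x y
    using 0[of "(x, y)"] image_eqI[of y snd "(x, y)" K]
    by (auto intro!: continuous_on_compose2[OF f] continuous_intros)
  have "is_fourier_L2 (\<lambda>y. f (x, y)) (\<lambda>\<xi>. v (x, \<xi>))" for x
    unfolding v_def prod.case
    using integrable_compact_support[OF slice(1) K2 slice(2)] L2_compact_support[OF slice(1) K2 slice(2)]
    by (rule is_fourier_L2_fourier_integral)
  then have "AE p in lborel. partial_fourier f p = v p"
    by (intro partial_fourier_eq[OF f_L2 vm]) simp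
  moreover have pm: "partial_fourier f \<in> borel_measurable borel"
    using partial_fourier_L2[OF f_L2] by (simp add: L2_def)
  ultimately have "AE \<xi> in lborel. AE x in lborel. partial_fourier f (x, \<xi>) = v (x, \<xi>)"
    using AE_lborel_prod_iff(2)[OF pm vm] by simp
  then show ?thesis
  proof eventually_elim
    fix \<xi> :: "real ^ 'n"
    assume ae: "AE x in lborel. partial_fourier f (x, \<xi>) = v (x, \<xi>)"
    let ?c = "complex_of_real ((2 * pi) powr (- real CARD('n) / 2))"
    show "\<forall>k. G_transform f (k, \<xi>) = ?c * (LINT p|lborel. f p * hermite_wave k \<xi> p)"
    proof
      fix k :: "nat ^ 'm"
      let ?h = "\<lambda>x. complex_of_real (hermite_scaled k (norm \<xi>) x)"
      have int: "integrable lborel (\<lambda>p. f p * hermite_wave k \<xi> p)"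
        by (rule integrable_compact_support[OF _ K]) (auto intro!: continuous_on_mult f continuous_hermite_wave simp: 0)
      have slice_eq: "v (x, \<xi>) * ?h x = ?c * (LINT y|lborel. f (x, y) * hermite_wave k \<xi> (x, y))" for x
      proof -
        have "v (x, \<xi>) * ?h x = ?c * ((LINT y|lborel. f (x, y) * exp (- \<i> * complex_of_real (\<xi> \<bullet> y))) * ?h x)"
          by (simp add: v_def fourier_integral_def)
        also have "\<dots> = ?c * (LINT y|lborel. (f (x, y) * exp (- \<i> * complex_of_real (\<xi> \<bullet> y))) * ?h x)"
          by (simp only: integral_mult_left_zero)
        finally show ?thesis
          by (simp add: hermite_wave_def ac_simps)
      qed
      have "G_transform f (k, \<xi>) = (LINT x|lborel. partial_fourier f (x, \<xi>) * ?h x)"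
        by (simp add: G_transform_def hermite_transform_def L2_inner_def)
      also have "\<dots> = (LINT x|lborel. v (x, \<xi>) * ?h x)"
      proof (rule integral_cong_AE)
        show "(\<lambda>x. partial_fourier f (x, \<xi>) * ?h x) \<in> borel_measurable lborel" "(\<lambda>x. v (x, \<xi>) * ?h x) \<in> borel_measurable lborel"
          using slice_measurable'[OF pm] slice_measurable'[OF vm] by simp_all
        show "AE x in lborel. partial_fourier f (x, \<xi>) * ?h x = v (x, \<xi>) * ?h x"
          using ae by eventually_elim simp
      qed
      also have "\<dots> = (LINT x|lborel. ?c * (LINT y|lborel. f (x, y) * hermite_wave k \<xi> (x, y)))"
        unfolding slice_eq ..
      also have "\<dots> = ?c * (LINT x|lborel. (LINT y|lborel. f (x, y) * hermite_wave k \<xi> (x, y)))"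
        by simp
      also have "(LINT x|lborel. (LINT y|lborel. f (x, y) * hermite_wave k \<xi> (x, y))) = (LINT p|lborel. f p * hermite_wave k \<xi> p)"
        using lborel_pair.integral_fst'[of "\<lambda>p. f p * hermite_wave k \<xi> p"] int by (simp add: lborel_prod)
      finally show "G_transform f (k, \<xi>) = ?c * (LINT p|lborel. f p * hermite_wave k \<xi> p)" .
    qed
  qed
qed

text \<open>\<open>grushin \<phi>\<close> is again continuous and vanishes off the support of
  \<phi>, so both transforms are integrals against the same waves and differ by the eigenvalue.
  Square-integrability of \<Theta> times the transform of \<phi> is inherited from
  \<open>G_transform_L2\<close> applied to \<open>grushin \<phi>\<close>.\<close>

lemma G_transform_grushin:
  fixes \<phi> :: "(real ^ 'm) \<times> (real ^ 'n) \<Rightarrow> complex"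
  assumes \<phi>: "\<phi> \<in> Cc_infinity"
  shows "AE p in Gamma_measure. G_transform (grushin \<phi>) p = mult_Theta (G_transform \<phi>) p"
    and "mult_Theta (G_transform \<phi>) \<in> L2 Gamma_measure"
    and "\<phi> \<in> L2 lborel" and "grushin \<phi> \<in> L2 lborel"
proof -
  have K: "compact (csupp \<phi>)"
    using \<phi> by (simp add: Cc_infinity_iff)
  show \<phi>_L2: "\<phi> \<in> L2 lborel"
    by (rule L2_compact_support[OF Cc_infinity_continuous[OF \<phi>] K not_in_csupp[of _ \<phi>]])
  show g_L2: "grushin \<phi> \<in> L2 lborel"
    by (rule L2_compact_support[OF grushin_continuous[OF \<phi>] K grushin_not_in_csupp[OF \<phi>]])
  let ?Gg = "G_transform (grushin \<phi>)" and ?T = "mult_Theta (G_transform \<phi>)"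
  interpret C: sigma_finite_measure "count_space (UNIV :: (nat ^ 'm) set)"
    by (rule sigma_finite_measure_count_space)
  interpret P: pair_sigma_finite "count_space (UNIV :: (nat ^ 'm) set)" "lborel :: (real ^ 'n) measure" ..
  let ?c = "complex_of_real ((2 * pi) powr (- real CARD('n) / 2))"
  have "AE \<xi> in lborel. \<forall>k. G_transform \<phi> (k, \<xi>) = ?c * (LINT p|lborel. \<phi> p * hermite_wave k \<xi> p)"
    by (rule G_transform_compact_support[OF Cc_infinity_continuous[OF \<phi>] K]) (rule not_in_csupp)
  moreover have "AE \<xi> in lborel. \<forall>k. ?Gg (k, \<xi>) = ?c * (LINT p|lborel. grushin \<phi> p * hermite_wave k \<xi> p)"
    by (rule G_transform_compact_support[OF grushin_continuous[OF \<phi>] K]) (rule grushin_not_in_csupp[OF \<phi>])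
  ultimately have ae: "AE \<xi> in lborel. ?Gg (k, \<xi>) = ?T (k, \<xi>)" for k
    \<comment> \<open>The eigenvalue relation is available for \<xi> \<noteq> 0.\<close>
    using AE_lborel_singleton[of 0]
    by eventually_elim (simp add: integral_grushin_hermite_wave[OF \<phi>] mult_Theta_def)
  have Gg_m: "?Gg \<in> borel_measurable (count_space UNIV \<Otimes>\<^sub>M lborel)"
    and G\<phi>_m: "G_transform \<phi> \<in> borel_measurable (count_space UNIV \<Otimes>\<^sub>M lborel)"
    using G_transform_L2[OF g_L2] G_transform_L2[OF \<phi>_L2] by (simp_all add: L2_def Gamma_measure_def)
  have "(Theta :: (nat ^ 'm) \<times> (real ^ 'n) \<Rightarrow> real) \<in> borel_measurable (count_space UNIV \<Otimes>\<^sub>M lborel)"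
    by (rule measurable_pair_measure_countable1) (simp_all add: Theta_def)
  then have T_m: "?T \<in> borel_measurable (count_space UNIV \<Otimes>\<^sub>M lborel)"
    unfolding mult_Theta_def using G\<phi>_m by measurable
  have "AE p in count_space UNIV \<Otimes>\<^sub>M lborel. ?Gg p = ?T p"
  proof (rule P.AE_pair_measure)
    show "{p \<in> space (count_space UNIV \<Otimes>\<^sub>M lborel). ?Gg p = ?T p} \<in> sets (count_space UNIV \<Otimes>\<^sub>M lborel)"
      using Gg_m T_m by measurable
  qed (simp add: ae AE_count_space)
  then show AE: "AE p in Gamma_measure. ?Gg p = ?T p"
    unfolding Gamma_measure_def .
  show "?T \<in> L2 Gamma_measure"
    by (rule L2_cong_AE[OF G_transform_L2[OF g_L2] _ AE]) (simp add: Gamma_measure_def T_m)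
qed

theorem proposition4p1:
  shows "(Cc_infinity :: ((real ^ 'm) \<times> (real ^ 'n) \<Rightarrow> complex) set) \<subseteq> Dom_GG
    \<and> (\<forall>\<phi> \<in> (Cc_infinity :: ((real ^ 'm) \<times> (real ^ 'n) \<Rightarrow> complex) set).
         AE x in lborel. GG \<phi> x = grushin \<phi> x)"
proof (intro conjI subsetI ballI)
  fix \<phi> :: "(real ^ 'm) \<times> (real ^ 'n) \<Rightarrow> complex"
  assume \<phi>: "\<phi> \<in> Cc_infinity"
  note G = G_transform_grushin[OF \<phi>]
  show "\<phi> \<in> Dom_GG"
    using G by (simp add: Dom_GG_def)
  let ?Q = "\<lambda>f. f \<in> L2 lborel \<and> (AE p in Gamma_measure. G_transform f p = mult_Theta (G_transform \<phi>) p)"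
  have "?Q (grushin \<phi>)"
    using G by simp
  then have "?Q (GG \<phi>)"
    unfolding GG_def G_transform_inv_def o_def by (rule someI[where P = ?Q])
  then have L2: "GG \<phi> \<in> L2 lborel" and eq: "AE p in Gamma_measure. G_transform (GG \<phi>) p = mult_Theta (G_transform \<phi>) p"
    by auto
  show "AE x in lborel. GG \<phi> x = grushin \<phi> x"
  proof (rule G_transform_injective[OF L2 G(4)])
    show "AE p in Gamma_measure. G_transform (GG \<phi>) p = G_transform (grushin \<phi>) p"
      using eq G(1) by eventually_elim simp
  qed
qed

end
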